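(* Let $p,m\ge1$, $\sigma>0$ and $\Sigma\in\mathbb{R}^{p\times p}$ a covariance matrix. For $B\in\mathbb{R}^{p\times m}$ let $P_B$ be the law of $(X,Y)\in\mathbb{R}^p\times\mathbb{R}^m$ with $X\sim N(0,\Sigma)$ and $Y\mid X\sim N(B^TX,\sigma^2I_m)$. For $\epsilon\in[0,1)$ and arbitrary $Q$, let $(X_1,Y_1),\dots,(X_n,Y_n)$ be i.i.d. from $\mathbb{P}_{(\epsilon,B,Q)}=(1-\epsilon)P_B+\epsilon Q$. For $\mathcal{U}\subset\mathbb{R}^{p\times m}\setminus\{0\}$ and a distribution $\mathbb{P}$ of $(X,Y)$ define the multivariate regression depth $\mathcal{D}_{\mathcal{U}}(B,\mathbb{P})=\inf_{U\in\mathcal{U}}\mathbb{P}\{\langle U^TX,Y-B^TX\rangle\ge0\}$, and let $\widehat B$ be any maximizer over $B\in\mathbb{R}^{p\times m}$ of $\mathcal{D}_{\mathbb{R}^{p\times m}\setminus\{0\}}(B,\mathbb{P}_n)$, $\mathbb{P}_n$ the empirical measure. Let $\kappa=\inf_{v\ne0}\|\Sigma^{1/2}v\|/\|v\|$. Then there exist absolute constants $c_0,C,C'>0$ such that whenever $\epsilon^2+\frac{pm}{n}\le c_0$, $$\mathrm{Tr}\big((\widehat B-B)^T\Sigma(\widehat B-B)\big)\le C\sigma^2\Big(\frac{pm}{n}\vee\epsilon^2\Big),\qquad \|\widehat B-B\|_{\rm F}^2\le C\frac{\sigma^2}{\kappa^2}\Big(\frac{pm}{n}\vee\epsilon^2\Big),$$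 with $\mathbb{P}_{(\epsilon,B,Q)}$-probability at least $1-\exp(-C'(pm+n\epsilon^2))$, uniformly over all $Q$ and $B\in\mathbb{R}^{p\times m}$.
   Context: $\langle\cdot,\cdot\rangle$ is the Euclidean inner product on $\mathbb{R}^m$; $\|\cdot\|_{\rm F}$ the Frobenius norm; $a\vee b=\max(a,b)$. *)

theory Defs
  imports "HOL-Probability.Probability"
begin

text \<open>Dimensions p, m, n vary inside the statement (the constants are absolute), so
vectors in R^k are functions nat => real of which only the indices < k matter, and
matrices in R^(a x b) are functions nat => nat => real of which only the entries (i,j)
with i < a, j < b matter. Random vectors live in the product space over {..<k}.\<close>

definition vec_space :: "nat \<Rightarrow> (nat \<Rightarrow> real) measure" where
  "vec_space k = PiM {..<k} (\<lambda>_. borel)"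

definition data_space :: "nat \<Rightarrow> nat \<Rightarrow> ((nat \<Rightarrow> real) \<times> (nat \<Rightarrow> real)) measure" where
  "data_space p m = vec_space p \<Otimes>\<^sub>M vec_space m"

definition covariance_matrix :: "nat \<Rightarrow> (nat \<Rightarrow> nat \<Rightarrow> real) \<Rightarrow> bool" where
  "covariance_matrix p S \<longleftrightarrow>
     (\<forall>i<p. \<forall>j<p. S i j = S j i) \<and>
     (\<forall>v::nat \<Rightarrow> real. 0 \<le> (\<Sum>i<p. \<Sum>j<p. v i * S i j * v j))"

text \<open>A square root factor A of S: A A^T = S (exists for every covariance matrix).\<close>
definition sqrt_factor :: "nat \<Rightarrow> (nat \<Rightarrow> nat \<Rightarrow> real) \<Rightarrow> (nat \<Rightarrow> nat \<Rightarrow> real)" where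
  "sqrt_factor p S = (SOME A. \<forall>i<p. \<forall>j<p. (\<Sum>k<p. A i k * A j k) = S i j)"

definition std_gauss :: "real measure" where
  "std_gauss = density lborel std_normal_density"

text \<open>P_B: X ~ N(0,S) realised as X = A Z with Z standard Gaussian in R^p, A A^T = S,
and Y = B^T X + sigma W with W standard Gaussian in R^m independent of Z, i.e.
Y | X ~ N(B^T X, sigma^2 I_m).\<close>
definition P_model :: "nat \<Rightarrow> nat \<Rightarrow> (nat \<Rightarrow> nat \<Rightarrow> real) \<Rightarrow> real \<Rightarrow> (nat \<Rightarrow> nat \<Rightarrow> real)
    \<Rightarrow> ((nat \<Rightarrow> real) \<times> (nat \<Rightarrow> real)) measure" where
  "P_model p m S \<sigma> B =
     (let A = sqrt_factor p S in
      distr (PiM {..<p} (\<lambda>_. std_gauss) \<Otimes>\<^sub>M PiM {..<m} (\<lambda>_. std_gauss)) (data_space p m)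
        (\<lambda>(z, w). let x = (\<lambda>i\<in>{..<p}. \<Sum>k<p. A i k * z k)
                  in (x, (\<lambda>j\<in>{..<m}. (\<Sum>i<p. B i j * x i) + \<sigma> * w j))))"

definition mixture :: "real \<Rightarrow> 'a measure \<Rightarrow> 'a measure \<Rightarrow> 'a measure" where
  "mixture \<epsilon> P Q = measure_of (space P) (sets P)
      (\<lambda>A. ennreal (1 - \<epsilon>) * emeasure P A + ennreal \<epsilon> * emeasure Q A)"

definition nonzero_mats :: "nat \<Rightarrow> nat \<Rightarrow> (nat \<Rightarrow> nat \<Rightarrow> real) set" where
  "nonzero_mats p m = {U. (\<forall>i j. (p \<le> i \<or> m \<le> j) \<longrightarrow> U i j = 0) \<and> (\<exists>i<p. \<exists>j<m. U i j \<noteq> 0)}"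

definition reg_inner :: "nat \<Rightarrow> nat \<Rightarrow> (nat \<Rightarrow> nat \<Rightarrow> real) \<Rightarrow> (nat \<Rightarrow> nat \<Rightarrow> real)
    \<Rightarrow> (nat \<Rightarrow> real) \<Rightarrow> (nat \<Rightarrow> real) \<Rightarrow> real" where
  "reg_inner p m U B x y = (\<Sum>j<m. (\<Sum>i<p. U i j * x i) * (y j - (\<Sum>i<p. B i j * x i)))"

definition emp_depth :: "nat \<Rightarrow> nat \<Rightarrow> nat \<Rightarrow> (nat \<Rightarrow> (nat \<Rightarrow> real) \<times> (nat \<Rightarrow> real))
    \<Rightarrow> (nat \<Rightarrow> nat \<Rightarrow> real) \<Rightarrow> real" where
  "emp_depth p m n \<omega> B =
     (INF U\<in>nonzero_mats p m.
        real (card {i\<in>{..<n}. 0 \<le> reg_inner p m U B (fst (\<omega> i)) (snd (\<omega> i))}) / real n)"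

definition is_depth_maximizer :: "nat \<Rightarrow> nat \<Rightarrow> nat \<Rightarrow> (nat \<Rightarrow> (nat \<Rightarrow> real) \<times> (nat \<Rightarrow> real))
    \<Rightarrow> (nat \<Rightarrow> nat \<Rightarrow> real) \<Rightarrow> bool" where
  "is_depth_maximizer p m n \<omega> Bh \<longleftrightarrow> (\<forall>B'. emp_depth p m n \<omega> B' \<le> emp_depth p m n \<omega> Bh)"

definition trace_form :: "nat \<Rightarrow> nat \<Rightarrow> (nat \<Rightarrow> nat \<Rightarrow> real) \<Rightarrow> (nat \<Rightarrow> nat \<Rightarrow> real) \<Rightarrow> real" where
  "trace_form p m S D = (\<Sum>j<m. \<Sum>i<p. \<Sum>k<p. D i j * S i k * D k j)"

definition frob_sq :: "nat \<Rightarrow> nat \<Rightarrow> (nat \<Rightarrow> nat \<Rightarrow> real) \<Rightarrow> real" where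
  "frob_sq p m D = (\<Sum>i<p. \<Sum>j<m. (D i j)\<^sup>2)"

text \<open>kappa = inf_{v \<noteq> 0} |S^{1/2} v| / |v|, using |S^{1/2} v|^2 = v^T S v.\<close>
definition kappa :: "nat \<Rightarrow> (nat \<Rightarrow> nat \<Rightarrow> real) \<Rightarrow> real" where
  "kappa p S = (INF v\<in>{v::nat \<Rightarrow> real. \<exists>i<p. v i \<noteq> 0}.
       sqrt (\<Sum>i<p. \<Sum>k<p. v i * S i k * v k) / sqrt (\<Sum>i<p. (v i)\<^sup>2))"

end

theory Submission
  imports Defs
begin

text \<open>Write \<open>\<Delta> = Bh - B\<close> and \<open>T\<^sup>2 = Tr (\<Delta>\<^sup>T S \<Delta>)\<close>. At \<open>B\<close> itself every halfspace
  \<open>\<langle>U\<^sup>T X, Y - B\<^sup>T X\<rangle> \<ge> 0\<close> has model probability at least 1/2, so by a uniform deviation bound for the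
  \<open>p m\<close>-dimensional class indexed by \<open>U\<close> the empirical depth of \<open>B\<close>, hence of \<open>Bh\<close>, is at least
  \<open>1/2 - \<epsilon> - t\<close> with \<open>t\<^sup>2\<close> of order \<open>p m / n + \<epsilon>\<^sup>2\<close>. Taking \<open>U = \<Delta>\<close> would give a class that is
  quadratic in its parameter; instead \<open>U\<close> ranges over a net, of cardinality exponential in
  \<open>p m\<close>, of the unit sphere in whitened coordinates. For each fixed \<open>U\<close> the class is affine in \<open>Bh\<close>, and for
  \<open>U\<close> close to \<open>\<Delta> / T\<close> the model probability of the halfspace is at most \<open>1/2 - min (T / \<sigma>) 1 / 400\<close>.
  Comparing both bounds gives \<open>T \<le> 800 \<sigma> (\<epsilon> + t)\<close>. A logarithmic factor is avoided in the deviation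
  bound by chaining over packings of the class restricted to the sample.\<close>

section \<open>Set families of bounded VC dimension\<close>

text \<open>With \<open>U\<close> and \<open>Bh\<close> both free, the functions
  \<open>(x, y)\<close> to \<open>reg_inner p m U Bh x y\<close> span all products x_i y_j and x_i
  x_k, so the linear-algebra bound on the VC dimension would be of order p m + p^2 and lose the rate
  when p is much larger than m. Freezing either \<open>B\<close> or \<open>U\<close> leaves an
  affine family of dimension at most p m + 2. The price is a union bound over K^(p m) directions; it
  is absorbed because n t^2 is chosen as a large multiple of p m + n \<epsilon>^2. Given the
  covariate, the gain from a direction V is proportional to |V^T z|, while replacing \<Delta> / T by
  V costs |M^T z| with M the net error. Hence the need for a small-ball estimate for |V^T z| that
  does not depend on the shape of V, and for the tiny net radius 1/100000. The Gaussian tail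
  saturates once T / \<sigma> exceeds 1, so only \<open>min (T / \<sigma>) 1\<close> can be
  controlled. The smallness condition with \<open>c0\<close> makes the right-hand side smaller than
  1, which removes the truncation. All norms are taken after multiplying by A^T, where A A^T = S, so
  that singular S is covered.\<close>

definition shatters :: "'a set set \<Rightarrow> 'a set \<Rightarrow> bool" where
  "shatters F S \<longleftrightarrow> (\<forall>T\<subseteq>S. \<exists>A\<in>F. A \<inter> S = T)"

definition vc_le :: "'a set set \<Rightarrow> nat \<Rightarrow> bool" where
  "vc_le F d \<longleftrightarrow> (\<forall>S. finite S \<longrightarrow> shatters F S \<longrightarrow> card S \<le> d)"

lemma shatters_mono: "shatters F S \<Longrightarrow> F \<subseteq> G \<Longrightarrow> shatters G S"
  unfolding shatters_def by (meson subsetD)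

lemma vc_le_mono: "vc_le G d \<Longrightarrow> F \<subseteq> G \<Longrightarrow> vc_le F d"
  unfolding vc_le_def using shatters_mono by blast

text \<open>Pajor's inequality. Split off a point x: \<open>F0\<close> holds the members without x,
  \<open>F1\<close> those with x, stripped of x. A set shattered by either trace family is shattered
  by \<open>F\<close>, and a set shattered by both remains shattered after adding x. So the
  shattered sets number at least card (s0 Un s1) + card (s0 Int s1) = card s0 + card s1.\<close>

lemma card_le_card_shattered:
  assumes "finite X" "F \<subseteq> Pow X"
  shows "card F \<le> card {S\<in>Pow X. shatters F S}"
  using assms
proof (induction X arbitrary: F rule: finite_induct)
  case empty
  show ?case
  proof (cases "F = {}")
    case False
    then have "F = {{}}" using empty by auto
    then have "{S\<in>Pow {}. shatters F S} = {{}}" by (auto simp: shatters_def)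
    then show ?thesis using \<open>F = {{}}\<close> by simp
  qed simp
next
  case (insert x X)
  define F0 where "F0 = {A\<in>F. x \<notin> A}"
  define F1 where "F1 = (\<lambda>A. A - {x}) ` {A\<in>F. x \<in> A}"
  have finF: "finite F" using insert by (meson finite_Pow_iff finite_insert finite_subset)
  have inj: "inj_on (\<lambda>A. A - {x}) {A\<in>F. x \<in> A}" by (auto simp: inj_on_def)
  have "F = F0 \<union> {A\<in>F. x \<in> A}" by (auto simp: F0_def)
  then have "card F = card F0 + card {A\<in>F. x \<in> A}"
    using finF by (subst card_Un_disjoint[symmetric]) (auto simp: F0_def)
  then have cF: "card F = card F0 + card F1"
    using card_image[OF inj] by (simp add: F1_def)
  define s0 where "s0 = {S\<in>Pow X. shatters F0 S}"
  define s1 where "s1 = {S\<in>Pow X. shatters F1 S}"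
  have fs: "finite s0" "finite s1" using insert by (auto simp: s0_def s1_def)
  have c0: "card F0 \<le> card s0" unfolding s0_def
    by (rule insert.IH) (use insert in \<open>auto simp: F0_def\<close>)
  have c1: "card F1 \<le> card s1" unfolding s1_def
    by (rule insert.IH) (use insert in \<open>auto simp: F1_def\<close>)
  have i: "s0 \<union> s1 \<subseteq> {S\<in>Pow (insert x X). shatters F S}"
  proof (intro Un_least subsetI CollectI conjI)
    fix S assume S: "S \<in> s0"
    show "S \<in> Pow (insert x X)" using S by (auto simp: s0_def)
    have "F0 \<subseteq> F" by (auto simp: F0_def)
    then show "shatters F S" using S unfolding s0_def shatters_def by blast
  next
    fix S assume S: "S \<in> s1"
    show "S \<in> Pow (insert x X)" using S by (auto simp: s1_def)
    have xS: "x \<notin> S" using S insert by (auto simp: s1_def)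
    show "shatters F S" unfolding shatters_def
    proof (intro allI impI)
      fix T assume "T \<subseteq> S"
      then obtain A where "A \<in> F1" "A \<inter> S = T" using S unfolding s1_def shatters_def by blast
      then obtain B where "B \<in> F" "A = B - {x}" by (auto simp: F1_def)
      then show "\<exists>A\<in>F. A \<inter> S = T" using xS \<open>A \<inter> S = T\<close> by (intro bexI[of _ B]) auto
    qed
  qed
  have ii: "insert x ` (s0 \<inter> s1) \<subseteq> {S\<in>Pow (insert x X). shatters F S}"
  proof (intro image_subsetI CollectI conjI)
    fix S assume "S \<in> s0 \<inter> s1"
    then have S: "S \<in> s0" "S \<in> s1" by auto
    show "insert x S \<in> Pow (insert x X)" using S by (auto simp: s0_def)
    have xS: "x \<notin> S" using S insert by (auto simp: s1_def)
    show "shatters F (insert x S)" unfolding shatters_def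
    proof (intro allI impI)
      fix T assume T: "T \<subseteq> insert x S"
      have T': "T - {x} \<subseteq> S" using T by auto
      show "\<exists>A\<in>F. A \<inter> insert x S = T"
      proof (cases "x \<in> T")
        case True
        obtain A where A: "A \<in> F1" "A \<inter> S = T - {x}" using S T' unfolding s1_def shatters_def by blast
        then obtain B where B: "B \<in> F" "x \<in> B" "A = B - {x}" by (auto simp: F1_def)
        show ?thesis using A B True xS by (intro bexI[of _ B]) auto
      next
        case False
        obtain A where A: "A \<in> F0" "A \<inter> S = T - {x}" using S T' unfolding s0_def shatters_def by blast
        then show ?thesis using False by (intro bexI[of _ A]) (auto simp: F0_def)
      qed
    qed
  qed
  have "card F \<le> card s0 + card s1" using c0 c1 cF by simp
  also have "\<dots> = card (s0 \<union> s1) + card (s0 \<inter> s1)" using card_Un_Int[OF fs] .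
  also have "card (s0 \<inter> s1) = card (insert x ` (s0 \<inter> s1))"
  proof (rule card_image[symmetric], rule inj_onI)
    fix S T assume "S \<in> s0 \<inter> s1" "T \<in> s0 \<inter> s1" and e: "insert x S = insert x T"
    then have "x \<notin> S" "x \<notin> T" using insert(2) by (auto simp: s0_def)
    then show "S = T" using e by (simp add: insert_ident)
  qed
  also have "card (s0 \<union> s1) + card (insert x ` (s0 \<inter> s1)) = card ((s0 \<union> s1) \<union> insert x ` (s0 \<inter> s1))"
    by (rule card_Un_disjoint[symmetric]) (use fs insert in \<open>auto simp: s0_def s1_def\<close>)
  also have "\<dots> \<le> card {S\<in>Pow (insert x X). shatters F S}"
    by (rule card_mono) (use i ii insert in \<open>auto\<close>)
  finally show ?case .
qed

lemma sum_Pow_power_card: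
  fixes x :: real
  assumes "finite X"
  shows "(\<Sum>S\<in>Pow X. x ^ card S) = (1 + x) ^ card X"
proof -
  have "(\<Prod>i\<in>X. x + 1) = (\<Sum>S\<in>Pow X. (\<Prod>i\<in>S. x) * (\<Prod>i\<in>X-S. 1))"
    by (rule prod_add[OF assms])
  then show ?thesis by (simp add: add.commute)
qed

text \<open>Instead of a partial binomial sum, each subset S of size at most d is given the weight
  \<open>x ^ card S / x ^ d\<close>, which is at least 1. The free parameter x is what the packing
  bound later tunes.\<close>

lemma sauer_shelah_weighted:
  fixes x :: real
  assumes "finite X" "F \<subseteq> Pow X" "vc_le F d" "0 < x" "x \<le> 1"
  shows "real (card F) \<le> (1 / x) ^ d * (1 + x) ^ card X"
proof -
  have "real (card F) \<le> real (card {S\<in>Pow X. shatters F S})"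
    using card_le_card_shattered[OF assms(1,2)] by simp
  also have "\<dots> \<le> real (card {S\<in>Pow X. card S \<le> d})"
    using assms by (intro of_nat_mono card_mono) (auto simp: vc_le_def dest: finite_subset)
  also have "\<dots> = (\<Sum>S\<in>{S\<in>Pow X. card S \<le> d}. 1)" by simp
  also have "\<dots> \<le> (\<Sum>S\<in>{S\<in>Pow X. card S \<le> d}. (1 / x) ^ d * x ^ card S)"
  proof (rule sum_mono)
    fix S assume "S \<in> {S\<in>Pow X. card S \<le> d}"
    then have "x ^ d \<le> x ^ card S" using assms by (intro power_decreasing) auto
    then show "1 \<le> (1 / x) ^ d * x ^ card S"
      using assms by (simp add: power_divide field_simps)
  qed
  also have "\<dots> \<le> (\<Sum>S\<in>Pow X. (1 / x) ^ d * x ^ card S)"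
    using assms by (intro sum_mono2) auto
  also have "\<dots> = (1 / x) ^ d * (1 + x) ^ card X"
    using sum_Pow_power_card[OF assms(1)] by (simp add: sum_distrib_left[symmetric])
  finally show ?thesis .
qed

text \<open>Greedy choice: some coordinate separates at least the average fraction \<open>\<eta>\<close> of the pairs that
  are not yet separated.\<close>

lemma separating_coordinates:
  fixes \<eta> :: real
  assumes X: "finite X" "X \<noteq> {}" and F: "finite F" "F \<subseteq> Pow X"
    and sep: "\<And>A B. A \<in> F \<Longrightarrow> B \<in> F \<Longrightarrow> A \<noteq> B \<Longrightarrow> \<eta> * card X \<le> card (sym_diff A B)"
    and \<eta>: "0 \<le> \<eta>" "\<eta> \<le> 1"
  shows "\<exists>S\<subseteq>X. card S \<le> q \<and>
    real (card {(A, B)\<in>F \<times> F. A \<noteq> B \<and> A \<inter> S = B \<inter> S}) \<le> (card F)\<^sup>2 * (1 - \<eta>) ^ q"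
proof (induction q)
  case 0
  have "card {(A, B)\<in>F \<times> F. A \<noteq> B \<and> A \<inter> {} = B \<inter> {}} \<le> card (F \<times> F)"
    using F by (intro card_mono) auto
  then show ?case by (intro exI[of _ "{}"]) (simp add: power2_eq_square card_cartesian_product flip: of_nat_mult)
next
  case (Suc q)
  then obtain S where S: "S \<subseteq> X" "card S \<le> q"
    "real (card {(A, B)\<in>F \<times> F. A \<noteq> B \<and> A \<inter> S = B \<inter> S}) \<le> (card F)\<^sup>2 * (1 - \<eta>) ^ q" by blast
  define U where "U = {(A, B)\<in>F \<times> F. A \<noteq> B \<and> A \<inter> S = B \<inter> S}"
  have fU: "finite U" unfolding U_def by (rule finite_subset[of _ "F \<times> F"]) (use F in auto)
  have cX: "card X > 0" using X by (simp add: card_gt_0_iff)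
  have "(\<Sum>x\<in>X. real (card {P\<in>U. x \<in> sym_diff (fst P) (snd P)})) =
        (\<Sum>x\<in>X. \<Sum>P\<in>U. if x \<in> sym_diff (fst P) (snd P) then 1 else 0)"
    using fU by (intro sum.cong refl) (simp add: sum.If_cases Int_def)
  also have "\<dots> = (\<Sum>P\<in>U. \<Sum>x\<in>X. if x \<in> sym_diff (fst P) (snd P) then 1 else 0)"
    by (rule sum.swap)
  also have "\<dots> = (\<Sum>P\<in>U. real (card (sym_diff (fst P) (snd P))))"
  proof (rule sum.cong[OF refl])
    fix P assume "P \<in> U"
    then have "sym_diff (fst P) (snd P) \<subseteq> X" using F(2) unfolding U_def by fastforce
    then have "X \<inter> {x. x \<in> sym_diff (fst P) (snd P)} = sym_diff (fst P) (snd P)" by auto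
    then show "(\<Sum>x\<in>X. if x \<in> sym_diff (fst P) (snd P) then 1 else 0) = real (card (sym_diff (fst P) (snd P)))"
      using X by (simp add: sum.If_cases)
  qed
  also have "\<dots> \<ge> (\<Sum>P\<in>U. \<eta> * card X)"
  proof (rule sum_mono)
    fix P assume "P \<in> U"
    then have "fst P \<in> F" "snd P \<in> F" "fst P \<noteq> snd P" unfolding U_def by (cases P; simp)+
    then show "\<eta> * card X \<le> real (card (sym_diff (fst P) (snd P)))" by (rule sep)
  qed
  finally have avg: "(\<Sum>x\<in>X. \<eta> * card U) \<le> (\<Sum>x\<in>X. real (card {P\<in>U. x \<in> sym_diff (fst P) (snd P)}))"
    by (simp add: algebra_simps)
  have "\<exists>x\<in>X. \<eta> * card U \<le> real (card {P\<in>U. x \<in> sym_diff (fst P) (snd P)})"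
  proof (rule ccontr)
    assume "\<not> ?thesis"
    then have "(\<Sum>x\<in>X. \<eta> * card U) > (\<Sum>x\<in>X. real (card {P\<in>U. x \<in> sym_diff (fst P) (snd P)}))"
      using X by (intro sum_strict_mono) auto
    then show False using avg by simp
  qed
  then obtain x where x: "x \<in> X" "\<eta> * card U \<le> real (card {P\<in>U. x \<in> sym_diff (fst P) (snd P)})" by blast
  define V where "V = {(A, B)\<in>F \<times> F. A \<noteq> B \<and> A \<inter> insert x S = B \<inter> insert x S}"
  have "V \<subseteq> U - {P\<in>U. x \<in> sym_diff (fst P) (snd P)}"
  proof (rule subsetI)
    fix P assume "P \<in> V"
    then obtain A B where P: "P = (A, B)" "A \<in> F" "B \<in> F" "A \<noteq> B"
      and e: "A \<inter> insert x S = B \<inter> insert x S" by (auto simp: V_def)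
    have "A \<inter> S = B \<inter> S" "x \<in> A \<longleftrightarrow> x \<in> B" using e by blast+
    then show "P \<in> U - {P\<in>U. x \<in> sym_diff (fst P) (snd P)}" using P by (auto simp: U_def)
  qed
  then have "card V \<le> card (U - {P\<in>U. x \<in> sym_diff (fst P) (snd P)})"
    using fU by (intro card_mono) auto
  also have "\<dots> = card U - card {P\<in>U. x \<in> sym_diff (fst P) (snd P)}"
    using fU by (intro card_Diff_subset) auto
  finally have "real (card V) \<le> real (card U) - real (card {P\<in>U. x \<in> sym_diff (fst P) (snd P)})"
    using card_mono[OF fU, of "{P\<in>U. x \<in> sym_diff (fst P) (snd P)}"] by (simp add: of_nat_diff)
  then have "real (card V) \<le> (1 - \<eta>) * card U" using x by (simp add: algebra_simps)
  also have "\<dots> \<le> (1 - \<eta>) * ((card F)\<^sup>2 * (1 - \<eta>) ^ q)"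
    using S(3) \<eta> unfolding U_def[symmetric] by (intro mult_left_mono) auto
  finally have "real (card V) \<le> (card F)\<^sup>2 * (1 - \<eta>) ^ Suc q" by (simp add: algebra_simps)
  moreover have "card (insert x S) \<le> Suc q"
    using S X by (metis Suc_le_mono card_insert_le_m1 card_insert_if finite_subset le_SucI)
  ultimately show ?case using S x unfolding V_def by (intro exI[of _ "insert x S"]) auto
qed

text \<open>About 2 ln M / \<eta> greedily chosen coordinates separate all M members, so M is also
  the number of traces on these coordinates, which Sauer-Shelah bounds. The resulting inequality has
  ln M on its right side only through a factor of order sqrt M, which can be divided out. This gives
  the exponent 2 d, with no logarithm; for chaining only the order of d matters.\<close>

lemma packing_bound:
  fixes \<eta> :: real
  assumes X: "finite X" "X \<noteq> {}" and F: "F \<subseteq> Pow X" "vc_le F d"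
    and sep: "\<And>A B. A \<in> F \<Longrightarrow> B \<in> F \<Longrightarrow> A \<noteq> B \<Longrightarrow> \<eta> * card X \<le> card (sym_diff A B)"
    and \<eta>: "0 < \<eta>" "\<eta> \<le> 1" and d: "1 \<le> d"
  shows "real (card F) \<le> (8 / \<eta>) ^ (2 * d)"
proof (cases "F = {}")
  case True then show ?thesis using \<eta> by simp
next
  case False
  have fF: "finite F" using F X by (meson finite_Pow_iff finite_subset)
  define M where "M = real (card F)"
  have M1: "M \<ge> 1" using False fF by (simp add: M_def Suc_leI card_gt_0_iff)
  \<comment> \<open>Chosen so that M^2 exp (- \<eta> q) < 1: the number of unseparated pairs is then
    an integer below 1, hence 0.\<close>
  define q where "q = nat \<lfloor>2 * ln M / \<eta>\<rfloor> + 1"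
  have q1: "real q > 2 * ln M / \<eta>" "real q \<le> 2 * ln M / \<eta> + 1"
  proof -
    have "0 \<le> 2 * ln M / \<eta>" using M1 \<eta> by simp
    then show "real q > 2 * ln M / \<eta>" "real q \<le> 2 * ln M / \<eta> + 1"
      unfolding q_def by linarith+
  qed
  have "\<exists>S\<subseteq>X. card S \<le> q \<and>
    real (card {(A, B)\<in>F \<times> F. A \<noteq> B \<and> A \<inter> S = B \<inter> S}) \<le> (card F)\<^sup>2 * (1 - \<eta>) ^ q"
    by (rule separating_coordinates[OF X fF F(1)]) (rule sep; assumption | use \<eta> in linarith)+
  then obtain S where S: "S \<subseteq> X" "card S \<le> q"
    "real (card {(A, B)\<in>F \<times> F. A \<noteq> B \<and> A \<inter> S = B \<inter> S}) \<le> (card F)\<^sup>2 * (1 - \<eta>) ^ q"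
    by blast
  have fS: "finite S" using S X finite_subset by auto
  have "(1 - \<eta>) ^ q \<le> (exp (-\<eta>)) ^ q"
    using \<eta> exp_ge_add_one_self[of "-\<eta>"] by (intro power_mono) auto
  also have "\<dots> = exp (- (\<eta> * q))" by (simp add: exp_of_nat_mult[symmetric] algebra_simps)
  also have "\<dots> < exp (- (2 * ln M))"
    using q1(1) \<eta>(1) by (simp add: pos_divide_less_eq mult.commute)
  also have "\<dots> = 1 / M\<^sup>2" using M1
    by (simp add: exp_minus exp_double divide_inverse)
  finally have "M\<^sup>2 * (1 - \<eta>) ^ q < M\<^sup>2 * (1 / M\<^sup>2)" using M1 by (intro mult_strict_left_mono) auto
  then have "M\<^sup>2 * (1 - \<eta>) ^ q < 1" using M1 by simp
  then have "card {(A, B)\<in>F \<times> F. A \<noteq> B \<and> A \<inter> S = B \<inter> S} = 0"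
    using S(3) by (simp add: M_def)
  moreover have "finite {(A, B)\<in>F \<times> F. A \<noteq> B \<and> A \<inter> S = B \<inter> S}"
    by (rule finite_subset[of _ "F \<times> F"]) (use fF in auto)
  ultimately have "inj_on (\<lambda>A. A \<inter> S) F" by (auto simp: inj_on_def)
  then have cM: "M = card ((\<lambda>A. A \<inter> S) ` F)" by (simp add: card_image M_def)
  have vc: "vc_le ((\<lambda>A. A \<inter> S) ` F) d"
    unfolding vc_le_def
  proof (intro allI impI)
    fix T assume T: "finite T" "shatters ((\<lambda>A. A \<inter> S) ` F) T"
    then have "T \<subseteq> S" unfolding shatters_def by blast
    have "shatters F T" unfolding shatters_def
    proof (intro allI impI)
      fix R assume "R \<subseteq> T"
      then obtain A where "A \<in> F" "A \<inter> S \<inter> T = R" using T(2) unfolding shatters_def by blast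
      then show "\<exists>A\<in>F. A \<inter> T = R" using \<open>T \<subseteq> S\<close> by (intro bexI[of _ A]) auto
    qed
    then show "card T \<le> d" using F T unfolding vc_le_def by blast
  qed
  \<comment> \<open>The weight \<eta> / 4 against q of about 2 ln M / \<eta> makes the second factor
    about exp (ln M / 2), that is sqrt M.\<close>
  have "M \<le> (1 / (\<eta>/4)) ^ d * (1 + \<eta>/4) ^ card S"
    unfolding cM by (rule sauer_shelah_weighted[OF fS _ vc]) (use \<eta> in auto)
  also have "\<dots> \<le> (4 / \<eta>) ^ d * exp (\<eta>/4 * q)"
  proof -
    have "(1 + \<eta>/4) ^ card S \<le> (1 + \<eta>/4) ^ q" using S \<eta> by (intro power_increasing) auto
    also have "\<dots> \<le> (exp (\<eta>/4)) ^ q" using \<eta> by (intro power_mono) auto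
    also have "\<dots> = exp (\<eta>/4 * q)" by (simp add: exp_of_nat_mult[symmetric] algebra_simps)
    finally show ?thesis using \<eta> by (intro mult_mono) auto
  qed
  also have "\<dots> \<le> (4 / \<eta>) ^ d * exp (ln M / 2 + 1/4)"
  proof -
    have "\<eta>/4 * q \<le> \<eta>/4 * (2 * ln M / \<eta> + 1)" using q1 \<eta> by (intro mult_left_mono) auto
    also have "\<dots> \<le> ln M / 2 + 1/4" using \<eta> by (simp add: field_simps)
    finally show ?thesis using \<eta> by (intro mult_left_mono) auto
  qed
  also have "\<dots> = (4 / \<eta>) ^ d * (exp (1/4) * exp (ln M / 2))" by (simp add: exp_add)
  finally have h: "M \<le> (4 / \<eta>) ^ d * (exp (1/4) * exp (ln M / 2))" .
  have sq: "exp (ln M / 2) * exp (ln M / 2) = M" using M1 by (simp add: exp_add[symmetric])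
  then have "exp (ln M / 2) * exp (ln M / 2) \<le> ((4 / \<eta>) ^ d * exp (1/4)) * exp (ln M / 2)" using h by (simp add: mult_ac)
  then have "exp (ln M / 2) \<le> (4 / \<eta>) ^ d * exp (1/4)" by (simp only: mult_le_cancel_right) (simp add: not_less)
  also have "\<dots> \<le> (4 / \<eta>) ^ d * 2 ^ d"
  proof -
    have "exp (1/4::real) \<le> 1 + 1/4 + (1/4)\<^sup>2" by (rule exp_bound) auto
    also have "\<dots> \<le> 2" by (simp add: power2_eq_square)
    also have "2 \<le> (2::real) ^ d" using power_increasing[OF d, of "2::real"] by simp
    finally show ?thesis using \<eta> by (intro mult_left_mono) auto
  qed
  also have "\<dots> = (8 / \<eta>) ^ d" by (simp add: power_mult_distrib[symmetric])
  finally have "exp (ln M / 2) \<le> (8 / \<eta>) ^ d" .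
  then have "exp (ln M / 2) * exp (ln M / 2) \<le> (8 / \<eta>) ^ d * (8 / \<eta>) ^ d" by (intro mult_mono) (use \<eta> in auto)
  then show ?thesis using sq by (simp add: M_def power_add[symmetric] mult_2)
qed

lemma maximal_separated_subset:
  assumes "finite F"
  shows "\<exists>N\<subseteq>F. (\<forall>A\<in>N. \<forall>B\<in>N. A \<noteq> B \<longrightarrow> r < real (card (sym_diff A B))) \<and>
     (\<forall>A\<in>F. \<exists>B\<in>N. A = B \<or> real (card (sym_diff A B)) \<le> r)"
  using assms
proof (induction F rule: finite_induct)
  case empty then show ?case by auto
next
  case (insert C F)
  then obtain N where N: "N \<subseteq> F" "\<forall>A\<in>N. \<forall>B\<in>N. A \<noteq> B \<longrightarrow> r < real (card (sym_diff A B))"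
    "\<forall>A\<in>F. \<exists>B\<in>N. A = B \<or> real (card (sym_diff A B)) \<le> r" by blast
  show ?case
  proof (cases "\<exists>B\<in>N. C = B \<or> real (card (sym_diff C B)) \<le> r")
    case True
    then show ?thesis using N by (intro exI[of _ N]) auto
  next
    case False
    have sd: "sym_diff B C = sym_diff C B" for B by auto
    have far: "r < real (card (sym_diff C B)) \<and> r < real (card (sym_diff B C))" if "B \<in> N" for B
      unfolding sd[of B] using False that by force
    have "\<exists>B\<in>insert C N. A = B \<or> real (card (sym_diff A B)) \<le> r" if "A \<in> insert C F" for A
      using that N(3) by blast
    moreover have "r < real (card (sym_diff A B))" if "A \<in> insert C N" "B \<in> insert C N" "A \<noteq> B" for A B
      using that N(2) far by (cases "A = C"; cases "B = C") auto
    ultimately show ?thesis using N(1) by (intro exI[of _ "insert C N"]) blast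
  qed
qed

section \<open>Random signs: subgaussian tails by counting, and chaining\<close>

lemma cosh_le_exp_half_square: "exp x + exp (- x) \<le> 2 * exp (x\<^sup>2 / 2)" for x :: real
proof -
  have *: "exp y + exp (- y) \<le> 2 * exp (y\<^sup>2 / 2)" if y: "y \<ge> 0" for y :: real
  proof -
    \<comment> \<open>Hoeffding's lemma for a fair two-point variable on an interval of length
      \<open>2 * y\<close>; factoring out exp y centres it.\<close>
    have "- (2 * y) * (1/2) + ln (1 + 1/2 * (exp (2 * y) - 1)) \<le> (2 * y)\<^sup>2 / 8"
      using Hoeffdings_lemma_aux[of "2*y" "1/2"] y by simp
    moreover have "1 + 1/2 * (exp (2 * y) - 1) = exp y * ((exp y + exp (-y)) / 2)"
      using exp_minus_inverse[of y] exp_double[of y] by (simp add: algebra_simps power2_eq_square)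
    moreover have "ln (exp y * ((exp y + exp (-y)) / 2)) = y + ln ((exp y + exp (-y)) / 2)"
      using add_pos_pos[of "exp y" "exp (-y)"] by (subst ln_mult) auto
    ultimately have "ln ((exp y + exp (-y)) / 2) \<le> y\<^sup>2 / 2"
      by (simp only:) (simp add: power2_eq_square)
    then have "exp (ln ((exp y + exp (-y)) / 2)) \<le> exp (y\<^sup>2 / 2)" by (simp only: exp_le_cancel_iff)
    moreover have "exp (ln ((exp y + exp (-y)) / 2)) = (exp y + exp (-y)) / 2"
      by (rule exp_ln) (simp add: add_pos_pos)
    ultimately show ?thesis by simp
  qed
  show ?thesis using *[of x] *[of "-x"] by (cases "x \<ge> 0") (auto simp: add.commute)
qed

text \<open>The Rademacher sum of the indicator of \<open>A\<close>. A sign pattern is encoded by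
  the set \<open>s\<close> of its plus signs, so that probabilities over signs are cardinalities of
  subsets of \<open>Pow {..<n}\<close> divided by \<open>2 ^ n\<close>.\<close>

definition signed_card :: "nat set \<Rightarrow> nat set \<Rightarrow> real" where
  "signed_card s A = real (card (A \<inter> s)) - real (card (A - s))"

lemma signed_card_sum:
  assumes "A \<subseteq> {..<n}"
  shows "signed_card s A = (\<Sum>i<n. (if i \<in> s then 1 else -1) * of_bool (i \<in> A))"
proof -
  have fA: "finite A" using assms finite_subset by blast
  have "(\<Sum>i<n. (if i \<in> s then 1 else -1) * of_bool (i \<in> A)) = (\<Sum>i\<in>A. (if i \<in> s then 1 else -1::real))"
    using assms by (intro sum.mono_neutral_cong_right) auto
  also have "\<dots> = real (card (A \<inter> {i. i \<in> s})) - real (card (A \<inter> - {i. i \<in> s}))"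
    using fA by (simp add: sum.If_cases)
  finally show ?thesis by (simp add: signed_card_def Diff_eq)
qed

text \<open>Chernoff's argument with counting in place of expectation; independence of the signs is
  the distributive law \<open>prod_add\<close>.\<close>

lemma rademacher_tail:
  fixes a :: "nat \<Rightarrow> real"
  assumes v: "(\<Sum>i<n. (a i)\<^sup>2) \<le> v" "0 < v" and l: "0 \<le> l"
  shows "real (card {s\<in>Pow {..<n}. l < (\<Sum>i<n. (if i \<in> s then 1 else -1) * a i)}) \<le> 2 ^ n * exp (- l\<^sup>2 / (2 * v))"
proof -
  define Z where "Z = (\<lambda>s. \<Sum>i<n. (if i \<in> s then 1 else -1) * a i)"
  \<comment> \<open>The minimizer of y^2 v / 2 - y l.\<close>
  define y where "y = l / v"
  have y: "0 \<le> y" using v l by (simp add: y_def)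
  have "real (card {s\<in>Pow {..<n}. l < Z s}) = (\<Sum>s\<in>{s\<in>Pow {..<n}. l < Z s}. 1)" by simp
  also have "\<dots> \<le> (\<Sum>s\<in>{s\<in>Pow {..<n}. l < Z s}. exp (y * (Z s - l)))"
    using y by (intro sum_mono) auto
  also have "\<dots> \<le> (\<Sum>s\<in>Pow {..<n}. exp (y * (Z s - l)))"
    by (intro sum_mono2) auto
  also have "\<dots> = exp (- y * l) * (\<Sum>s\<in>Pow {..<n}. exp (y * Z s))"
    by (simp add: sum_distrib_left exp_add[symmetric] algebra_simps)
  also have "(\<Sum>s\<in>Pow {..<n}. exp (y * Z s)) =
     (\<Sum>s\<in>Pow {..<n}. (\<Prod>i\<in>s. exp (y * a i)) * (\<Prod>i\<in>{..<n} - s. exp (- (y * a i))))"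
  proof (rule sum.cong[OF refl])
    fix s assume s: "s \<in> Pow {..<n}"
    have "Z s = (\<Sum>i\<in>{..<n} \<inter> s. a i) + (\<Sum>i\<in>{..<n} - s. - a i)"
      unfolding Z_def by (simp add: sum.If_cases if_distrib[of "\<lambda>x. x * _"] Diff_eq cong: if_cong)
    moreover have "{..<n} \<inter> s = s" using s by auto
    ultimately have "exp (y * Z s) = exp (\<Sum>i\<in>s. y * a i) * exp (\<Sum>i\<in>{..<n} - s. - (y * a i))"
      by (simp add: exp_add[symmetric] sum_distrib_left sum_negf right_diff_distrib)
    then show "exp (y * Z s) = (\<Prod>i\<in>s. exp (y * a i)) * (\<Prod>i\<in>{..<n} - s. exp (- (y * a i)))"
      using s by (simp add: exp_sum finite_subset[of s "{..<n}"])
  qed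
  also have "\<dots> = (\<Prod>i<n. exp (y * a i) + exp (- (y * a i)))" by (rule prod_add[symmetric]) simp
  also have "\<dots> \<le> (\<Prod>i<n. 2 * exp ((y * a i)\<^sup>2 / 2))"
    by (intro prod_mono) (auto simp: cosh_le_exp_half_square add_nonneg_nonneg)
  also have "\<dots> = 2 ^ n * exp (y\<^sup>2 / 2 * (\<Sum>i<n. (a i)\<^sup>2))"
    by (simp add: prod.distrib exp_sum[symmetric] sum_distrib_left power_mult_distrib)
  also have "\<dots> \<le> 2 ^ n * exp (y\<^sup>2 / 2 * v)"
    using v by (intro mult_left_mono) (auto intro: mult_left_mono)
  also have "exp (- y * l) * (2 ^ n * exp (y\<^sup>2 / 2 * v)) = 2 ^ n * exp (y\<^sup>2 / 2 * v - y * l)"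
    by (simp add: exp_add[symmetric] algebra_simps)
  also have "y\<^sup>2 / 2 * v - y * l = - l\<^sup>2 / (2 * v)"
    using v by (simp add: y_def field_simps power2_eq_square)
  finally show ?thesis by (simp add: Z_def)
qed

text \<open>Subgaussian increments for the Hamming distance: the squared coefficients of the
  difference form the indicator of the symmetric difference. Taking \<open>B\<close> empty also
  covers a single set.\<close>

lemma signed_card_diff_tail:
  assumes AB: "A \<subseteq> {..<n}" "B \<subseteq> {..<n}" and v: "real (card (sym_diff A B)) \<le> v" "0 < v" and l: "0 \<le> l"
  shows "real (card {s\<in>Pow {..<n}. l < signed_card s A - signed_card s B}) \<le> 2 ^ n * exp (- l\<^sup>2 / (2 * v))"
proof -
  define a :: "nat \<Rightarrow> real" where "a i = of_bool (i \<in> A) - of_bool (i \<in> B)" for i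
  have "(\<Sum>i<n. (a i)\<^sup>2) = (\<Sum>i\<in>sym_diff A B. 1)"
    using AB by (intro sum.mono_neutral_cong_right) (auto simp: a_def)
  then have "(\<Sum>i<n. (a i)\<^sup>2) \<le> v" using v by simp
  moreover have "signed_card s A - signed_card s B = (\<Sum>i<n. (if i \<in> s then 1 else -1) * a i)" for s
    unfolding signed_card_sum[OF AB(1)] signed_card_sum[OF AB(2)] a_def
    by (simp only: sum_subtractf[symmetric] right_diff_distrib)
  ultimately show ?thesis using rademacher_tail[OF _ v(2) l, where n = n and a = a] by simp
qed

text \<open>The sums stay below 4, so the start level b and the chaining steps b (j + 1) / 2^j add
  up to at most 5 b.\<close>

lemma chaining_steps_sum: "(\<Sum>j<k. (real j + 1) / 2 ^ j) = 4 - (2 * real k + 4) / 2 ^ k"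
proof (induction k)
  case (Suc k)
  show ?case unfolding sum.lessThan_Suc Suc by (simp add: field_simps)
qed simp

lemma card_exists_le:
  fixes c :: real
  assumes "finite N" "\<And>A. A \<in> N \<Longrightarrow> real (card {s\<in>S. R A s}) \<le> c" "finite S"
  shows "real (card {s\<in>S. \<exists>A\<in>N. R A s}) \<le> card N * c"
proof -
  have "{s\<in>S. \<exists>A\<in>N. R A s} = (\<Union>A\<in>N. {s\<in>S. R A s})" by auto
  then have "real (card {s\<in>S. \<exists>A\<in>N. R A s}) \<le> real (\<Sum>A\<in>N. card {s\<in>S. R A s})"
    by (simp only: of_nat_mono card_UN_le[OF assms(1)])
  also have "\<dots> \<le> (\<Sum>A\<in>N. c)" unfolding of_nat_sum by (rule sum_mono) (rule assms(2))
  finally show ?thesis by simp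
qed

text \<open>Chaining through maximal separated sets \<open>N k\<close> of Hamming radius n / 4^k. By
  the packing bound the log-cardinality of \<open>N k\<close> grows only linearly in k, whereas a
  step of size b (k + 1) / 2^k against variance n / 4^k has an exponent proportional to (k + 1)^2.
  Level k therefore fails with proportion at most \<open>q ^ (k + 1)\<close>, and the geometric
  series gives the factor 3 without any dependence on ln n.\<close>

lemma rademacher_vc_tail:
  assumes n: "0 < n" and F: "F \<subseteq> Pow {..<n}" "vc_le F d" and d: "1 \<le> d"
    and b: "0 \<le> b" "40 * real d * real n \<le> b\<^sup>2"
  shows "real (card {s\<in>Pow {..<n}. \<exists>A\<in>F. 5 * b < signed_card s A}) \<le> 2 ^ n * (3 * exp (- b\<^sup>2 / (4 * n)))"
proof -
  have fF: "finite F" using F by (meson finite_Pow_iff finite_lessThan finite_subset)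
  define r where "r k = real n / 4 ^ k" for k :: nat
  have rpos: "0 < r k" for k using n by (simp add: r_def)
  have "\<forall>k. \<exists>N\<subseteq>F. (\<forall>A\<in>N. \<forall>B\<in>N. A \<noteq> B \<longrightarrow> r k < real (card (sym_diff A B))) \<and>
     (\<forall>A\<in>F. \<exists>B\<in>N. A = B \<or> real (card (sym_diff A B)) \<le> r k)"
    using maximal_separated_subset[OF fF] by blast
  then obtain N where N: "\<And>k. N k \<subseteq> F"
    "\<And>k A B. A \<in> N k \<Longrightarrow> B \<in> N k \<Longrightarrow> A \<noteq> B \<Longrightarrow> r k < real (card (sym_diff A B))"
    "\<And>k A. A \<in> F \<Longrightarrow> \<exists>B\<in>N k. A = B \<or> real (card (sym_diff A B)) \<le> r k" by metis
  have fN: "finite (N k)" for k using N(1) fF finite_subset by blast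
  have cN: "real (card (N k)) \<le> exp (real d * (6 + 4 * real k))" for k
  proof -
    have vc: "vc_le (N k) d" using vc_le_mono[OF F(2) N(1)] .
    have "real (card (N k)) \<le> (8 / (1 / 4 ^ k)) ^ (2 * d)"
    proof (rule packing_bound[where X = "{..<n}", OF _ _ _ vc])
      show "1 / 4 ^ k * real (card {..<n}) \<le> real (card (sym_diff A B))"
        if "A \<in> N k" "B \<in> N k" "A \<noteq> B" for A B
        using N(2)[OF that] by (simp add: r_def)
      show "N k \<subseteq> Pow {..<n}" using N(1)[of k] F by blast
    qed (use n d in auto)
    \<comment> \<open>Powers of 2 are bounded by powers of e, so that entropy and tail exponents can
      be added directly.\<close>
    also have "8 / (1 / 4 ^ k) = (2::real) ^ (3 + 2 * k)"
      by (simp add: power_add power_mult)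
    also have "((2::real) ^ (3 + 2 * k)) ^ (2 * d) \<le> (exp 1 ^ (3 + 2 * k)) ^ (2 * d)"
      using exp_ge_add_one_self[of 1] by (intro power_mono) auto
    also have "\<dots> = exp (real d * (6 + 4 * real k))"
      by (simp add: exp_of_nat_mult[symmetric] power_mult[symmetric] algebra_simps)
    finally show ?thesis .
  qed
  \<comment> \<open>The hypothesis \<open>40 * real d * real n \<le> b\<^sup>2\<close> rewritten;
    the margin 10 d pays for the entropy 6 d of \<open>N 0\<close> and for d (10 + 4 k) at each
    later step.\<close>
  have bn: "10 * real d \<le> b\<^sup>2 / (4 * n)" using b(2) n by (simp add: field_simps)
  define q where "q = exp (- (b\<^sup>2 / (4 * n)))"
  have q0: "0 < q" by (simp add: q_def)
  have "q \<le> exp (- 1)" using bn d unfolding q_def by simp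
  also have "\<dots> \<le> 1 / 2" using exp_ge_add_one_self[of 1] by (simp add: exp_minus field_simps)
  finally have q: "q \<le> 1 / 2" .
  define L where "L k = b + b * (\<Sum>j<k. (real j + 1) / 2 ^ j)" for k :: nat
  define cnt where "cnt k = real (card {s\<in>Pow {..<n}. \<exists>A\<in>N k. L k < signed_card s A})" for k
  have main: "cnt k \<le> 2 ^ n * (q + (\<Sum>j<k. q ^ (j + 1)))" for k
  proof (induction k)
    case 0
    have "cnt 0 \<le> card (N 0) * (2 ^ n * exp (- b\<^sup>2 / (2 * real n)))"
      unfolding cnt_def
    proof (rule card_exists_le[OF fN])
      fix A assume A: "A \<in> N 0"
      then have A': "A \<subseteq> {..<n}" using N(1) F by blast
      have "card A \<le> n" using card_mono[OF _ A'] by simp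
      then show "real (card {s\<in>Pow {..<n}. L 0 < signed_card s A}) \<le> 2 ^ n * exp (- b\<^sup>2 / (2 * real n))"
        using signed_card_diff_tail[OF A', of "{}" "real n" b] n b by (simp add: L_def signed_card_def)
    qed simp
    also have "\<dots> \<le> exp (real d * (6 + 4 * real 0)) * (2 ^ n * exp (- b\<^sup>2 / (2 * real n)))"
      by (intro mult_right_mono cN) auto
    also have "\<dots> = 2 ^ n * exp (real d * 6 - b\<^sup>2 / (2 * real n))"
      by (simp only: mult.left_commute[of "exp _"] exp_add[symmetric]) simp
    also have "\<dots> \<le> 2 ^ n * q"
    proof -
      have "real d * 6 - b\<^sup>2 / (2 * real n) \<le> - (b\<^sup>2 / (4 * n))" using bn by simp
      then show ?thesis unfolding q_def by simp
    qed
    finally show ?case by simp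
  next
    case (Suc k)
    define l where "l = b * (real k + 1) / 2 ^ k"
    have l0: "0 \<le> l" using b by (simp add: l_def)
    have L: "L (Suc k) = L k + l" by (simp add: L_def l_def algebra_simps)
    \<comment> \<open>The parent of \<open>A\<close> at the coarser level k. Either the parent
      already exceeds \<open>L k\<close>, or the increment from parent to \<open>A\<close> exceeds
      l.\<close>
    define par where "par A = (SOME B. B \<in> N k \<and> (A = B \<or> real (card (sym_diff A B)) \<le> r k))" for A
    have par: "par A \<in> N k" "A = par A \<or> real (card (sym_diff A (par A))) \<le> r k" if "A \<in> F" for A
      using someI_ex[OF N(3)[OF that, of k, unfolded Bex_def]] unfolding par_def by blast+
    have "{s\<in>Pow {..<n}. \<exists>A\<in>N (Suc k). L (Suc k) < signed_card s A} \<subseteq>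
      {s\<in>Pow {..<n}. \<exists>A\<in>N k. L k < signed_card s A} \<union>
      {s\<in>Pow {..<n}. \<exists>A\<in>N (Suc k). l < signed_card s A - signed_card s (par A)}" (is "_ \<subseteq> ?S1 \<union> ?S2")
    proof (rule subsetI)
      fix s assume "s \<in> {s\<in>Pow {..<n}. \<exists>A\<in>N (Suc k). L (Suc k) < signed_card s A}"
      then obtain A where A: "s \<in> Pow {..<n}" "A \<in> N (Suc k)" "L (Suc k) < signed_card s A" by blast
      have "L k < signed_card s (par A) \<or> l < signed_card s A - signed_card s (par A)"
        using A(3) L by linarith
      moreover have "par A \<in> N k" using par(1) A(2) N(1) by blast
      ultimately show "s \<in> ?S1 \<union> ?S2" using A by blast
    qed
    then have "card {s\<in>Pow {..<n}. \<exists>A\<in>N (Suc k). L (Suc k) < signed_card s A} \<le> card (?S1 \<union> ?S2)"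
      by (intro card_mono) auto
    also have "\<dots> \<le> card ?S1 + card ?S2" by (rule card_Un_le)
    finally have "cnt (Suc k) \<le> cnt k + card ?S2" unfolding cnt_def by linarith
    also have "real (card ?S2) \<le> card (N (Suc k)) * (2 ^ n * exp (- l\<^sup>2 / (2 * r k)))"
    proof (rule card_exists_le[OF fN])
      fix A assume A: "A \<in> N (Suc k)"
      then have AF: "A \<in> F" using N(1) by blast
      have A': "A \<subseteq> {..<n}" "par A \<subseteq> {..<n}" using AF par(1)[OF AF] N(1) F by blast+
      have "real (card (sym_diff A (par A))) \<le> r k"
      proof (cases "A = par A")
        case True
        then have "sym_diff A (par A) = {}" by blast
        then show ?thesis using rpos[of k] by (simp only: card.empty of_nat_0 less_imp_le)
      next
        case False
        then show ?thesis using par(2)[OF AF] by blast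
      qed
      then show "real (card {s\<in>Pow {..<n}. l < signed_card s A - signed_card s (par A)}) \<le> 2 ^ n * exp (- l\<^sup>2 / (2 * r k))"
        by (rule signed_card_diff_tail[OF A' _ rpos l0])
    qed simp
    also have "\<dots> \<le> exp (real d * (6 + 4 * real (Suc k))) * (2 ^ n * exp (- l\<^sup>2 / (2 * r k)))"
      by (intro mult_right_mono cN) auto
    also have "\<dots> = 2 ^ n * exp (real d * (10 + 4 * real k) - l\<^sup>2 / (2 * r k))"
      by (simp only: mult.left_commute[of "exp _"] exp_add[symmetric]) (simp add: algebra_simps)
    also have "\<dots> \<le> 2 ^ n * q ^ (k + 1)"
    proof -
      \<comment> \<open>The tail exponent is 2 c (k + 1)^2. One half of it dominates the entropy
        because c is at least 10 d, and the other half leaves \<open>q ^ (k + 1)\<close>.\<close>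
      define c where "c = b\<^sup>2 / (4 * n)"
      have "l\<^sup>2 / (2 * r k) = 2 * c * (real k + 1)\<^sup>2"
      proof -
        have "(2 ^ k)\<^sup>2 = (4::real) ^ k" by (simp add: power_mult[symmetric] mult.commute[of k 2]) (simp add: power_mult)
        then show ?thesis using n by (simp add: l_def r_def c_def power_divide power_mult_distrib)
      qed
      moreover have "(real k + 1) \<le> (real k + 1)\<^sup>2" by (simp add: power2_eq_square)
      then have "2 * c * (real k + 1) \<le> 2 * c * (real k + 1)\<^sup>2"
        using n by (intro mult_left_mono) (auto simp: c_def)
      moreover have "real d * (10 + 4 * real k) \<le> c * (real k + 1)"
      proof -
        have "real d * (10 + 4 * real k) \<le> real d * (10 * (real k + 1))" by (intro mult_left_mono) auto
        also have "\<dots> = 10 * real d * (real k + 1)" by simp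
        also have "\<dots> \<le> c * (real k + 1)" using bn unfolding c_def by (intro mult_right_mono) auto
        finally show ?thesis .
      qed
      ultimately have "real d * (10 + 4 * real k) - l\<^sup>2 / (2 * r k) \<le> - (c * (real k + 1))" by linarith
      moreover have "q ^ (k + 1) = exp (- (c * (real k + 1)))"
        unfolding q_def c_def[symmetric] exp_of_nat_mult[symmetric] by (simp add: algebra_simps)
      ultimately show ?thesis by simp
    qed
    finally have "cnt (Suc k) \<le> cnt k + 2 ^ n * q ^ (k + 1)" by simp
    then show ?case using Suc by (simp add: algebra_simps)
  qed
  have geo: "(\<Sum>j<k. q ^ (j + 1)) \<le> 2 * q" for k
  proof -
    have "(\<Sum>j<k. q ^ (j + 1)) = q * (\<Sum>j<k. q ^ j)" by (simp add: sum_distrib_left)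
    also have "(\<Sum>j<k. q ^ j) = (1 - q ^ k) / (1 - q)" using q q0 by (subst geometric_sum) (auto simp: field_simps)
    also have "\<dots> \<le> 1 / (1 - q)" using q q0 by (intro divide_right_mono) auto
    also have "\<dots> \<le> 2" using q by (simp add: field_simps)
    finally show ?thesis using q0 by simp
  qed
  \<comment> \<open>At radius below 1 a net point within the radius coincides with the set itself,
    so the chain ends with all of \<open>F\<close>.\<close>
  obtain k :: nat where k: "real n < 4 ^ k" using real_arch_pow[of 4 "real n"] by auto
  have NF: "F \<subseteq> N k"
  proof
    fix A assume A: "A \<in> F"
    then obtain B where B: "B \<in> N k" "A = B \<or> real (card (sym_diff A B)) \<le> r k" using N(3) by blast
    have "A \<subseteq> {..<n}" "B \<subseteq> {..<n}" using A B(1) N(1)[of k] F(1) by blast+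
    then have fAB: "finite (sym_diff A B)" by (meson finite_Diff finite_UnI finite_lessThan finite_subset)
    have "r k < 1" using k by (simp add: r_def)
    then have "A = B \<or> card (sym_diff A B) = 0" using B(2) by linarith
    then have "A = B" using fAB by auto
    then show "A \<in> N k" using B by simp
  qed
  have "L k \<le> 5 * b"
  proof -
    have "(\<Sum>j<k. (real j + 1) / 2 ^ j) \<le> 4" unfolding chaining_steps_sum by simp
    then have "b * (\<Sum>j<k. (real j + 1) / 2 ^ j) \<le> b * 4" using b(1) by (rule mult_left_mono)
    then show ?thesis by (simp add: L_def)
  qed
  then have "card {s\<in>Pow {..<n}. \<exists>A\<in>F. 5 * b < signed_card s A} \<le> card {s\<in>Pow {..<n}. \<exists>A\<in>N k. L k < signed_card s A}"
    using NF by (intro card_mono) force+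
  then have "real (card {s\<in>Pow {..<n}. \<exists>A\<in>F. 5 * b < signed_card s A}) \<le> cnt k" by (simp add: cnt_def)
  also have "\<dots> \<le> 2 ^ n * (q + (\<Sum>j<k. q ^ (j + 1)))" by (rule main)
  also have "\<dots> \<le> 2 ^ n * (3 * q)" using geo[of k] by (intro mult_left_mono) auto
  finally show ?thesis by (simp add: q_def)
qed

section \<open>Symmetrization\<close>

lemma indep_vars_PiM_coordinates:
  assumes "\<And>i. i \<in> I \<Longrightarrow> prob_space (M i)" "I \<noteq> {}"
  shows "prob_space.indep_vars (PiM I M) M (\<lambda>i \<omega>. \<omega> i) I"
proof -
  interpret prob_space "PiM I M" by (rule prob_space_PiM) fact
  show ?thesis
  proof (subst indep_vars_iff_distr_eq_PiM'[OF assms(2)])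
    have "distr (PiM I M) (PiM I M) (\<lambda>x. \<lambda>i\<in>I. x i) = distr (PiM I M) (PiM I M) (\<lambda>x. x)"
      by (intro distr_cong refl) (auto simp: space_PiM PiE_def extensional_restrict)
    also have "\<dots> = PiM I M" by (rule distr_id)
    also have "\<dots> = PiM I (\<lambda>i. distr (PiM I M) (M i) (\<lambda>\<omega>. \<omega> i))"
      by (intro PiM_cong refl distr_PiM_component[symmetric] assms)
    finally show "distr (PiM I M) (PiM I M) (\<lambda>x. \<lambda>i\<in>I. x i) = PiM I (\<lambda>i. distr (PiM I M) (M i) (\<lambda>\<omega>. \<omega> i))" .
  qed simp
qed

text \<open>Hoeffding's inequality for one fixed set. The index set is general because it is applied
  to the ghost half \<open>{n..<n+n}\<close> of the doubled sample.\<close>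

lemma count_deviation_le:
  assumes P: "prob_space P" and C: "C \<in> sets P" and I: "finite I" "I \<noteq> {}" and \<epsilon>: "0 \<le> \<epsilon>"
  shows "measure (PiM I (\<lambda>_. P)) {\<omega>\<in>space (PiM I (\<lambda>_. P)). real (card I) * measure P C + \<epsilon> \<le> real (card {i\<in>I. \<omega> i \<in> C})}
     \<le> exp (- 2 * \<epsilon>\<^sup>2 / real (card I))"
proof -
  interpret P: prob_space P by fact
  let ?M = "PiM I (\<lambda>_. P)"
  interpret M: prob_space ?M by (rule prob_space_PiM) (rule P)
  let ?X = "\<lambda>i \<omega>. indicator C (\<omega> i) :: real"
  have ind: "M.indep_vars (\<lambda>_. borel) ?X I"
    by (rule M.indep_vars_compose2[OF indep_vars_PiM_coordinates[OF _ I(2)]]) (use C P in \<open>auto intro: P.prob_space_axioms\<close>)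
  have ex: "M.expectation (?X i) = measure P C" if "i \<in> I" for i
  proof -
    have "M.expectation (?X i) = (\<integral>x. indicator C x \<partial>distr ?M P (\<lambda>\<omega>. \<omega> i))"
      by (rule integral_distr[symmetric]) (use C that in auto)
    also have "distr ?M P (\<lambda>\<omega>. \<omega> i) = P" by (rule distr_PiM_component) (use that P in auto)
    finally show ?thesis using C by simp
  qed
  interpret Hoeffding_ineq ?M I ?X "\<lambda>_. 0" "\<lambda>_. 1" "(\<Sum>i\<in>I. M.expectation (?X i))"
    by (unfold_locales; (rule I ind AE_I2)?) (auto simp: indicator_def)
  have cI: "0 < card I" using I by (simp add: card_gt_0_iff)
  have "measure ?M {x \<in> space ?M. (\<Sum>i\<in>I. M.expectation (?X i)) + \<epsilon> \<le> (\<Sum>i\<in>I. ?X i x)} \<le> exp (- 2 * \<epsilon>\<^sup>2 / (\<Sum>i\<in>I. (1 - 0)\<^sup>2))"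
    by (rule Hoeffding_ineq_ge[OF \<epsilon>]) (use cI in simp)
  moreover have "(\<Sum>i\<in>I. ?X i x) = real (card {i\<in>I. x i \<in> C})" for x
    using I by (simp add: indicator_def sum.If_cases Int_def)
  moreover have "(\<Sum>i\<in>I. M.expectation (?X i)) = real (card I) * measure P C" using ex by simp
  ultimately show ?thesis by simp
qed

text \<open>The trace of \<open>C\<close> on the sample, taken as a set of indices rather than of
  sample points, so that repeated points are counted with multiplicity.\<close>

definition hits :: "nat \<Rightarrow> (nat \<Rightarrow> 'a) \<Rightarrow> 'a set \<Rightarrow> nat set" where
  "hits n \<omega> C = {i. i < n \<and> \<omega> i \<in> C}"

lemma hits_subset: "hits n \<omega> C \<subseteq> {..<n}" by (auto simp: hits_def)

lemma card_hits_sum: "real (card (hits n \<omega> C)) = (\<Sum>i<n. indicator C (\<omega> i))"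
  by (simp add: indicator_def sum.If_cases Int_def hits_def)

text \<open>The sign change of symmetrization realised as a permutation of the doubled sample:
  coordinates i and i + n trade places exactly for i in \<open>s\<close>.\<close>

definition ghost_swap :: "nat \<Rightarrow> nat set \<Rightarrow> nat \<Rightarrow> nat" where
  "ghost_swap n s i = (if i < n then (if i \<in> s then i + n else i) else (if i - n \<in> s then i - n else i))"

lemma ghost_swap_bij: "s \<subseteq> {..<n} \<Longrightarrow> inj_on (ghost_swap n s) {..<n + n}" "s \<subseteq> {..<n} \<Longrightarrow> ghost_swap n s \<in> {..<n + n} \<rightarrow> {..<n + n}"
  by (auto simp: ghost_swap_def inj_on_def split: if_splits)

text \<open>An index in \<open>s\<close> contributes ghost minus own indicator, any other index own
  minus ghost. The negated signs of the own half are written as the complementary sign pattern, so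
  that the one-sided tail bound applies to both halves.\<close>

lemma ghost_swap_difference:
  assumes "s \<subseteq> {..<n}" and \<omega>': "\<omega>' = (\<lambda>i\<in>{..<n+n}. \<omega> (ghost_swap n s i))"
  shows "real (card (hits n \<omega>' C)) - real (card (hits n (\<lambda>i. \<omega>' (i + n)) C)) =
    signed_card s (hits n (\<lambda>i. \<omega> (i + n)) C) + signed_card ({..<n} - s) (hits n \<omega> C)"
proof -
  have "real (card (hits n \<omega>' C)) - real (card (hits n (\<lambda>i. \<omega>' (i + n)) C)) =
    (\<Sum>i<n. indicator C (\<omega>' i) - indicator C (\<omega>' (i + n)))"
    by (simp add: card_hits_sum sum_subtractf)
  also have "\<dots> = (\<Sum>i<n. (if i \<in> s then 1 else -1) * of_bool (i \<in> hits n (\<lambda>i. \<omega> (i + n)) C) +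
       (if i \<in> {..<n} - s then 1 else -1) * of_bool (i \<in> hits n \<omega> C))"
    by (intro sum.cong refl) (use assms in \<open>auto simp: ghost_swap_def hits_def indicator_def\<close>)
  also have "\<dots> = signed_card s (hits n (\<lambda>i. \<omega> (i + n)) C) + signed_card ({..<n} - s) (hits n \<omega> C)"
    by (simp only: signed_card_sum[OF hits_subset] sum.distrib)
  finally show ?thesis .
qed

text \<open>A sum above 10 b has a summand above 5 b, and complementation maps sign patterns
  bijectively to sign patterns. Each half contributes the factor 3, in total 6.\<close>

lemma count_ghost_swaps:
  fixes \<C> :: "'a set set"
  assumes vc: "\<And>\<omega>. vc_le (hits n \<omega> ` \<C>) d" and n: "0 < n" and d: "1 \<le> d"
    and b: "0 \<le> b" "40 * real d * real n \<le> b\<^sup>2"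
  shows "real (card {s\<in>Pow {..<n}. \<exists>C\<in>\<C>. 10 * b < signed_card s (hits n \<omega>1 C) + signed_card ({..<n} - s) (hits n \<omega>2 C)})
    \<le> 2 ^ n * (6 * exp (- b\<^sup>2 / (4 * n)))"
proof -
  let ?T = "\<lambda>\<omega>. {s\<in>Pow {..<n}. \<exists>A\<in>hits n \<omega> ` \<C>. 5 * b < signed_card s A}"
  have T: "real (card (?T \<omega>)) \<le> 2 ^ n * (3 * exp (- b\<^sup>2 / (4 * n)))" for \<omega>
    by (rule rademacher_vc_tail[OF n _ vc d b]) (auto simp: hits_def)
  have "{s\<in>Pow {..<n}. \<exists>C\<in>\<C>. 10 * b < signed_card s (hits n \<omega>1 C) + signed_card ({..<n} - s) (hits n \<omega>2 C)}
    \<subseteq> ?T \<omega>1 \<union> (\<lambda>s. {..<n} - s) ` ?T \<omega>2"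
  proof (rule subsetI)
    fix s assume "s \<in> {s\<in>Pow {..<n}. \<exists>C\<in>\<C>. 10 * b < signed_card s (hits n \<omega>1 C) + signed_card ({..<n} - s) (hits n \<omega>2 C)}"
    then obtain C where C: "s \<subseteq> {..<n}" "C \<in> \<C>" "10 * b < signed_card s (hits n \<omega>1 C) + signed_card ({..<n} - s) (hits n \<omega>2 C)"
      by blast
    from C(3) consider "5 * b < signed_card s (hits n \<omega>1 C)" | "5 * b < signed_card ({..<n} - s) (hits n \<omega>2 C)" by linarith
    then show "s \<in> ?T \<omega>1 \<union> (\<lambda>s. {..<n} - s) ` ?T \<omega>2"
    proof cases
      case 1 then show ?thesis using C by blast
    next
      case 2
      have "{..<n} - s \<in> ?T \<omega>2" using 2 C by blast
      moreover have "s = {..<n} - ({..<n} - s)" using C by blast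
      ultimately show ?thesis by blast
    qed
  qed
  then have "card {s\<in>Pow {..<n}. \<exists>C\<in>\<C>. 10 * b < signed_card s (hits n \<omega>1 C) + signed_card ({..<n} - s) (hits n \<omega>2 C)}
    \<le> card (?T \<omega>1 \<union> (\<lambda>s. {..<n} - s) ` ?T \<omega>2)" by (intro card_mono) auto
  also have "\<dots> \<le> card (?T \<omega>1) + card ((\<lambda>s. {..<n} - s) ` ?T \<omega>2)" by (rule card_Un_le)
  also have "\<dots> \<le> card (?T \<omega>1) + card (?T \<omega>2)" by (intro add_left_mono card_image_le) auto
  finally show ?thesis using T[of \<omega>1] T[of \<omega>2] by linarith
qed

text \<open>Symmetrization with a ghost sample: a deviation t from the true probability forces, with
  conditional probability at least 1/2, a difference of more than n t / 2 between the two halves.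
  The law of the doubled sample is invariant under every swap, so the probability of such a
  difference is an average over swaps, bounded pointwise by counting signs. Countability of the
  class makes the bad event measurable. The constant 12 is 2 for the ghost step times 6 for the two
  halves.\<close>

lemma vc_uniform_deviation:
  fixes \<C> :: "'a set set" and P :: "'a measure"
  assumes P: "prob_space P" and \<C>: "countable \<C>" "\<C> \<subseteq> sets P"
    and vc: "\<And>\<omega>. vc_le (hits n \<omega> ` \<C>) d" and n: "0 < n" and d: "1 \<le> d"
    and t: "0 < t" "16000 * real d \<le> real n * t\<^sup>2"
  defines "M \<equiv> PiM {..<n} (\<lambda>_. P)"
  defines "bad \<equiv> {\<omega>\<in>space M. \<exists>C\<in>\<C>. real n * (measure P C + t) < real (card (hits n \<omega> C))}"
  shows "bad \<in> sets M" "measure M bad \<le> 12 * exp (- (real n * t\<^sup>2 / 1600))"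
proof -
  interpret P: prob_space P by fact
  let ?G = "PiM {n..<n+n} (\<lambda>_. P)" and ?M2 = "PiM {..<n+n} (\<lambda>_. P)"
  interpret M: prob_space M unfolding M_def by (rule prob_space_PiM) (rule P)
  interpret G: prob_space ?G by (rule prob_space_PiM) (rule P)
  interpret M2: prob_space ?M2 by (rule prob_space_PiM) (rule P)
  interpret PP: product_sigma_finite "\<lambda>_::nat. P" by unfold_locales
  have [measurable]: "C \<in> sets P" if "C \<in> \<C>" for C using that \<C> by auto
  have hm[measurable]: "(\<lambda>\<omega>. real (card (hits n \<omega> C))) \<in> borel_measurable M" if "C \<in> \<C>" for C
    unfolding card_hits_sum M_def using that by measurable
  show bad[measurable]: "bad \<in> sets M"
  proof -
    have "bad = (\<Union>C\<in>\<C>. {\<omega>\<in>space M. real n * (measure P C + t) < real (card (hits n \<omega> C))})"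
      unfolding bad_def by blast
    also have "\<dots> \<in> sets M" using \<C>(1) by (intro sets.countable_UN'') measurable
    finally show ?thesis .
  qed
  define R where "R \<omega> C \<longleftrightarrow> real n * t / 2 < real (card (hits n \<omega> C)) - real (card (hits n (\<lambda>i. \<omega> (i + n)) C))"
    for \<omega> :: "nat \<Rightarrow> 'a" and C
  define bad2 where "bad2 = {\<omega>\<in>space ?M2. \<exists>C\<in>\<C>. R \<omega> C}"
  have hm1[measurable]: "(\<lambda>\<omega>. real (card (hits n \<omega> C))) \<in> borel_measurable ?M2"
    "(\<lambda>\<omega>. real (card (hits n (\<lambda>i. \<omega> (i + n)) C))) \<in> borel_measurable ?M2" if "C \<in> \<C>" for C
    unfolding card_hits_sum using that by measurable
  have bad2[measurable]: "bad2 \<in> sets ?M2"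
  proof -
    have "bad2 = (\<Union>C\<in>\<C>. {\<omega>\<in>space ?M2. R \<omega> C})" unfolding bad2_def by blast
    also have "\<dots> \<in> sets ?M2" unfolding R_def using \<C>(1) by (intro sets.countable_UN'') measurable
    finally show ?thesis .
  qed
  have nt: "16000 \<le> real n * t\<^sup>2" using t(2) d by simp
  have U: "{..<n} \<union> {n..<n+n} = {..<n+n}" "{..<n} \<inter> {n..<n+n} = {}" by auto
  \<comment> \<open>For a bad sample x fix a violating C. By Hoeffding the ghost count for this
    single C stays below n P(C) + n t / 2 with probability at least 1/2, and each such ghost sample
    puts the merged sample into \<open>bad2\<close>.\<close>
  have ghost: "ennreal (1 / 2) * indicator bad x \<le> emeasure ?G (Pair x -` (merge {..<n} {n..<n+n} -` bad2 \<inter> space (M \<Otimes>\<^sub>M ?G)))"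
    if x: "x \<in> space M" for x
  proof (cases "x \<in> bad")
    case True
    then obtain C where C: "C \<in> \<C>" "real n * (measure P C + t) < real (card (hits n x C))" by (auto simp: bad_def)
    define B where "B = {y\<in>space ?G. real (card {n..<n+n}) * measure P C + real n * t / 2 \<le> real (card {i\<in>{n..<n+n}. y i \<in> C})}"
    have Bs: "B \<in> sets ?G"
    proof -
      have "real (card {i\<in>{n..<n+n}. y i \<in> C}) = (\<Sum>i\<in>{n..<n+n}. indicator C (y i))" for y :: "nat \<Rightarrow> 'a"
        by (simp add: indicator_def sum.If_cases Int_def)
      then show ?thesis unfolding B_def using C(1) by simp
    qed
    have "measure ?G B \<le> exp (- 2 * (real n * t / 2)\<^sup>2 / real (card {n..<n+n}))"
      unfolding B_def by (rule count_deviation_le[OF P]) (use C \<C> n t in auto)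
    also have "- 2 * (real n * t / 2)\<^sup>2 / real (card {n..<n+n}) = - (real n * t\<^sup>2 / 2)"
      using n by (simp add: power2_eq_square field_simps)
    also have "exp (- (real n * t\<^sup>2 / 2)) \<le> exp (- 1)" using nt by simp
    also have "\<dots> \<le> 1 / 2" using exp_ge_add_one_self[of 1] by (simp add: exp_minus field_simps)
    finally have "measure ?G B \<le> 1 / 2" .
    then have "1 / 2 \<le> measure ?G (space ?G - B)" using G.prob_compl[OF Bs] by simp
    then have "ennreal (1 / 2) \<le> emeasure ?G (space ?G - B)"
      unfolding G.emeasure_eq_measure by (rule ennreal_leI)
    also have "\<dots> \<le> emeasure ?G (Pair x -` (merge {..<n} {n..<n+n} -` bad2 \<inter> space (M \<Otimes>\<^sub>M ?G)))"
    proof (rule emeasure_mono)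
      show "space ?G - B \<subseteq> Pair x -` (merge {..<n} {n..<n+n} -` bad2 \<inter> space (M \<Otimes>\<^sub>M ?G))"
      proof (rule subsetI)
        fix y assume y: "y \<in> space ?G - B"
        let ?w = "merge {..<n} {n..<n+n} (x, y)"
        have h1: "hits n ?w C = hits n x C" by (auto simp: hits_def merge_def)
        have "{i\<in>{n..<n+n}. y i \<in> C} = (\<lambda>i. i + n) ` hits n (\<lambda>i. ?w (i + n)) C"
        proof (intro set_eqI iffI)
          fix i assume i: "i \<in> {i\<in>{n..<n+n}. y i \<in> C}"
          show "i \<in> (\<lambda>i. i + n) ` hits n (\<lambda>i. ?w (i + n)) C"
            by (rule image_eqI[of _ _ "i - n"]) (use i in \<open>auto simp: hits_def merge_def\<close>)
        qed (auto simp: hits_def merge_def)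
        then have h2: "card {i\<in>{n..<n+n}. y i \<in> C} = card (hits n (\<lambda>i. ?w (i + n)) C)"
          by (simp add: card_image)
        have ws: "?w \<in> space ?M2"
          using x y unfolding M_def by (auto simp: space_PiM merge_def PiE_def Pi_def extensional_def)
        have "real n * measure P C + real n * t / 2 > real (card (hits n (\<lambda>i. ?w (i + n)) C))"
          using y h2 by (auto simp: B_def not_le)
        then have "R ?w C" unfolding R_def h1 using C(2) by (simp add: algebra_simps)
        then have "?w \<in> bad2" using ws C(1) by (auto simp: bad2_def)
        then show "y \<in> Pair x -` (merge {..<n} {n..<n+n} -` bad2 \<inter> space (M \<Otimes>\<^sub>M ?G))"
          using x y by (simp add: space_pair_measure)
      qed
      show "Pair x -` (merge {..<n} {n..<n+n} -` bad2 \<inter> space (M \<Otimes>\<^sub>M ?G)) \<in> sets ?G"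
        by (rule sets_Pair1, rule measurable_sets[OF _ bad2]) (use measurable_merge[of "{..<n}" "{n..<n+n}" "\<lambda>_. P"] in \<open>simp add: U M_def\<close>)
    qed
    finally show ?thesis using True by simp
  qed simp
  have mm: "merge {..<n} {n..<n+n} \<in> measurable (M \<Otimes>\<^sub>M ?G) ?M2"
    using measurable_merge[of "{..<n}" "{n..<n+n}" "\<lambda>_. P"] by (simp add: U M_def)
  have "ennreal (1 / 2) * emeasure M bad = (\<integral>\<^sup>+x. ennreal (1 / 2) * indicator bad x \<partial>M)"
    by (subst nn_integral_cmult_indicator) auto
  also have "\<dots> \<le> (\<integral>\<^sup>+x. emeasure ?G (Pair x -` (merge {..<n} {n..<n+n} -` bad2 \<inter> space (M \<Otimes>\<^sub>M ?G))) \<partial>M)"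
    by (rule nn_integral_mono) (rule ghost)
  also have "\<dots> = emeasure (M \<Otimes>\<^sub>M ?G) (merge {..<n} {n..<n+n} -` bad2 \<inter> space (M \<Otimes>\<^sub>M ?G))"
    by (rule G.emeasure_pair_measure_alt[symmetric], rule measurable_sets[OF mm bad2])
  also have "\<dots> = emeasure (distr (M \<Otimes>\<^sub>M ?G) ?M2 (merge {..<n} {n..<n+n})) bad2"
    by (rule emeasure_distr[symmetric, OF mm bad2])
  also have "distr (M \<Otimes>\<^sub>M ?G) ?M2 (merge {..<n} {n..<n+n}) = ?M2"
    using PP.distr_merge[of "{..<n}" "{n..<n+n}"] by (simp add: U M_def)
  finally have "ennreal (1 / 2 * measure M bad) \<le> ennreal (measure ?M2 bad2)"
    by (simp only: M.emeasure_eq_measure M2.emeasure_eq_measure) (subst ennreal_mult, auto)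
  then have half: "measure M bad \<le> 2 * measure ?M2 bad2" by (subst (asm) ennreal_le_iff) auto
  \<comment> \<open>This makes 10 b = n t / 2, the threshold in \<open>R\<close>; then b^2 / (4 n) =
    n t^2 / 1600, and 40 d n <= b^2 is the hypothesis 16000 d <= n t^2.\<close>
  define b where "b = real n * t / 20"
  have b: "0 \<le> b" "40 * real d * real n \<le> b\<^sup>2"
  proof -
    show "0 \<le> b" using t by (simp add: b_def)
    have "16000 * real d * real n \<le> real n * t\<^sup>2 * real n" using t(2) by (rule mult_right_mono) simp
    then show "40 * real d * real n \<le> b\<^sup>2" by (simp add: b_def power2_eq_square field_simps)
  qed
  define \<tau> where "\<tau> s \<omega> = (\<lambda>i\<in>{..<n+n}. \<omega> (ghost_swap n s i))" for s and \<omega> :: "nat \<Rightarrow> 'a"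
  have \<tau>: "\<tau> s \<in> measurable ?M2 ?M2" "measure ?M2 bad2 = measure ?M2 (\<tau> s -` bad2 \<inter> space ?M2)"
    if s: "s \<in> Pow {..<n}" for s
  proof -
    have g: "inj_on (ghost_swap n s) {..<n+n}" "ghost_swap n s \<in> {..<n+n} \<rightarrow> {..<n+n}"
      using ghost_swap_bij[of s n] s by auto
    show m: "\<tau> s \<in> measurable ?M2 ?M2" unfolding \<tau>_def
      by (rule measurable_restrict, rule measurable_component_singleton) (use g in auto)
    have "distr ?M2 ?M2 (\<tau> s) = ?M2" unfolding \<tau>_def
      by (rule distr_PiM_reindex[where M = "\<lambda>_. P", OF P g])
    then show "measure ?M2 bad2 = measure ?M2 (\<tau> s -` bad2 \<inter> space ?M2)"
      using measure_distr[OF m bad2] by simp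
  qed
  have int: "integrable ?M2 (indicator (\<tau> s -` bad2 \<inter> space ?M2) :: _ \<Rightarrow> real)" if "s \<in> Pow {..<n}" for s
    by (rule integrable_real_indicator) (use measurable_sets[OF \<tau>(1)[OF that] bad2] in \<open>simp_all add: M2.emeasure_eq_measure\<close>)
  \<comment> \<open>Invariance turns the probability into an average over all \<open>2 ^ n\<close>
    swaps; after exchanging sum and integral the sample is fixed and only the swaps are
    counted.\<close>
  have "2 ^ n * measure ?M2 bad2 = (\<Sum>s\<in>Pow {..<n}. measure ?M2 (\<tau> s -` bad2 \<inter> space ?M2))"
  proof -
    have "(\<Sum>s\<in>Pow {..<n}. measure ?M2 (\<tau> s -` bad2 \<inter> space ?M2)) = (\<Sum>s\<in>Pow {..<n}. measure ?M2 bad2)"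
      by (intro sum.cong refl \<tau>(2)[symmetric])
    then show ?thesis by (simp add: card_Pow)
  qed
  also have "\<dots> = (\<Sum>s\<in>Pow {..<n}. (\<integral>\<omega>. indicator (\<tau> s -` bad2 \<inter> space ?M2) \<omega> \<partial>?M2))"
    by (intro sum.cong refl) (simp add: Int_absorb1 sets.sets_into_space)
  also have "\<dots> = (\<integral>\<omega>. (\<Sum>s\<in>Pow {..<n}. indicator (\<tau> s -` bad2 \<inter> space ?M2) \<omega>) \<partial>?M2)"
    by (rule Bochner_Integration.integral_sum[symmetric]) (rule int)
  also have "\<dots> \<le> (\<integral>\<omega>. 2 ^ n * (6 * exp (- b\<^sup>2 / (4 * n))) \<partial>?M2)"
  proof (rule integral_mono)
    show "integrable ?M2 (\<lambda>\<omega>. \<Sum>s\<in>Pow {..<n}. indicator (\<tau> s -` bad2 \<inter> space ?M2) \<omega> :: real)"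
      by (rule Bochner_Integration.integrable_sum) (rule int)
    fix \<omega>
    have "(\<Sum>s\<in>Pow {..<n}. indicator (\<tau> s -` bad2 \<inter> space ?M2) \<omega> :: real) = real (card {s\<in>Pow {..<n}. \<omega> \<in> \<tau> s -` bad2 \<inter> space ?M2})"
      by (simp add: indicator_def sum.If_cases Int_def)
    also have "\<dots> \<le> real (card {s\<in>Pow {..<n}. \<exists>C\<in>\<C>. 10 * b < signed_card s (hits n (\<lambda>i. \<omega> (i + n)) C) + signed_card ({..<n} - s) (hits n \<omega> C)})"
    proof (intro of_nat_mono card_mono subsetI)
      fix s assume s: "s \<in> {s\<in>Pow {..<n}. \<omega> \<in> \<tau> s -` bad2 \<inter> space ?M2}"
      then obtain C where C: "C \<in> \<C>" "R (\<tau> s \<omega>) C" by (auto simp: bad2_def)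
      have "10 * b < signed_card s (hits n (\<lambda>i. \<omega> (i + n)) C) + signed_card ({..<n} - s) (hits n \<omega> C)"
      proof -
        have "s \<subseteq> {..<n}" using s by simp
        from ghost_swap_difference[OF this \<tau>_def[of s \<omega>], of C] C(2) show ?thesis
          unfolding R_def b_def by linarith
      qed
      then show "s \<in> {s\<in>Pow {..<n}. \<exists>C\<in>\<C>. 10 * b < signed_card s (hits n (\<lambda>i. \<omega> (i + n)) C) + signed_card ({..<n} - s) (hits n \<omega> C)}"
        using s C(1) by blast
    qed simp
    also have "\<dots> \<le> 2 ^ n * (6 * exp (- b\<^sup>2 / (4 * n)))" by (rule count_ghost_swaps[OF vc n d b])
    finally show "(\<Sum>s\<in>Pow {..<n}. indicator (\<tau> s -` bad2 \<inter> space ?M2) \<omega> :: real) \<le> 2 ^ n * (6 * exp (- b\<^sup>2 / (4 * n)))" .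
  qed simp
  finally have "measure ?M2 bad2 \<le> 6 * exp (- b\<^sup>2 / (4 * n))" by (simp add: M2.prob_space)
  moreover have "- b\<^sup>2 / (4 * n) = - (real n * t\<^sup>2 / 1600)"
    using n by (simp add: b_def power2_eq_square field_simps)
  ultimately have "measure ?M2 bad2 \<le> 6 * exp (- (real n * t\<^sup>2 / 1600))" by (simp only:)
  then show "measure M bad \<le> 12 * exp (- (real n * t\<^sup>2 / 1600))" using half by linarith
qed

section \<open>Halfspaces in finite-dimensional function spaces\<close>

text \<open>Gaussian elimination: if equation j has a nonzero coefficient at some x0, it is solved
  for that unknown, and \<open>g\<close> holds the coefficients of the remaining equations after
  substitution.\<close>

lemma homogeneous_system_nontrivial_solution:
  fixes e :: "'i \<Rightarrow> 's \<Rightarrow> real"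
  assumes "finite I" "finite S" "card I < card S"
  shows "\<exists>l. (\<exists>x\<in>S. l x \<noteq> 0) \<and> (\<forall>i\<in>I. (\<Sum>x\<in>S. l x * e i x) = 0)"
  using assms
proof (induction I arbitrary: e S rule: finite_induct)
  case empty
  then have "S \<noteq> {}" by auto
  then show ?case by (intro exI[of _ "\<lambda>_. 1"]) auto
next
  case (insert j I)
  show ?case
  proof (cases "\<exists>x0\<in>S. e j x0 \<noteq> 0")
    case False
    have "card I < card S" using insert by simp
    then obtain l where l: "\<exists>x\<in>S. l x \<noteq> 0" "\<forall>i\<in>I. (\<Sum>x\<in>S. l x * e i x) = 0"
      using insert.IH[OF insert.prems(1), of e] by blast
    have "(\<Sum>x\<in>S. l x * e j x) = 0" using False by simp
    then show ?thesis using l by blast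
  next
    case True
    then obtain x0 where x0: "x0 \<in> S" "e j x0 \<noteq> 0" by blast
    define g where "g i x = e i x - e i x0 * e j x / e j x0" for i x
    have "card I < card (S - {x0})" using insert x0 by (simp add: card_Diff_singleton)
    then obtain l where l: "\<exists>x\<in>S - {x0}. l x \<noteq> 0" "\<And>i. i \<in> I \<Longrightarrow> (\<Sum>x\<in>S - {x0}. l x * g i x) = 0"
      using insert.IH[of "S - {x0}" g] insert by blast
    define c where "c = - (\<Sum>x\<in>S - {x0}. l x * e j x) / e j x0"
    define l' where "l' = l(x0 := c)"
    have s: "(\<Sum>x\<in>S. l' x * f x) = c * f x0 + (\<Sum>x\<in>S - {x0}. l x * f x)" for f
    proof -
      have "(\<Sum>x\<in>S. l' x * f x) = l' x0 * f x0 + (\<Sum>x\<in>S - {x0}. l' x * f x)"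
        using insert x0 by (subst sum.remove[of S x0]) auto
      also have "(\<Sum>x\<in>S - {x0}. l' x * f x) = (\<Sum>x\<in>S - {x0}. l x * f x)" by (intro sum.cong) (auto simp: l'_def)
      finally show ?thesis by (simp add: l'_def)
    qed
    have "(\<Sum>x\<in>S. l' x * e j x) = 0" unfolding s using x0 by (simp add: c_def)
    moreover have "(\<Sum>x\<in>S. l' x * e i x) = 0" if "i \<in> I" for i
    proof -
      have "0 = (\<Sum>x\<in>S - {x0}. l x * e i x - l x * e j x * (e i x0 / e j x0))"
        using l(2)[OF that] by (simp add: g_def algebra_simps)
      also have "\<dots> = (\<Sum>x\<in>S - {x0}. l x * e i x) - (\<Sum>x\<in>S - {x0}. l x * e j x) * (e i x0 / e j x0)"
        by (simp only: sum_subtractf sum_distrib_right)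
      finally show ?thesis unfolding s c_def using x0 by (simp add: field_simps)
    qed
    moreover have "\<exists>x\<in>S. l' x \<noteq> 0" using l(1) by (auto simp: l'_def)
    ultimately show ?thesis by blast
  qed
qed

text \<open>With more points than basis functions there is a linear relation l that annihilates
  every g in the span. If the points were shattered, some g would be positive exactly where l is;
  then every product l g is nonnegative and one is positive, against the relation.\<close>

lemma vc_le_positivity_sets:
  fixes \<phi> :: "'i \<Rightarrow> 'a \<Rightarrow> real"
  assumes I: "finite I"
    and G: "\<And>g. g \<in> G \<Longrightarrow> \<exists>a. \<forall>x. g x = (\<Sum>i\<in>I. a i * \<phi> i x)"
  shows "vc_le (hits n \<omega> ` (\<lambda>g. {x. 0 < g x}) ` G) (card I)"
  unfolding vc_le_def
proof (intro allI impI, rule ccontr)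
  fix S assume S: "finite S" "shatters (hits n \<omega> ` (\<lambda>g. {x. 0 < g x}) ` G) S" "\<not> card S \<le> card I"
  have sh: "\<exists>g\<in>G. {k\<in>S. 0 < g (\<omega> k)} = T" if T: "T \<subseteq> S" for T
  proof -
    have "S \<subseteq> {..<n}" using S(2)[unfolded shatters_def, rule_format, OF order_refl] hits_subset by blast
    obtain g where "g \<in> G" "hits n \<omega> {x. 0 < g x} \<inter> S = T"
      using S(2)[unfolded shatters_def, rule_format, OF T] by blast
    moreover have "hits n \<omega> {x. 0 < g x} \<inter> S = {k\<in>S. 0 < g (\<omega> k)}"
      using \<open>S \<subseteq> {..<n}\<close> by (auto simp: hits_def)
    ultimately show ?thesis by blast
  qed
  have "\<exists>l. (\<exists>x\<in>S. l x \<noteq> 0) \<and> (\<forall>i\<in>I. (\<Sum>k\<in>S. l k * \<phi> i (\<omega> k)) = 0)"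
    by (rule homogeneous_system_nontrivial_solution[OF I S(1)]) (use S(3) in simp)
  then obtain l0 where l0: "\<exists>x\<in>S. l0 x \<noteq> 0" "\<And>i. i \<in> I \<Longrightarrow> (\<Sum>k\<in>S. l0 k * \<phi> i (\<omega> k)) = 0" by blast
  \<comment> \<open>The sign of the relation is fixed so that some coefficient is positive; without
    one, all products could vanish and no contradiction would arise.\<close>
  have "\<exists>l. (\<exists>x\<in>S. 0 < l x) \<and> (\<forall>i\<in>I. (\<Sum>k\<in>S. l k * \<phi> i (\<omega> k)) = 0)"
  proof (cases "\<exists>x\<in>S. 0 < l0 x")
    case True then show ?thesis using l0 by blast
  next
    case False
    then have "\<exists>x\<in>S. 0 < - l0 x" using l0(1) by force
    moreover have "(\<Sum>k\<in>S. - l0 k * \<phi> i (\<omega> k)) = 0" if "i \<in> I" for i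
      using l0(2)[OF that] by (simp add: sum_negf)
    ultimately show ?thesis by (intro exI[of _ "\<lambda>x. - l0 x"]) blast
  qed
  then obtain l where l: "\<exists>x\<in>S. 0 < l x" "\<And>i. i \<in> I \<Longrightarrow> (\<Sum>k\<in>S. l k * \<phi> i (\<omega> k)) = 0" by blast
  obtain g where g: "g \<in> G" "{k\<in>S. 0 < g (\<omega> k)} = {k\<in>S. 0 < l k}" using sh[of "{k\<in>S. 0 < l k}"] by blast
  obtain a where a: "\<And>x. g x = (\<Sum>i\<in>I. a i * \<phi> i x)" using G[OF g(1)] by blast
  have "(\<Sum>k\<in>S. l k * g (\<omega> k)) = (\<Sum>k\<in>S. \<Sum>i\<in>I. a i * (l k * \<phi> i (\<omega> k)))"
    unfolding a by (simp add: sum_distrib_left mult.left_commute)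
  also have "\<dots> = (\<Sum>i\<in>I. a i * (\<Sum>k\<in>S. l k * \<phi> i (\<omega> k)))"
    by (subst sum.swap) (simp add: sum_distrib_left)
  also have "\<dots> = 0" using l(2) by simp
  finally have z: "(\<Sum>k\<in>S. l k * g (\<omega> k)) = 0" .
  have iff: "0 < g (\<omega> k) \<longleftrightarrow> 0 < l k" if "k \<in> S" for k using g(2) that by blast
  have nn: "0 \<le> l k * g (\<omega> k)" if "k \<in> S" for k
    using iff[OF that] by (cases "0 < l k") (auto simp: zero_le_mult_iff not_less)
  obtain k where k: "k \<in> S" "0 < l k" using l(1) by blast
  have "0 < l k * g (\<omega> k)" using k iff by simp
  then have "0 < (\<Sum>k\<in>S. l k * g (\<omega> k))" using sum_pos2[where f = "\<lambda>k. l k * g (\<omega> k)", OF S(1) k(1)] nn by simp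
  then show False using z by simp
qed

section \<open>Uniform deviations for linear and affine families with real coefficients\<close>

lemma real_approx_rat:
  fixes a :: "'i \<Rightarrow> real"
  assumes "0 < (e::real)"
  shows "\<exists>q::'i \<Rightarrow> rat. \<forall>i. \<bar>of_rat (q i) - a i\<bar> < e"
proof -
  have "\<exists>q::rat. \<bar>of_rat q - a i\<bar> < e" for i
  proof -
    obtain r where r: "r \<in> \<rat>" "a i - e < r" "r < a i + e" using Rats_dense_in_real[of "a i - e" "a i + e"] assms by auto
    then obtain q where "r = of_rat q" by (auto elim: Rats_cases)
    then show ?thesis using r by (intro exI[of _ q]) auto
  qed
  then show ?thesis by metis
qed

text \<open>The class over real coefficients is reached from the countable one over rational
  coefficients by approximating \<open>g - 1/k\<close>: a point with \<open>g = 0\<close> eventually leaves the approximating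
  sets, so no mass of \<open>{g = 0}\<close> is gained in the limit.\<close>

lemma linear_uniform_deviation:
  fixes \<phi> :: "'i \<Rightarrow> 'a \<Rightarrow> real"
  assumes P: "prob_space P" and I: "finite I" and i0: "i0 \<in> I" "\<And>x. \<phi> i0 x = 1"
    and \<phi>: "\<And>i. i \<in> I \<Longrightarrow> \<phi> i \<in> borel_measurable P"
    and n: "0 < n" and t: "0 < t" "16000 * real (card I) \<le> real n * t\<^sup>2"
  defines "M \<equiv> PiM {..<n} (\<lambda>_. P)"
  shows "\<exists>E\<in>sets M. 1 - 12 * exp (- (real n * t\<^sup>2 / 1600)) \<le> measure M E \<and>
    (\<forall>\<omega>\<in>E. \<forall>a. real (card {i\<in>{..<n}. 0 < (\<Sum>k\<in>I. a k * \<phi> k (\<omega> i))})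
        \<le> real n * (measure P {x\<in>space P. 0 < (\<Sum>k\<in>I. a k * \<phi> k x)} + t))"
proof -
  interpret P: prob_space P by fact
  interpret M: prob_space M unfolding M_def by (rule prob_space_PiM) (rule P)
  define L where "L a x = (\<Sum>k\<in>I. a k * \<phi> k x)" for a :: "'i \<Rightarrow> real" and x
  define pos where "pos a = {x\<in>space P. 0 < L a x}" for a
  have Lm[measurable]: "L a \<in> borel_measurable P" for a
    unfolding L_def[abs_def] using \<phi> by measurable
  have pm[measurable]: "pos a \<in> sets P" for a unfolding pos_def by measurable
  define Q where "Q = (\<lambda>q i. real_of_rat (q i)) ` (PiE I (\<lambda>_. UNIV :: rat set))"
  have cQ: "countable Q" unfolding Q_def using I by (intro countable_image countable_PiE) auto
  \<comment> \<open>Cutting each basis function off outside \<open>space P\<close> turns the sets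
    \<open>pos a\<close> into full positivity sets without enlarging the basis.\<close>
  have vc: "vc_le (hits n \<omega> ` pos ` Q) (card I)" for \<omega>
  proof -
    have "pos ` Q = (\<lambda>g. {x. 0 < g x}) ` (\<lambda>a x. L a x * indicator (space P) x) ` Q"
      by (auto simp: pos_def indicator_def image_image split: if_splits intro!: image_cong)
    moreover have "vc_le (hits n \<omega> ` (\<lambda>g. {x. 0 < g x}) ` (\<lambda>a x. L a x * indicator (space P) x) ` Q) (card I)"
    proof (rule vc_le_positivity_sets[OF I, where \<phi> = "\<lambda>i x. \<phi> i x * indicator (space P) x"])
      fix g assume "g \<in> (\<lambda>a x. L a x * indicator (space P) x) ` Q"
      then obtain a where "g = (\<lambda>x. L a x * indicator (space P) x)" by blast
      then show "\<exists>a. \<forall>x. g x = (\<Sum>i\<in>I. a i * (\<phi> i x * indicator (space P) x))"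
        by (intro exI[of _ a]) (simp add: L_def sum_distrib_right mult.assoc)
    qed
    ultimately show ?thesis by simp
  qed
  have cI: "1 \<le> card I" using I i0 by (metis One_nat_def Suc_leI card_gt_0_iff empty_iff)
  define bad where "bad = {\<omega>\<in>space M. \<exists>C\<in>pos ` Q. real n * (measure P C + t) < real (card (hits n \<omega> C))}"
  have bad: "bad \<in> sets M" "measure M bad \<le> 12 * exp (- (real n * t\<^sup>2 / 1600))"
    unfolding bad_def M_def
    by (rule vc_uniform_deviation[OF P _ _ vc n cI t]; use cQ in auto)+
  show ?thesis
  proof (intro bexI[of _ "space M - bad"] conjI ballI allI)
    show "space M - bad \<in> sets M" using bad by simp
    show "1 - 12 * exp (- (real n * t\<^sup>2 / 1600)) \<le> measure M (space M - bad)"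
      using M.prob_compl[OF bad(1)] bad(2) by simp
  next
    fix \<omega> a assume \<omega>: "\<omega> \<in> space M - bad"
    have \<omega>P: "\<omega> i \<in> space P" if "i < n" for i using \<omega> that by (auto simp: M_def space_PiM)
    \<comment> \<open>The coefficient of the constant function \<open>\<phi> i0\<close> is lowered
      by \<open>e m\<close>, and all coefficients are then rounded to rationals within
      \<open>(e m)\<^sup>2\<close>. At a fixed point the rounding error is of order
      \<open>(e m)\<^sup>2\<close>, so the downward shift eventually wins.\<close>
    define e where "e m = 1 / (real m + 1)" for m
    have e: "0 < e m" for m by (simp add: e_def)
    have "\<exists>q::'i \<Rightarrow> rat. \<forall>i. \<bar>of_rat (q i) - (a i - (if i = i0 then e m else 0))\<bar> < (e m)\<^sup>2" for m
      by (rule real_approx_rat) (rule zero_less_power[OF e])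
    then obtain q :: "nat \<Rightarrow> 'i \<Rightarrow> rat" where q: "\<And>m i. \<bar>of_rat (q m i) - (a i - (if i = i0 then e m else 0))\<bar> < (e m)\<^sup>2"
      by metis
    define b where "b m i = real_of_rat (restrict (q m) I i)" for m i
    have bQ: "b m \<in> Q" for m unfolding Q_def b_def[abs_def] by (rule imageI) auto
    have close: "\<bar>L (b m) x - (L a x - e m)\<bar> \<le> (e m)\<^sup>2 * (\<Sum>k\<in>I. \<bar>\<phi> k x\<bar>)" for m x
    proof -
      have "e m = (\<Sum>k\<in>I. (if k = i0 then e m else 0) * \<phi> k x)"
        using I i0 by (simp add: if_distrib[of "\<lambda>c. c * _"] sum.delta cong: if_cong)
      then have "L (b m) x - (L a x - e m) = (\<Sum>k\<in>I. (of_rat (q m k) - (a k - (if k = i0 then e m else 0))) * \<phi> k x)"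
        unfolding L_def b_def by (simp add: sum_subtractf sum.distrib left_diff_distrib)
      also have "\<bar>\<dots>\<bar> \<le> (\<Sum>k\<in>I. \<bar>(of_rat (q m k) - (a k - (if k = i0 then e m else 0))) * \<phi> k x\<bar>)"
        by (rule sum_abs)
      also have "\<dots> \<le> (\<Sum>k\<in>I. (e m)\<^sup>2 * \<bar>\<phi> k x\<bar>)"
        unfolding abs_mult by (intro sum_mono mult_right_mono less_imp_le[OF q]) simp
      finally show ?thesis by (simp add: sum_distrib_left)
    qed
    have e0: "e \<longlonglongrightarrow> 0" unfolding e_def[abs_def]
      using LIMSEQ_inverse_real_of_nat by (simp add: inverse_eq_divide add.commute)
    have lim: "(\<lambda>m. L (b m) x) \<longlonglongrightarrow> L a x" for x
    proof -
      have "(\<lambda>m. (e m)\<^sup>2 * (\<Sum>k\<in>I. \<bar>\<phi> k x\<bar>)) \<longlonglongrightarrow> 0\<^sup>2 * (\<Sum>k\<in>I. \<bar>\<phi> k x\<bar>)"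
        by (intro tendsto_intros e0)
      then have t0: "(\<lambda>m. (e m)\<^sup>2 * (\<Sum>k\<in>I. \<bar>\<phi> k x\<bar>)) \<longlonglongrightarrow> 0" by simp
      have "(\<lambda>m. L (b m) x - (L a x - e m)) \<longlonglongrightarrow> 0"
        by (rule Lim_null_comparison[OF _ t0], rule always_eventually, rule allI, unfold real_norm_def, rule close)
      then have "(\<lambda>m. (L (b m) x - (L a x - e m)) + (L a x - e m)) \<longlonglongrightarrow> 0 + (L a x - 0)"
        by (intro tendsto_intros e0)
      then show ?thesis by simp
    qed
    have out: "\<forall>\<^sub>F m in sequentially. indicator (pos (b m) - pos a) x = (0::real)" for x
    proof (cases "x \<in> space P \<and> L a x \<le> 0")
      case False then show ?thesis by (auto simp: pos_def not_le)
    next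
      case True
      obtain m0 :: nat where m0: "(\<Sum>k\<in>I. \<bar>\<phi> k x\<bar>) \<le> real m0" using real_arch_simple by blast
      have "L (b m) x \<le> 0" if "m0 \<le> m" for m
      proof -
        have "(e m)\<^sup>2 * (\<Sum>k\<in>I. \<bar>\<phi> k x\<bar>) \<le> (e m)\<^sup>2 * (real m + 1)"
          using m0 that by (intro mult_left_mono) auto
        also have "\<dots> = e m" by (simp add: e_def power2_eq_square)
        finally show ?thesis using close[of m x] True by linarith
      qed
      then show ?thesis unfolding eventually_sequentially
        by (intro exI[of _ m0]) (auto simp: pos_def indicator_def not_less)
    qed
    have diff0: "(\<lambda>m. measure P (pos (b m) - pos a)) \<longlonglongrightarrow> 0"
    proof -
      have "(\<lambda>m. \<integral>x. indicator (pos (b m) - pos a) x \<partial>P) \<longlonglongrightarrow> (\<integral>x. (0::real) \<partial>P)"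
      proof (rule integral_dominated_convergence[where w = "\<lambda>_. 1"])
        show "AE x in P. (\<lambda>m. indicator (pos (b m) - pos a) x) \<longlonglongrightarrow> (0::real)"
          using out by (intro AE_I2 tendsto_eventually) auto
      qed (auto simp: indicator_def)
      then show ?thesis by (simp add: Int_absorb2 sets.sets_into_space pos_def)
    qed
    have ev: "\<forall>\<^sub>F m in sequentially. real (card (hits n \<omega> (pos a))) \<le> real n * (measure P (pos a) + measure P (pos (b m) - pos a) + t)"
    proof -
      have "\<forall>\<^sub>F m in sequentially. \<forall>i\<in>hits n \<omega> (pos a). 0 < L (b m) (\<omega> i)"
      proof (subst eventually_ball_finite_distrib)
        show "finite (hits n \<omega> (pos a))" by (rule finite_subset[OF hits_subset]) simp
        show "\<forall>i\<in>hits n \<omega> (pos a). \<forall>\<^sub>F m in sequentially. 0 < L (b m) (\<omega> i)"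
          using order_tendstoD(1)[OF lim] by (auto simp: hits_def pos_def)
      qed
      then show ?thesis
      proof eventually_elim
        case (elim m)
        then have "hits n \<omega> (pos a) \<subseteq> hits n \<omega> (pos (b m))" by (auto simp: hits_def pos_def)
        then have "real (card (hits n \<omega> (pos a))) \<le> real (card (hits n \<omega> (pos (b m))))"
          using finite_subset[OF hits_subset] by (intro of_nat_mono card_mono) auto
        also have "\<dots> \<le> real n * (measure P (pos (b m)) + t)"
        proof -
          have "pos (b m) \<in> pos ` Q" using bQ by blast
          then have "\<not> real n * (measure P (pos (b m)) + t) < real (card (hits n \<omega> (pos (b m))))"
            using \<omega> unfolding bad_def by blast
          then show ?thesis by simp
        qed
        also have "measure P (pos (b m)) \<le> measure P (pos a \<union> (pos (b m) - pos a))"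
          by (rule P.finite_measure_mono) auto
        also have "\<dots> \<le> measure P (pos a) + measure P (pos (b m) - pos a)"
          by (rule measure_Un_le) auto
        finally show ?case by (simp add: mult_left_mono)
      qed
    qed
    have "(\<lambda>m. real n * (measure P (pos a) + measure P (pos (b m) - pos a) + t)) \<longlonglongrightarrow> real n * (measure P (pos a) + 0 + t)"
      by (intro tendsto_intros diff0)
    from tendsto_lowerbound[OF this ev] have "real (card (hits n \<omega> (pos a))) \<le> real n * (measure P (pos a) + t)" by simp
    moreover have "hits n \<omega> (pos a) = {i\<in>{..<n}. 0 < (\<Sum>k\<in>I. a k * \<phi> k (\<omega> i))}"
      using \<omega>P by (auto simp: hits_def pos_def L_def)
    ultimately show "real (card {i\<in>{..<n}. 0 < (\<Sum>k\<in>I. a k * \<phi> k (\<omega> i))})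
        \<le> real n * (measure P {x\<in>space P. 0 < (\<Sum>k\<in>I. a k * \<phi> k x)} + t)"
      by (simp add: pos_def L_def)
  qed
qed

text \<open>Reduction to the linear case with p m + 2 basis functions: \<open>None\<close> indexes
  the constant 1, \<open>Some None\<close> the offset and \<open>Some (Some (j, i))\<close> the
  function \<open>f i j\<close>. The constant acts as a movable level: the closed condition 0 <= g
  is the decreasing limit of 0 < g + 1 / (k + 1), so the same event serves strict and non-strict
  inequalities.\<close>

lemma affine_uniform_deviation:
  fixes off :: "'a \<Rightarrow> real" and f :: "nat \<Rightarrow> nat \<Rightarrow> 'a \<Rightarrow> real"
  assumes P: "prob_space P" and off: "off \<in> borel_measurable P"
    and f: "\<And>i j. i < p \<Longrightarrow> j < m \<Longrightarrow> f i j \<in> borel_measurable P"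
    and n: "0 < n" and t: "0 < t" "16000 * real (p * m + 2) \<le> real n * t\<^sup>2"
  defines "M \<equiv> PiM {..<n} (\<lambda>_. P)"
  shows "\<exists>E\<in>sets M. 1 - 12 * exp (- (real n * t\<^sup>2 / 1600)) \<le> measure M E \<and>
    (\<forall>\<omega>\<in>E. \<forall>c. real (card {k\<in>{..<n}. 0 < off (\<omega> k) + (\<Sum>j<m. \<Sum>i<p. c i j * f i j (\<omega> k))})
        \<le> real n * (measure P {x\<in>space P. 0 < off x + (\<Sum>j<m. \<Sum>i<p. c i j * f i j x)} + t) \<and>
      real (card {k\<in>{..<n}. 0 \<le> off (\<omega> k) + (\<Sum>j<m. \<Sum>i<p. c i j * f i j (\<omega> k))})
        \<le> real n * (measure P {x\<in>space P. 0 \<le> off x + (\<Sum>j<m. \<Sum>i<p. c i j * f i j x)} + t))"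
proof -
  interpret P: prob_space P by fact
  define I :: "(nat \<times> nat) option option set" where
    "I = insert None (insert (Some None) ((\<lambda>q. Some (Some q)) ` ({..<m} \<times> {..<p})))"
  define \<phi> where "\<phi> q x = (case q of None \<Rightarrow> 1 | Some None \<Rightarrow> off x | Some (Some (j, i)) \<Rightarrow> f i j x)" for q x
  have I: "finite I" "card I = p * m + 2"
  proof -
    show "finite I" by (simp add: I_def)
    have "card ((\<lambda>q. Some (Some q)) ` ({..<m} \<times> {..<p})) = p * m"
      by (subst card_image) (auto simp: inj_on_def card_cartesian_product)
    then show "card I = p * m + 2" by (simp add: I_def card_insert_if image_iff)
  qed
  have sumI: "(\<Sum>q\<in>I. a q * \<phi> q x) = a None + a (Some None) * off x + (\<Sum>j<m. \<Sum>i<p. a (Some (Some (j, i))) * f i j x)" for a x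
  proof -
    have "(\<Sum>q\<in>(\<lambda>q. Some (Some q)) ` ({..<m} \<times> {..<p}). a q * \<phi> q x) = (\<Sum>(j, i)\<in>{..<m} \<times> {..<p}. a (Some (Some (j, i))) * f i j x)"
      by (subst sum.reindex) (auto simp: inj_on_def \<phi>_def case_prod_unfold)
    also have "\<dots> = (\<Sum>j<m. \<Sum>i<p. a (Some (Some (j, i))) * f i j x)" by (simp add: sum.cartesian_product)
    finally have "(\<Sum>q\<in>(\<lambda>q. Some (Some q)) ` ({..<m} \<times> {..<p}). a q * \<phi> q x) = (\<Sum>j<m. \<Sum>i<p. a (Some (Some (j, i))) * f i j x)" .
    then show ?thesis unfolding I_def
      by (subst sum.insert, simp, force, subst sum.insert, simp, force) (simp add: \<phi>_def)
  qed
  have "\<exists>E\<in>sets M. 1 - 12 * exp (- (real n * t\<^sup>2 / 1600)) \<le> measure M E \<and>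
    (\<forall>\<omega>\<in>E. \<forall>a. real (card {i\<in>{..<n}. 0 < (\<Sum>k\<in>I. a k * \<phi> k (\<omega> i))})
        \<le> real n * (measure P {x\<in>space P. 0 < (\<Sum>k\<in>I. a k * \<phi> k x)} + t))"
    unfolding M_def
  proof (rule linear_uniform_deviation[OF P I(1) _ _ _ n t(1)])
    show "None \<in> I" by (simp add: I_def)
    show "\<phi> None x = 1" for x by (simp add: \<phi>_def)
    show "16000 * real (card I) \<le> real n * t\<^sup>2" using t(2) by (simp add: I(2))
    show "\<phi> q \<in> borel_measurable P" if "q \<in> I" for q
      using that off f by (auto simp: I_def \<phi>_def[abs_def])
  qed
  then obtain E where E: "E \<in> sets M" "1 - 12 * exp (- (real n * t\<^sup>2 / 1600)) \<le> measure M E"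
    and dev: "\<And>\<omega> a. \<omega> \<in> E \<Longrightarrow> real (card {i\<in>{..<n}. 0 < (\<Sum>k\<in>I. a k * \<phi> k (\<omega> i))})
        \<le> real n * (measure P {x\<in>space P. 0 < (\<Sum>k\<in>I. a k * \<phi> k x)} + t)" by blast
  show ?thesis
  proof (rule bexI[OF _ E(1)], rule conjI[OF E(2)], intro ballI allI)
    fix \<omega> c assume \<omega>: "\<omega> \<in> E"
    define g where "g x = off x + (\<Sum>j<m. \<Sum>i<p. c i j * f i j x)" for x
    have gm[measurable]: "g \<in> borel_measurable P"
      unfolding g_def[abs_def] using off f by measurable
    have le: "real (card {k\<in>{..<n}. 0 < g (\<omega> k) + e}) \<le> real n * (measure P {x\<in>space P. 0 < g x + e} + t)" for e
      using dev[OF \<omega>, of "\<lambda>q. case q of None \<Rightarrow> e | Some None \<Rightarrow> 1 | Some (Some (j, i)) \<Rightarrow> c i j"]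
      unfolding sumI by (simp add: g_def add_ac)
    define A where "A k = {x\<in>space P. 0 < g x + 1 / (real k + 1)}" for k :: nat
    have "(\<lambda>k. measure P (A k)) \<longlonglongrightarrow> measure P (\<Inter>k. A k)"
    proof (rule P.finite_Lim_measure_decseq)
      show "range A \<subseteq> P.events" unfolding A_def by auto
      show "decseq A"
      proof (rule antimonoI, rule subsetI)
        fix k l :: nat and x assume kl: "k \<le> l" and x: "x \<in> A l"
        have "1 / (real l + 1) \<le> 1 / (real k + 1)" using kl by (intro divide_left_mono) auto
        then show "x \<in> A k" using x unfolding A_def by auto
      qed
    qed
    moreover have "(\<Inter>k. A k) = {x\<in>space P. 0 \<le> g x}"
    proof (intro set_eqI iffI)
      fix x assume x: "x \<in> (\<Inter>k. A k)"
      have "0 \<le> g x"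
      proof (rule ccontr)
        assume "\<not> 0 \<le> g x"
        then obtain k where "inverse (real (Suc k)) < - g x" using reals_Archimedean[of "- g x"] by auto
        moreover have "x \<in> A k" using x by blast
        ultimately show False by (simp add: A_def inverse_eq_divide add.commute)
      qed
      then show "x \<in> {x\<in>space P. 0 \<le> g x}" using x by (auto simp: A_def)
    next
      fix x assume "x \<in> {x\<in>space P. 0 \<le> g x}"
      then show "x \<in> (\<Inter>k. A k)" by (auto simp: A_def intro: add_nonneg_pos)
    qed
    ultimately have lim: "(\<lambda>k. real n * (measure P (A k) + t)) \<longlonglongrightarrow> real n * (measure P {x\<in>space P. 0 \<le> g x} + t)"
      by (intro tendsto_intros) simp
    have "real (card {k\<in>{..<n}. 0 \<le> g (\<omega> k)}) \<le> real n * (measure P (A k) + t)" for k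
    proof -
      have "card {k\<in>{..<n}. 0 \<le> g (\<omega> k)} \<le> card {i\<in>{..<n}. 0 < g (\<omega> i) + 1 / (real k + 1)}"
        by (intro card_mono) (auto intro: add_nonneg_pos)
      then show ?thesis using le[of "1 / (real k + 1)"] unfolding A_def by linarith
    qed
    from LIMSEQ_le_const[OF lim] this have "real (card {k\<in>{..<n}. 0 \<le> g (\<omega> k)}) \<le> real n * (measure P {x\<in>space P. 0 \<le> g x} + t)"
      by blast
    then show "real (card {k\<in>{..<n}. 0 < off (\<omega> k) + (\<Sum>j<m. \<Sum>i<p. c i j * f i j (\<omega> k))})
        \<le> real n * (measure P {x\<in>space P. 0 < off x + (\<Sum>j<m. \<Sum>i<p. c i j * f i j x)} + t) \<and>
      real (card {k\<in>{..<n}. 0 \<le> off (\<omega> k) + (\<Sum>j<m. \<Sum>i<p. c i j * f i j (\<omega> k))})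
        \<le> real n * (measure P {x\<in>space P. 0 \<le> off x + (\<Sum>j<m. \<Sum>i<p. c i j * f i j x)} + t)"
      using le[of 0] unfolding g_def by simp
  qed
qed

section \<open>Gaussian estimates\<close>

lemma sets_std_gauss [measurable_cong, simp]: "sets std_gauss = sets borel"
  by (simp add: std_gauss_def)

lemma space_std_gauss [simp]: "space std_gauss = UNIV"
  by (simp add: std_gauss_def)

lemma measurable_std_gauss: "measurable std_gauss N = measurable borel N"
  by (rule measurable_cong_sets) simp_all

lemma prob_space_std_gauss: "prob_space std_gauss"
  unfolding std_gauss_def by (rule prob_space_normal_density) simp

definition gauss_vec :: "nat \<Rightarrow> (nat \<Rightarrow> real) measure" where
  "gauss_vec k = PiM {..<k} (\<lambda>_. std_gauss)"

lemma prob_space_gauss_vec: "prob_space (gauss_vec k)"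
  unfolding gauss_vec_def by (intro prob_space_PiM prob_space_std_gauss)

lemma measurable_gauss_vec_component [measurable]: "i < k \<Longrightarrow> (\<lambda>z. z i) \<in> borel_measurable (gauss_vec k)"
  unfolding gauss_vec_def by measurable

lemma distributed_gauss_component:
  assumes "i < k"
  shows "distributed (gauss_vec k) lborel (\<lambda>z. z i) std_normal_density"
proof -
  have "distr (gauss_vec k) std_gauss (\<lambda>z. z i) = std_gauss"
    unfolding gauss_vec_def by (rule distr_PiM_component) (use assms prob_space_std_gauss in auto)
  moreover have "distr (gauss_vec k) lborel (\<lambda>z. z i) = distr (gauss_vec k) std_gauss (\<lambda>z. z i)"
    by (rule distr_cong) auto
  ultimately show ?thesis using assms unfolding distributed_def by (simp add: std_gauss_def)
qed

lemma distributed_gauss_linear_form: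
  assumes v: "0 < (\<Sum>k<p. (v k)\<^sup>2)"
  shows "distributed (gauss_vec p) lborel (\<lambda>z. (\<Sum>k<p. v k * z k) / sqrt (\<Sum>k<p. (v k)\<^sup>2)) std_normal_density"
proof -
  interpret prob_space "gauss_vec p" by (rule prob_space_gauss_vec)
  \<comment> \<open>Zero coefficients are dropped, because the law of a sum of independent normals
    is used with positive standard deviations.\<close>
  define K where "K = {k\<in>{..<p}. v k \<noteq> 0}"
  have K: "finite K" "K \<noteq> {}"
  proof -
    show "finite K" by (simp add: K_def)
    show "K \<noteq> {}"
    proof
      assume "K = {}"
      then have "\<forall>k<p. v k = 0" by (auto simp: K_def)
      then show False using v by simp
    qed
  qed
  have s1: "(\<Sum>k\<in>K. v k * z k) = (\<Sum>k<p. v k * z k)" for z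
    by (rule sum.mono_neutral_left) (auto simp: K_def)
  have s2: "(\<Sum>k\<in>K. (v k)\<^sup>2) = (\<Sum>k<p. (v k)\<^sup>2)"
    by (rule sum.mono_neutral_left) (auto simp: K_def)
  have "{..<p} \<noteq> {}" using K by (auto simp: K_def)
  then have "indep_vars (\<lambda>_. std_gauss) (\<lambda>i z. z i) {..<p}"
    unfolding gauss_vec_def using indep_vars_PiM_coordinates[of "{..<p}" "\<lambda>_. std_gauss"] prob_space_std_gauss by simp
  then have "indep_vars (\<lambda>_. std_gauss) (\<lambda>i z. z i) K"
    by (rule indep_vars_subset) (auto simp: K_def)
  then have ind: "indep_vars (\<lambda>_. borel) (\<lambda>k z. v k * z k) K"
    by (rule indep_vars_compose2[where Y = "\<lambda>k x. v k * x"])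
      (unfold measurable_std_gauss, rule borel_measurable_times, auto)
  have "distributed (gauss_vec p) lborel (\<lambda>z. \<Sum>k\<in>K. v k * z k) (normal_density (\<Sum>k\<in>K. 0) (sqrt (\<Sum>k\<in>K. \<bar>v k\<bar>\<^sup>2)))"
  proof (rule sum_indep_normal[OF K ind])
    fix k assume k: "k \<in> K"
    show "0 < \<bar>v k\<bar>" using k by (simp add: K_def)
    show "distributed (gauss_vec p) lborel (\<lambda>z. v k * z k) (normal_density 0 \<bar>v k\<bar>)"
      using normal_density_affine[OF distributed_gauss_component, of k "v k" 0] k by (simp add: K_def)
  qed
  then have "distributed (gauss_vec p) lborel (\<lambda>z. \<Sum>k<p. v k * z k) (normal_density 0 (sqrt (\<Sum>k<p. (v k)\<^sup>2)))"
    by (simp add: s1 s2)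
  then show ?thesis
    using normal_standard_normal_convert[of "sqrt (\<Sum>k<p. (v k)\<^sup>2)" "\<lambda>z. \<Sum>k<p. v k * z k" 0] v by simp
qed

lemma distr_gauss_linear_form:
  assumes v: "0 < (\<Sum>k<p. (v k)\<^sup>2)"
  shows "distr (gauss_vec p) borel (\<lambda>z. (\<Sum>k<p. v k * z k) / sqrt (\<Sum>k<p. (v k)\<^sup>2)) = std_gauss"
proof -
  have "distr (gauss_vec p) borel (\<lambda>z. (\<Sum>k<p. v k * z k) / sqrt (\<Sum>k<p. (v k)\<^sup>2)) =
    distr (gauss_vec p) lborel (\<lambda>z. (\<Sum>k<p. v k * z k) / sqrt (\<Sum>k<p. (v k)\<^sup>2))"
    by (rule distr_cong) auto
  then show ?thesis using distributed_gauss_linear_form[OF v] by (simp add: distributed_def std_gauss_def)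
qed

section \<open>The standard Gaussian tail around 0\<close>

definition gauss_tail :: "real \<Rightarrow> real" where
  "gauss_tail x = measure std_gauss {x..}"

lemma gauss_tail_le_1: "gauss_tail x \<le> 1"
  unfolding gauss_tail_def using prob_space_std_gauss by (rule prob_space.prob_le_1)

lemma gauss_tail_antimono: "x \<le> y \<Longrightarrow> gauss_tail y \<le> gauss_tail x"
  unfolding gauss_tail_def
  by (rule finite_measure.finite_measure_mono[OF prob_space.finite_measure[OF prob_space_std_gauss]]) auto

lemma std_normal_density_le_half: "std_normal_density x \<le> 1 / 2"
proof -
  have "sqrt 4 \<le> sqrt (2 * pi)" using pi_ge_two by (intro real_sqrt_le_mono) simp
  then have "2 \<le> sqrt (2 * pi)" by simp
  then have "1 / sqrt (2 * pi) * exp (- x\<^sup>2 / 2) \<le> 1 / 2 * 1"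
    by (intro mult_mono divide_left_mono) auto
  then show ?thesis by (simp add: std_normal_density_def)
qed

lemma std_normal_density_ge_sixth:
  assumes "0 \<le> x" "x \<le> 1"
  shows "1 / 6 \<le> std_normal_density x"
proof -
  have "sqrt (2 * pi) \<le> sqrt 9" using pi_less_4 by (intro real_sqrt_le_mono) simp
  then have "sqrt (2 * pi) \<le> 3" by simp
  moreover have "1 / 2 \<le> exp (- x\<^sup>2 / 2)"
  proof -
    have "x\<^sup>2 \<le> 1" using assms by (simp add: power_le_one)
    then show ?thesis using exp_ge_add_one_self[of "- x\<^sup>2 / 2"] by simp
  qed
  ultimately have "1 / 3 * (1 / 2) \<le> 1 / sqrt (2 * pi) * exp (- x\<^sup>2 / 2)"
    by (intro mult_mono divide_left_mono) auto
  then show ?thesis by (simp add: std_normal_density_def)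
qed

lemma measure_std_gauss_interval_ge:
  assumes "0 \<le> x" "x \<le> 1"
  shows "x / 6 \<le> measure std_gauss {0..<x}"
proof -
  interpret prob_space std_gauss by (rule prob_space_std_gauss)
  have "ennreal (x / 6) = (\<integral>\<^sup>+y. ennreal (1 / 6) * indicator {0..<x} y \<partial>lborel)"
    using assms by (subst nn_integral_cmult_indicator) (auto simp: ennreal_mult[symmetric])
  also have "\<dots> \<le> (\<integral>\<^sup>+y. ennreal (std_normal_density y) * indicator {0..<x} y \<partial>lborel)"
    using assms std_normal_density_ge_sixth by (intro nn_integral_mono) (auto simp: indicator_def)
  also have "\<dots> = emeasure std_gauss {0..<x}"
    unfolding std_gauss_def by (subst emeasure_density) auto
  finally show ?thesis by (simp add: emeasure_eq_measure)
qed

lemma measure_std_gauss_interval_le: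
  assumes "x \<le> 0"
  shows "measure std_gauss {x..<0} \<le> - x / 2"
proof -
  interpret prob_space std_gauss by (rule prob_space_std_gauss)
  have "emeasure std_gauss {x..<0} = (\<integral>\<^sup>+y. ennreal (std_normal_density y) * indicator {x..<0} y \<partial>lborel)"
    unfolding std_gauss_def by (subst emeasure_density) auto
  also have "\<dots> \<le> (\<integral>\<^sup>+y. ennreal (1 / 2) * indicator {x..<0} y \<partial>lborel)"
    by (intro nn_integral_mono mult_right_mono ennreal_leI std_normal_density_le_half) auto
  also have "\<dots> = ennreal (1 / 2) * ennreal (- x)"
    using assms by (subst nn_integral_cmult_indicator) auto
  also have "\<dots> = ennreal (1 / 2 * (- x))" using assms by (intro ennreal_mult[symmetric]) auto
  finally show ?thesis using assms by (simp add: emeasure_eq_measure)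
qed

lemma gauss_tail_0: "gauss_tail 0 = 1 / 2"
proof -
  interpret prob_space std_gauss by (rule prob_space_std_gauss)
  have D: "distributed std_gauss lborel (\<lambda>x. x) std_normal_density"
    by (simp add: distributed_def std_gauss_def distr_id2)
  have "distributed std_gauss lborel (\<lambda>x. 0 + (-1) * x) std_normal_density"
    using normal_density_affine[OF D, of "-1" 0] by simp
  then have "distr std_gauss lborel (\<lambda>x. - x) = std_gauss"
    by (simp add: distributed_def std_gauss_def)
  then have "measure std_gauss {0..} = measure (distr std_gauss lborel (\<lambda>x. - x)) {0..}" by simp
  also have "\<dots> = measure std_gauss {..0}"
    by (subst measure_distr) (auto simp: vimage_def atMost_def measurable_std_gauss)
  also have "{..0::real} = {..<0} \<union> {0}" by auto
  also have "measure std_gauss ({..<0} \<union> {0}) = measure std_gauss {..<0} + measure std_gauss {0}"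
    by (rule finite_measure_Union) auto
  also have "measure std_gauss {0} = 0"
  proof -
    have "emeasure std_gauss {0} = (\<integral>\<^sup>+y. ennreal (std_normal_density y) * indicator {0} y \<partial>lborel)"
      unfolding std_gauss_def by (subst emeasure_density) auto
    also have "\<dots> = 0" by (subst nn_integral_indicator_singleton) auto
    finally show ?thesis by (simp add: measure_def)
  qed
  finally have "measure std_gauss {0..} = measure std_gauss {..<0}" by simp
  moreover have "measure std_gauss {0..} + measure std_gauss {..<0} = measure std_gauss ({0..} \<union> {..<0})"
    by (rule finite_measure_Union[symmetric]) auto
  moreover have "{0..} \<union> {..<0} = space std_gauss" by auto
  ultimately show ?thesis using prob_space unfolding gauss_tail_def by simp
qed

lemma gauss_tail_nonneg_le:
  assumes "0 \<le> x"
  shows "gauss_tail x \<le> 1 / 2 - min x 1 / 6"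
proof -
  interpret prob_space std_gauss by (rule prob_space_std_gauss)
  define y where "y = min x 1"
  have y: "0 \<le> y" "y \<le> 1" using assms by (auto simp: y_def)
  have "gauss_tail y + measure std_gauss {0..<y} = measure std_gauss ({y..} \<union> {0..<y})"
    unfolding gauss_tail_def by (rule finite_measure_Union[symmetric]) auto
  also have "{y..} \<union> {0..<y} = {0..}" using y by auto
  finally have "gauss_tail y + measure std_gauss {0..<y} = 1 / 2"
    using gauss_tail_0 by (simp add: gauss_tail_def)
  then show ?thesis using measure_std_gauss_interval_ge[OF y] gauss_tail_antimono[of y x]
    by (simp add: y_def)
qed

lemma gauss_tail_nonpos_le:
  assumes "x \<le> 0"
  shows "gauss_tail x \<le> 1 / 2 - x / 2"
proof -
  interpret prob_space std_gauss by (rule prob_space_std_gauss)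
  have "gauss_tail x = measure std_gauss ({0..} \<union> {x..<0})"
    unfolding gauss_tail_def using assms by (intro arg_cong[where f = "measure std_gauss"]) auto
  also have "\<dots> = gauss_tail 0 + measure std_gauss {x..<0}"
    unfolding gauss_tail_def by (rule finite_measure_Union) auto
  finally show ?thesis using measure_std_gauss_interval_le[OF assms] gauss_tail_0 by simp
qed

text \<open>In the application \<open>r1\<close> is |V^T z| and \<open>r2\<close> the norm of the
  net error at z. The right side replaces case distinctions by functions whose Gaussian means are
  controlled by E exp (- c r1^2) and E r2^2 alone. The first bracket equals at least -1 always and
  is nonnegative unless r1 >= 1/4 and r2 <= 1/8, the event on which the tail drops below 1/2. The
  second bounds 2 r2 and pays for r1 < r2 when \<tau> <= 1. The third is at least 1 when r1 < r2 and
  pays for the trivial bound 1 on the tail when \<tau> > 1.\<close>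

lemma gauss_tail_shifted_le:
  fixes r1 r2 \<tau> s \<eta> :: real
  assumes r: "0 < r1" "0 \<le> r2" and \<tau>: "0 < \<tau>" and s: "\<tau> * (r1 - r2) \<le> s" and \<eta>: "0 < \<eta>"
  shows "gauss_tail s \<le> 1 / 2 + min \<tau> 1 *
    ((3 * exp (- 16 * r1\<^sup>2) + 64 * r2\<^sup>2 - 1) / 48 + (\<eta> + r2\<^sup>2 / \<eta>) / 4 + (3 * exp (- 1000000 * r1\<^sup>2) + 1000000 * r2\<^sup>2) / 2)"
    (is "_ \<le> _ + ?t * (?A / 48 + ?B / 4 + ?C / 2)")
proof -
  have t: "0 < ?t" "?t \<le> 1" "?t \<le> \<tau>" using \<tau> by auto
  have BC: "0 \<le> ?B" "0 \<le> ?C" using \<eta> by auto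
  have e3: "1 \<le> 3 * exp (- x)" if "x \<le> 1" for x :: real
  proof -
    have "exp x \<le> 3" by (rule order_trans[OF _ exp_le]) (use that in simp)
    then show ?thesis by (simp add: exp_minus field_simps)
  qed
  \<comment> \<open>The arithmetic-geometric mean inequality, so that only the second moment of
    \<open>r2\<close> is needed later.\<close>
  have r2B: "2 * r2 \<le> ?B"
  proof -
    have "0 \<le> (\<eta> - r2)\<^sup>2 / \<eta>" using \<eta> by simp
    also have "\<dots> = ?B - 2 * r2" using \<eta> by (simp add: power2_eq_square field_simps)
    finally show ?thesis by simp
  qed
  have A1: "0 \<le> ?A" if "r1 < 1 / 4 \<or> 1 / 8 < r2"
    using that
  proof
    assume "r1 < 1 / 4"
    then have "r1\<^sup>2 \<le> (1 / 4)\<^sup>2" using r by (intro power_mono) auto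
    then have "16 * r1\<^sup>2 \<le> 1" by (simp add: power2_eq_square)
    from e3[OF this] have "1 \<le> 3 * exp (- 16 * r1\<^sup>2)" by simp
    then show ?thesis using zero_le_power2[of r2] by linarith
  next
    assume "1 / 8 < r2"
    then have "(1 / 8)\<^sup>2 \<le> r2\<^sup>2" by (intro power_mono) auto
    then have "1 \<le> 64 * r2\<^sup>2" by (simp add: power2_eq_square)
    moreover have "0 \<le> 3 * exp (- 16 * r1\<^sup>2)" by simp
    ultimately show ?thesis by linarith
  qed
  have A2: "- 1 \<le> ?A" by simp
  have C1: "1 \<le> ?C" if "r1 < r2"
  proof (cases "r1 < 1 / 1000")
    case True
    then have "r1\<^sup>2 \<le> (1 / 1000)\<^sup>2" using r by (intro power_mono) auto
    then have "1000000 * r1\<^sup>2 \<le> 1" by (simp add: power2_eq_square)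
    from e3[OF this] have "1 \<le> 3 * exp (- 1000000 * r1\<^sup>2)" by simp
    then show ?thesis using zero_le_power2[of r2] by linarith
  next
    case False
    then have "(1 / 1000)\<^sup>2 \<le> r2\<^sup>2" using that by (intro power_mono) auto
    then have "1 \<le> 1000000 * r2\<^sup>2" by (simp add: power2_eq_square)
    moreover have "0 \<le> 3 * exp (- 1000000 * r1\<^sup>2)" by simp
    ultimately show ?thesis by linarith
  qed
  have mono: "gauss_tail s \<le> gauss_tail (\<tau> * (r1 - r2))" using s by (rule gauss_tail_antimono)
  have X0: "0 \<le> a / 48 + b / 4 + c / 2" if "0 \<le> a" "0 \<le> b" "0 \<le> c" for a b c :: real
    using that by linarith
  have X1: "- 1 / 48 \<le> a / 48 + b / 4 + c / 2" if "- 1 \<le> a" "0 \<le> b" "0 \<le> c" for a b c :: real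
    using that by linarith
  have X2: "b / 4 \<le> a / 48 + b / 4 + c / 2" if "0 \<le> a" "0 \<le> c" for a b c :: real
    using that by linarith
  have X3: "1 / 2 \<le> a / 48 + b / 4 + c / 2" if "0 \<le> a" "0 \<le> b" "1 \<le> c" for a b c :: real
    using that by linarith
  define X where "X = ?A / 48 + ?B / 4 + ?C / 2"
  have "gauss_tail s \<le> 1 / 2 + ?t * X"
  proof (cases "r2 \<le> r1")
    case True
    then have s0: "0 \<le> \<tau> * (r1 - r2)" using \<tau> by simp
    have m: "gauss_tail s \<le> 1 / 2 - min (\<tau> * (r1 - r2)) 1 / 6" using mono gauss_tail_nonneg_le[OF s0] by linarith
    show ?thesis
    proof (cases "r1 < 1 / 4 \<or> 1 / 8 < r2")
      case True
      have "0 \<le> X" unfolding X_def by (rule X0[OF A1[OF True] BC])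
      then have "0 \<le> ?t * X" using t by simp
      moreover have "0 \<le> min (\<tau> * (r1 - r2)) 1" using s0 by simp
      ultimately show ?thesis using m by linarith
    next
      case False
      \<comment> \<open>Here r1 - r2 is at least 1/4 - 1/8. The slope 1/6 of the tail bound turns
        this 1/8 into the gain 1/48.\<close>
      then have "\<tau> * (1 / 8) \<le> \<tau> * (r1 - r2)" using \<tau> by (intro mult_left_mono) auto
      moreover have "?t * (1 / 8) \<le> \<tau> * (1 / 8)" using t(3) by (rule mult_right_mono) simp
      moreover have "?t * (1 / 8) \<le> 1" using t by linarith
      ultimately have "?t * (1 / 8) \<le> min (\<tau> * (r1 - r2)) 1" by (intro min.boundedI) linarith+
      moreover have "- 1 / 48 \<le> X" unfolding X_def by (rule X1[OF A2 BC])
      then have "?t * (- 1 / 48) \<le> ?t * X" using t by (intro mult_left_mono) auto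
      ultimately show ?thesis using m by linarith
    qed
  next
    case False
    then have A: "0 \<le> ?A" using A1 by force
    show ?thesis
    proof (cases "\<tau> \<le> 1")
      case True
      have "\<tau> * (r1 - r2) \<le> 0" using False \<tau> by (simp add: mult_nonneg_nonpos)
      from gauss_tail_nonpos_le[OF this] have "gauss_tail s \<le> 1 / 2 + \<tau> * (r2 - r1) / 2"
      proof -
        have "\<tau> * (r2 - r1) = - (\<tau> * (r1 - r2))" by (simp add: algebra_simps)
        then show ?thesis using mono gauss_tail_nonpos_le[OF \<open>\<tau> * (r1 - r2) \<le> 0\<close>] by linarith
      qed
      also have "\<tau> * (r2 - r1) / 2 \<le> \<tau> * (?B / 4)"
      proof -
        have "(r2 - r1) / 2 \<le> b / 4" if "2 * r2 \<le> b" for b using that r(1) by (simp add: field_simps)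
        from mult_left_mono[OF this[OF r2B], of \<tau>] show ?thesis using \<tau> by simp
      qed
      also have "\<dots> \<le> ?t * X"
      proof -
        have "?B / 4 \<le> X" unfolding X_def by (rule X2[OF A BC(2)])
        then show ?thesis using True \<tau> by simp
      qed
      finally show ?thesis by simp
    next
      case F: False
      have "1 / 2 \<le> X" unfolding X_def by (rule X3[OF A BC(1) C1]) (use False in simp)
      then show ?thesis using gauss_tail_le_1[of s] F by simp
    qed
  qed
  then show ?thesis unfolding X_def .
qed

section \<open>Moments and small-ball bounds for the Gaussian vector V^T z\<close>

lemma integral_exp_std_gauss_le:
  assumes \<delta>: "0 < \<delta>"
  shows "(\<integral>x. exp (- x\<^sup>2 / \<delta>\<^sup>2) \<partial>std_gauss) \<le> \<delta>"
proof -
  \<comment> \<open>Bounding the standard density by its maximum leaves, up to the factor \<delta> /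
    sqrt 2, the density of variance \<delta>^2 / 2.\<close>
  have eq: "std_normal_density x * exp (- x\<^sup>2 / \<delta>\<^sup>2) \<le> (\<delta> / sqrt 2) * normal_density 0 (\<delta> / sqrt 2) x" for x
  proof -
    have "std_normal_density x \<le> 1 / sqrt (2 * pi)"
      by (simp add: std_normal_density_def divide_right_mono)
    then have "std_normal_density x * exp (- x\<^sup>2 / \<delta>\<^sup>2) \<le> 1 / sqrt (2 * pi) * exp (- x\<^sup>2 / \<delta>\<^sup>2)"
      by (rule mult_right_mono) simp
    also have "\<dots> = (\<delta> / sqrt 2) * normal_density 0 (\<delta> / sqrt 2) x"
      using \<delta> by (simp add: normal_density_def power_divide real_sqrt_mult real_sqrt_divide)
    finally show ?thesis .
  qed
  have "(\<integral>x. exp (- x\<^sup>2 / \<delta>\<^sup>2) \<partial>std_gauss) = (\<integral>x. std_normal_density x * exp (- x\<^sup>2 / \<delta>\<^sup>2) \<partial>lborel)"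
    unfolding std_gauss_def by (subst integral_density) auto
  also have "\<dots> \<le> (\<integral>x. (\<delta> / sqrt 2) * normal_density 0 (\<delta> / sqrt 2) x \<partial>lborel)"
  proof (rule integral_mono)
    show r: "integrable lborel (\<lambda>x. (\<delta> / sqrt 2) * normal_density 0 (\<delta> / sqrt 2) x)"
      using \<delta> by (intro integrable_mult_right integrable_normal_density) simp
    show "integrable lborel (\<lambda>x. std_normal_density x * exp (- x\<^sup>2 / \<delta>\<^sup>2))"
      by (rule Bochner_Integration.integrable_bound[OF r]) (use eq \<delta> in \<open>auto intro!: AE_I2 simp: abs_mult\<close>)
  qed (rule eq)
  also have "\<dots> = \<delta> / sqrt 2" using \<delta> by simp
  also have "\<dots> \<le> \<delta> / 1" using \<delta> by (intro divide_left_mono) auto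
  finally show ?thesis by simp
qed

lemma integral_square_gauss_linear_form:
  "integrable (gauss_vec p) (\<lambda>z. (\<Sum>k<p. v k * z k)\<^sup>2)" (is ?I)
  "(\<integral>z. (\<Sum>k<p. v k * z k)\<^sup>2 \<partial>gauss_vec p) = (\<Sum>k<p. (v k)\<^sup>2)" (is ?E)
proof -
  interpret prob_space "gauss_vec p" by (rule prob_space_gauss_vec)
  have "?I \<and> ?E"
  proof (cases "(\<Sum>k<p. (v k)\<^sup>2) = 0")
    case True
    then have "\<forall>k<p. v k = 0" by (subst (asm) sum_nonneg_eq_0_iff) auto
    then show ?thesis by simp
  next
    case False
    define s where "s = sqrt (\<Sum>k<p. (v k)\<^sup>2)"
    have v: "0 < (\<Sum>k<p. (v k)\<^sup>2)" using False sum_nonneg[of "{..<p}" "\<lambda>k. (v k)\<^sup>2"] by simp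
    then have s: "0 < s" "s\<^sup>2 = (\<Sum>k<p. (v k)\<^sup>2)" by (auto simp: s_def)
    note D = distributed_gauss_linear_form[OF v, folded s_def]
    have eq: "(\<Sum>k<p. v k * z k)\<^sup>2 = s\<^sup>2 * ((\<Sum>k<p. v k * z k) / s)\<^sup>2" for z
      using s(1) by (simp add: power_divide)
    have i: "integrable lborel (\<lambda>x. std_normal_density x * x\<^sup>2)" by (rule integrable_std_normal_moment)
    have "integrable (gauss_vec p) (\<lambda>z. ((\<Sum>k<p. v k * z k) / s)\<^sup>2)"
      using distributed_integrable[OF D, of "\<lambda>x. x\<^sup>2"] i by simp
    moreover have "(\<integral>z. ((\<Sum>k<p. v k * z k) / s)\<^sup>2 \<partial>gauss_vec p) = 1"
      using distributed_integral[OF D, of "\<lambda>x. x\<^sup>2"] integral_std_normal_moment_even[of 1] by simp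
    ultimately show ?thesis unfolding eq using s by simp
  qed
  then show ?I ?E by auto
qed

text \<open>Coordinate j of V^T z. For V = A^T U and z standard Gaussian it is coordinate j of U^T X
  with X = A z.\<close>

definition col_form :: "nat \<Rightarrow> (nat \<Rightarrow> nat \<Rightarrow> real) \<Rightarrow> nat \<Rightarrow> (nat \<Rightarrow> real) \<Rightarrow> real" where
  "col_form p V j z = (\<Sum>k<p. V k j * z k)"

lemma col_form_measurable [measurable]: "(\<lambda>z. col_form p V j z) \<in> borel_measurable (gauss_vec p)"
  unfolding col_form_def by measurable

lemma integral_col_forms_square:
  "integrable (gauss_vec p) (\<lambda>z. \<Sum>j<m. (col_form p V j z)\<^sup>2)"
  "(\<integral>z. (\<Sum>j<m. (col_form p V j z)\<^sup>2) \<partial>gauss_vec p) = (\<Sum>k<p. \<Sum>j<m. (V k j)\<^sup>2)"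
proof -
  show "integrable (gauss_vec p) (\<lambda>z. \<Sum>j<m. (col_form p V j z)\<^sup>2)"
    unfolding col_form_def by (intro Bochner_Integration.integrable_sum integral_square_gauss_linear_form)
  have "(\<integral>z. (\<Sum>j<m. (col_form p V j z)\<^sup>2) \<partial>gauss_vec p) = (\<Sum>j<m. \<integral>z. (col_form p V j z)\<^sup>2 \<partial>gauss_vec p)"
    unfolding col_form_def by (rule Bochner_Integration.integral_sum) (rule integral_square_gauss_linear_form)
  also have "\<dots> = (\<Sum>j<m. \<Sum>k<p. (V k j)\<^sup>2)"
    unfolding col_form_def by (simp add: integral_square_gauss_linear_form)
  also have "\<dots> = (\<Sum>k<p. \<Sum>j<m. (V k j)\<^sup>2)" by (rule sum.swap)
  finally show "(\<integral>z. (\<Sum>j<m. (col_form p V j z)\<^sup>2) \<partial>gauss_vec p) = (\<Sum>k<p. \<Sum>j<m. (V k j)\<^sup>2)" .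
qed

text \<open>Convexity of \<open>exp\<close> turns the chaos into a convex combination of one-dimensional Gaussian
  integrals, so no diagonalisation (nor independence of the columns) is needed.\<close>

lemma integral_exp_col_forms_le:
  assumes V: "(\<Sum>k<p. \<Sum>j<m. (V k j)\<^sup>2) = 1" and \<delta>: "0 < \<delta>"
  shows "(\<integral>z. exp (- (\<Sum>j<m. (col_form p V j z)\<^sup>2) / \<delta>\<^sup>2) \<partial>gauss_vec p) \<le> \<delta>"
    "integrable (gauss_vec p) (\<lambda>z. exp (- (\<Sum>j<m. (col_form p V j z)\<^sup>2) / \<delta>\<^sup>2))"
proof -
  interpret prob_space "gauss_vec p" by (rule prob_space_gauss_vec)
  \<comment> \<open>The squared column norms sum to 1 and serve as the convex weights; zero columns
    are dropped, and each remaining column form, normalized, is standard Gaussian.\<close>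
  define w where "w j = (\<Sum>k<p. (V k j)\<^sup>2)" for j
  define J where "J = {j\<in>{..<m}. w j \<noteq> 0}"
  have w0: "0 \<le> w j" for j unfolding w_def by (rule sum_nonneg) simp
  have wJ: "0 < w j" if "j \<in> J" for j using that w0[of j] by (simp add: J_def)
  have fJ: "finite J" by (simp add: J_def)
  have "(\<Sum>j<m. w j) = 1" unfolding w_def using V by (subst sum.swap) simp
  moreover have "(\<Sum>j\<in>J. w j) = (\<Sum>j<m. w j)" by (rule sum.mono_neutral_left) (auto simp: J_def)
  ultimately have w1: "(\<Sum>j\<in>J. w j) = 1" by simp
  define N where "N j z = col_form p V j z / sqrt (w j)" for j z
  have Nm[measurable]: "N j \<in> borel_measurable (gauss_vec p)" for j unfolding N_def[abs_def] by measurable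
  have zero: "col_form p V j z = 0" if "w j = 0" for j z
  proof -
    have "\<forall>k<p. V k j = 0" using that unfolding w_def by (subst (asm) sum_nonneg_eq_0_iff) auto
    then show ?thesis by (simp add: col_form_def)
  qed
  have sq: "(\<Sum>j<m. (col_form p V j z)\<^sup>2) = (\<Sum>j\<in>J. w j * (N j z)\<^sup>2)" for z
  proof -
    have "(\<Sum>j<m. (col_form p V j z)\<^sup>2) = (\<Sum>j\<in>J. (col_form p V j z)\<^sup>2)"
      by (rule sum.mono_neutral_right) (auto simp: J_def zero)
    also have "\<dots> = (\<Sum>j\<in>J. w j * (N j z)\<^sup>2)"
      by (rule sum.cong) (use wJ in \<open>auto simp: N_def power_divide less_imp_le less_imp_neq[symmetric]\<close>)
    finally show ?thesis .
  qed
  have bd: "integrable (gauss_vec p) f" if "f \<in> borel_measurable (gauss_vec p)" "\<And>z. \<bar>f z\<bar> \<le> 1" for f :: "_ \<Rightarrow> real"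
    by (rule integrable_const_bound[of _ 1]) (use that in auto)
  show i: "integrable (gauss_vec p) (\<lambda>z. exp (- (\<Sum>j<m. (col_form p V j z)\<^sup>2) / \<delta>\<^sup>2))"
    by (rule bd) (auto intro!: divide_nonneg_nonneg sum_nonneg)
  have iN: "integrable (gauss_vec p) (\<lambda>z. exp (- (N j z)\<^sup>2 / \<delta>\<^sup>2))" for j by (rule bd) auto
  have "(\<integral>z. exp (- (\<Sum>j<m. (col_form p V j z)\<^sup>2) / \<delta>\<^sup>2) \<partial>gauss_vec p)
     \<le> (\<integral>z. (\<Sum>j\<in>J. w j * exp (- (N j z)\<^sup>2 / \<delta>\<^sup>2)) \<partial>gauss_vec p)"
  proof (rule integral_mono[OF i])
    show "integrable (gauss_vec p) (\<lambda>z. \<Sum>j\<in>J. w j * exp (- (N j z)\<^sup>2 / \<delta>\<^sup>2))"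
      by (intro Bochner_Integration.integrable_sum integrable_mult_right iN)
    fix z
    have "- (\<Sum>j<m. (col_form p V j z)\<^sup>2) / \<delta>\<^sup>2 = (\<Sum>j\<in>J. w j *\<^sub>R (- (N j z)\<^sup>2 / \<delta>\<^sup>2))"
      unfolding sq by (simp add: sum_divide_distrib sum_negf)
    also have "exp \<dots> \<le> (\<Sum>j\<in>J. w j * exp (- (N j z)\<^sup>2 / \<delta>\<^sup>2))"
    proof (rule convex_on_sum[OF fJ _ _ w1])
      show "J \<noteq> {}" using w1 by auto
      show "convex_on UNIV (exp :: real \<Rightarrow> real)" using convex_on_exp[of 1] by simp
    qed (use w0 in auto)
    finally show "exp (- (\<Sum>j<m. (col_form p V j z)\<^sup>2) / \<delta>\<^sup>2) \<le> (\<Sum>j\<in>J. w j * exp (- (N j z)\<^sup>2 / \<delta>\<^sup>2))" .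
  qed
  also have "\<dots> = (\<Sum>j\<in>J. w j * (\<integral>z. exp (- (N j z)\<^sup>2 / \<delta>\<^sup>2) \<partial>gauss_vec p))"
    by (subst Bochner_Integration.integral_sum) (simp_all only: integrable_mult_right[OF iN] integral_mult_right_zero)
  also have "\<dots> \<le> (\<Sum>j\<in>J. w j * \<delta>)"
  proof (intro sum_mono mult_left_mono w0)
    fix j assume j: "j \<in> J"
    have d: "distr (gauss_vec p) borel (N j) = std_gauss"
      using distr_gauss_linear_form[where p = p and v = "\<lambda>k. V k j"] wJ[OF j] unfolding N_def[abs_def] col_form_def w_def by simp
    have "(\<integral>z. exp (- (N j z)\<^sup>2 / \<delta>\<^sup>2) \<partial>gauss_vec p) = (\<integral>x. exp (- x\<^sup>2 / \<delta>\<^sup>2) \<partial>distr (gauss_vec p) borel (N j))"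
      by (rule integral_distr[symmetric]) auto
    then show "(\<integral>z. exp (- (N j z)\<^sup>2 / \<delta>\<^sup>2) \<partial>gauss_vec p) \<le> \<delta>"
      unfolding d using integral_exp_std_gauss_le[OF \<delta>] by simp
  qed
  also have "\<dots> = \<delta>" using w1 by (simp add: sum_distrib_right[symmetric])
  finally show "(\<integral>z. exp (- (\<Sum>j<m. (col_form p V j z)\<^sup>2) / \<delta>\<^sup>2) \<partial>gauss_vec p) \<le> \<delta>" .
qed

text \<open>On the zero set the exponential integrand of the small-ball bound equals 1, so its
  probability is at most every positive \<delta>. This permits division by |V^T z| in the
  conditional argument.\<close>

lemma AE_col_forms_nonzero:
  assumes V: "(\<Sum>k<p. \<Sum>j<m. (V k j)\<^sup>2) = 1"
  shows "AE z in gauss_vec p. 0 < (\<Sum>j<m. (col_form p V j z)\<^sup>2)"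
proof -
  interpret prob_space "gauss_vec p" by (rule prob_space_gauss_vec)
  define Z where "Z = {z\<in>space (gauss_vec p). (\<Sum>j<m. (col_form p V j z)\<^sup>2) = 0}"
  have Zs[measurable]: "Z \<in> events" unfolding Z_def by measurable
  have "prob Z \<le> 0 + \<delta>" if \<delta>: "0 < \<delta>" for \<delta>
  proof -
    have "prob Z = (\<integral>z. indicator Z z \<partial>gauss_vec p)" by simp
    also have "\<dots> \<le> (\<integral>z. exp (- (\<Sum>j<m. (col_form p V j z)\<^sup>2) / \<delta>\<^sup>2) \<partial>gauss_vec p)"
    proof (rule integral_mono[OF _ integral_exp_col_forms_le(2)[OF V \<delta>]])
      show "integrable (gauss_vec p) (indicator Z :: _ \<Rightarrow> real)"
        by (rule integrable_real_indicator) (simp_all add: emeasure_eq_measure)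
    qed (auto simp: indicator_def Z_def)
    also have "\<dots> \<le> \<delta>" by (rule integral_exp_col_forms_le(1)[OF V \<delta>])
    finally show ?thesis by simp
  qed
  then have "prob Z \<le> 0" by (rule field_le_epsilon)
  then have "emeasure (gauss_vec p) Z = 0" by (simp add: emeasure_eq_measure measure_le_0_iff)
  then have "AE z in gauss_vec p. z \<notin> Z" using Zs by (intro AE_not_in null_setsI)
  moreover have "AE z in gauss_vec p. z \<in> space (gauss_vec p)" by (rule AE_space)
  ultimately show ?thesis
  proof eventually_elim
    case (elim z)
    then have "(\<Sum>j<m. (col_form p V j z)\<^sup>2) \<noteq> 0" by (simp add: Z_def)
    moreover have "0 \<le> (\<Sum>j<m. (col_form p V j z)\<^sup>2)" by (rule sum_nonneg) simp
    ultimately show ?case by simp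
  qed
qed

text \<open>Given z, the form in w is centred Gaussian with standard deviation \<sigma> R, R = |V^T
  z|, so the conditional probability is \<open>gauss_tail s\<close> with s the inner product of V^T
  z and D^T z divided by \<sigma> R. Writing D = T (V + M), Cauchy-Schwarz gives s >= (T / \<sigma>)
  (R - |M^T z|). The pointwise majorant \<open>h\<close> is then integrated over z.\<close>

lemma gauss_regression_halfspace_le:
  assumes V: "(\<Sum>k<p. \<Sum>j<m. (V k j)\<^sup>2) = 1" and T: "0 < T" and \<sigma>: "0 < \<sigma>"
    and D: "(\<Sum>k<p. \<Sum>j<m. (D k j - T * V k j)\<^sup>2) \<le> (T / 100000)\<^sup>2"
  shows "measure (gauss_vec p \<Otimes>\<^sub>M gauss_vec m)
      {(z, w)\<in>space (gauss_vec p \<Otimes>\<^sub>M gauss_vec m). 0 \<le> (\<Sum>j<m. col_form p V j z * (\<sigma> * w j - col_form p D j z))}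
    \<le> 1 / 2 - min (T / \<sigma>) 1 / 400"
proof -
  let ?P = "gauss_vec p" and ?W = "gauss_vec m"
  interpret P: prob_space ?P by (rule prob_space_gauss_vec)
  interpret W: prob_space ?W by (rule prob_space_gauss_vec)
  interpret PW: pair_prob_space ?P ?W ..
  define \<tau> where "\<tau> = T / \<sigma>"
  have \<tau>: "0 < \<tau>" using T \<sigma> by (simp add: \<tau>_def)
  define \<eta> :: real where "\<eta> = 1 / 100000"
  define M where "M k j = D k j / T - V k j" for k j
  define S where "S = {(z, w)\<in>space (?P \<Otimes>\<^sub>M ?W). 0 \<le> (\<Sum>j<m. col_form p V j z * (\<sigma> * w j - col_form p D j z))}"
  have Ss[measurable]: "S \<in> sets (?P \<Otimes>\<^sub>M ?W)"
  proof -
    note [measurable] = measurable_compose[OF measurable_fst col_form_measurable]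
      measurable_compose[OF measurable_snd measurable_gauss_vec_component]
    have "S = {x\<in>space (?P \<Otimes>\<^sub>M ?W). 0 \<le> (\<Sum>j<m. col_form p V j (fst x) * (\<sigma> * snd x j - col_form p D j (fst x)))}"
      by (auto simp: S_def)
    also have "\<dots> \<in> sets (?P \<Otimes>\<^sub>M ?W)" by measurable
    finally show ?thesis .
  qed
  \<comment> \<open>\<open>r1\<close> and \<open>r2\<close> are squared norms here; the tail lemma
    is applied to their square roots.\<close>
  define r1 where "r1 z = (\<Sum>j<m. (col_form p V j z)\<^sup>2)" for z
  define r2 where "r2 z = (\<Sum>j<m. (col_form p M j z)\<^sup>2)" for z
  have r1m[measurable]: "r1 \<in> borel_measurable ?P" unfolding r1_def[abs_def] by measurable
  have r2m[measurable]: "r2 \<in> borel_measurable ?P" unfolding r2_def[abs_def] by measurable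
  have r0: "0 \<le> r1 z" "0 \<le> r2 z" for z unfolding r1_def r2_def by (rule sum_nonneg; simp)+
  define h where "h z = 1 / 2 + min \<tau> 1 *
    ((3 * exp (- 16 * r1 z) + 64 * r2 z - 1) / 48 + (\<eta> + r2 z / \<eta>) / 4 + (3 * exp (- 1000000 * r1 z) + 1000000 * r2 z) / 2)" for z
  have fib: "emeasure ?W (Pair z -` S) \<le> ennreal (h z) \<and> 0 \<le> h z" if z: "z \<in> space ?P" "0 < r1 z" for z
  proof -
    define R where "R = sqrt (r1 z)"
    have R: "0 < R" "R\<^sup>2 = r1 z" using z by (auto simp: R_def)
    define s where "s = (\<Sum>j<m. col_form p V j z * col_form p D j z) / (\<sigma> * R)"
    have "Pair z -` S = {w\<in>space ?W. s \<le> (\<Sum>j<m. col_form p V j z * w j) / R}"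
    proof -
      have "0 \<le> (\<Sum>j<m. col_form p V j z * (\<sigma> * w j - col_form p D j z)) \<longleftrightarrow>
        s \<le> (\<Sum>j<m. col_form p V j z * w j) / R" for w
      proof -
        have "(\<Sum>j<m. col_form p V j z * (\<sigma> * w j - col_form p D j z)) =
          \<sigma> * (\<Sum>j<m. col_form p V j z * w j) - s * (\<sigma> * R)"
        proof -
          have sR: "s * (\<sigma> * R) = (\<Sum>j<m. col_form p V j z * col_form p D j z)" using R \<sigma> by (simp add: s_def)
          show ?thesis unfolding sR by (simp add: right_diff_distrib sum_subtractf sum_distrib_left mult.left_commute)
        qed
        moreover have "s \<le> (\<Sum>j<m. col_form p V j z * w j) / R \<longleftrightarrow> \<sigma> * (s * R) \<le> \<sigma> * (\<Sum>j<m. col_form p V j z * w j)"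
          using R \<sigma> by (simp add: pos_le_divide_eq)
        ultimately show ?thesis by (simp add: mult_ac)
      qed
      then show ?thesis using z unfolding S_def by (auto simp: space_pair_measure)
    qed
    moreover have "emeasure ?W {w\<in>space ?W. s \<le> (\<Sum>j<m. col_form p V j z * w j) / R} = ennreal (gauss_tail s)"
    proof -
      have d: "distr ?W borel (\<lambda>w. (\<Sum>j<m. col_form p V j z * w j) / R) = std_gauss"
        using distr_gauss_linear_form[where p = m and v = "\<lambda>j. col_form p V j z"] z(2) unfolding R_def r1_def by simp
      have "emeasure std_gauss {s..} = emeasure ?W {w\<in>space ?W. s \<le> (\<Sum>j<m. col_form p V j z * w j) / R}"
        unfolding d[symmetric] by (subst emeasure_distr) (auto intro!: arg_cong[where f = "emeasure ?W"])
      then show ?thesis unfolding gauss_tail_def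
        using finite_measure.emeasure_eq_measure[OF prob_space.finite_measure[OF prob_space_std_gauss]] by simp
    qed
    moreover have "gauss_tail s \<le> h z"
    proof -
      have "\<tau> * (R - sqrt (r2 z)) \<le> s"
      proof -
        have cf: "col_form p D j z = T * (col_form p V j z + col_form p M j z)" for j
          using T by (simp add: col_form_def M_def sum.distrib[symmetric] sum_distrib_left algebra_simps diff_divide_distrib)
        have "(\<Sum>j<m. col_form p V j z * col_form p D j z) = T * (r1 z + (\<Sum>j<m. col_form p V j z * col_form p M j z))"
          unfolding cf r1_def by (simp add: sum_distrib_left sum.distrib[symmetric] algebra_simps power2_eq_square)
        moreover have "- (R * sqrt (r2 z)) \<le> (\<Sum>j<m. col_form p V j z * col_form p M j z)"
        proof -
          have "(\<Sum>j<m. col_form p V j z * col_form p M j z)\<^sup>2 \<le> r1 z * r2 z"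
            unfolding r1_def r2_def by (rule Cauchy_Schwarz_ineq_sum)
          then have "\<bar>\<Sum>j<m. col_form p V j z * col_form p M j z\<bar> \<le> sqrt (r1 z * r2 z)"
            by (rule real_le_rsqrt[of "\<bar>_\<bar>", simplified])
          then show ?thesis by (simp add: R_def real_sqrt_mult)
        qed
        ultimately have "T * (R\<^sup>2 - R * sqrt (r2 z)) \<le> (\<Sum>j<m. col_form p V j z * col_form p D j z)"
          using T R by simp
        then have "T * (R\<^sup>2 - R * sqrt (r2 z)) / (\<sigma> * R) \<le> s"
          unfolding s_def using \<sigma> R by (intro divide_right_mono) auto
        moreover have "T * (R\<^sup>2 - R * sqrt (r2 z)) / (\<sigma> * R) = \<tau> * (R - sqrt (r2 z))"
          using R \<sigma> by (simp add: \<tau>_def power2_eq_square field_simps)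
        ultimately show ?thesis by simp
      qed
      from gauss_tail_shifted_le[OF R(1) _ \<tau> this, of \<eta>]
      show ?thesis using r0 R by (simp add: h_def \<eta>_def)
    qed
    moreover have "0 \<le> gauss_tail s" by (simp add: gauss_tail_def)
    ultimately show ?thesis by (simp add: ennreal_leI)
  qed
  \<comment> \<open>The coefficients 16 and 1000000 are 1 / \<delta>^2 for \<delta> = 1/4 and
    \<delta> = 1/1000, where the small-ball bound gives means of at most \<delta>.\<close>
  have e1: "integrable ?P (\<lambda>z. exp (- 16 * r1 z))" "(\<integral>z. exp (- 16 * r1 z) \<partial>?P) \<le> 1 / 4"
    using integral_exp_col_forms_le[OF V, of "1/4"] by (simp_all add: r1_def power2_eq_square mult.commute)
  have e2: "integrable ?P (\<lambda>z. exp (- 1000000 * r1 z))" "(\<integral>z. exp (- 1000000 * r1 z) \<partial>?P) \<le> 1 / 1000"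
    using integral_exp_col_forms_le[OF V, of "1/1000"] by (simp_all add: r1_def power2_eq_square mult.commute)
  have e3: "integrable ?P r2" "(\<integral>z. r2 z \<partial>?P) \<le> \<eta>\<^sup>2"
  proof -
    show "integrable ?P r2" unfolding r2_def[abs_def] by (rule integral_col_forms_square)
    have "(\<integral>z. r2 z \<partial>?P) = (\<Sum>k<p. \<Sum>j<m. (M k j)\<^sup>2)" unfolding r2_def by (rule integral_col_forms_square)
    also have "\<dots> = (\<Sum>k<p. \<Sum>j<m. (D k j - T * V k j)\<^sup>2) / T\<^sup>2"
    proof -
      have "(M k j)\<^sup>2 = (D k j - T * V k j)\<^sup>2 / T\<^sup>2" for k j
        using T by (simp add: M_def power_divide[symmetric] diff_divide_distrib)
      then show ?thesis by (simp add: sum_divide_distrib)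
    qed
    also have "\<dots> \<le> (T / 100000)\<^sup>2 / T\<^sup>2" by (intro divide_right_mono D) simp
    also have "\<dots> = \<eta>\<^sup>2" using T by (simp add: \<eta>_def power_divide)
    finally show "(\<integral>z. r2 z \<partial>?P) \<le> \<eta>\<^sup>2" .
  qed
  have hi: "integrable ?P h" unfolding h_def[abs_def] using e1(1) e2(1) e3(1) by (auto simp del: integrable_const)
  have Ih: "(\<integral>z. h z \<partial>?P) \<le> 1 / 2 - min \<tau> 1 / 400"
  proof -
    let ?E1 = "\<integral>z. exp (- 16 * r1 z) \<partial>?P" and ?E2 = "\<integral>z. exp (- 1000000 * r1 z) \<partial>?P" and ?R = "\<integral>z. r2 z \<partial>?P"
    have "(\<integral>z. h z \<partial>?P) = 1 / 2 + min \<tau> 1 * ((3 * ?E1 + 64 * ?R - 1) / 48 + (\<eta> + ?R / \<eta>) / 4 + (3 * ?E2 + 1000000 * ?R) / 2)"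
      unfolding h_def[abs_def] using e1(1) e2(1) e3(1) P.prob_space by simp
    also have "\<dots> \<le> 1 / 2 + min \<tau> 1 * (- 1 / 400)"
    proof -
      have "(3 * ?E1 + 64 * ?R - 1) / 48 + (\<eta> + ?R / \<eta>) / 4 + (3 * ?E2 + 1000000 * ?R) / 2 \<le> - 1 / 400"
      proof -
        \<comment> \<open>The leading term is (3/4 - 1) / 48 = -1/192, about -0.0052. The third
          bracket contributes about 0.0016 and the remaining terms about 0.00001, which leaves less
          than -1/400. The small radius keeps the factor 1000000 b harmless.\<close>
        have "(3 * a + 64 * b - 1) / 48 + (1 / 100000 + b / (1 / 100000)) / 4 + (3 * c + 1000000 * b) / 2 \<le> - 1 / 400"
          if "a \<le> 1 / 4" "c \<le> 1 / 1000" "b \<le> (1 / 100000)\<^sup>2" for a b c :: real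
        proof -
          have b: "b \<le> 1 / 10000000000" using that(3) by (simp add: power2_eq_square)
          have "(3 * a + 64 * b - 1) / 48 + (1 / 100000 + b * 100000) / 4 + (3 * c + 1000000 * b) / 2 \<le> - 1 / 400"
            using that(1,2) b unfolding add_divide_distrib diff_divide_distrib by linarith
          moreover have "b / (1 / 100000) = b * 100000" by simp
          ultimately show ?thesis by (simp only:)
        qed
        from this[OF e1(2) e2(2) e3(2)[unfolded \<eta>_def]] show ?thesis unfolding \<eta>_def .
      qed
      then show ?thesis using \<tau> by (intro add_left_mono mult_left_mono) auto
    qed
    finally show ?thesis by simp
  qed
  have AE0: "AE z in ?P. 0 < r1 z" unfolding r1_def by (rule AE_col_forms_nonzero[OF V])
  have hn: "AE z in ?P. 0 \<le> h z" using AE0 AE_space by eventually_elim (use fib in auto)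
  have "emeasure (?P \<Otimes>\<^sub>M ?W) S = (\<integral>\<^sup>+z. emeasure ?W (Pair z -` S) \<partial>?P)"
    by (rule W.emeasure_pair_measure_alt[OF Ss])
  also have "\<dots> \<le> (\<integral>\<^sup>+z. ennreal (h z) \<partial>?P)"
    by (rule nn_integral_mono_AE) (use AE0 AE_space in \<open>eventually_elim, use fib in auto\<close>)
  also have "\<dots> = ennreal (\<integral>z. h z \<partial>?P)" by (rule nn_integral_eq_integral[OF hi hn])
  also have "\<dots> \<le> ennreal (1 / 2 - min \<tau> 1 / 400)" by (rule ennreal_leI[OF Ih])
  finally have "measure (?P \<Otimes>\<^sub>M ?W) S \<le> 1 / 2 - min \<tau> 1 / 400"
    by (simp add: PW.emeasure_eq_measure ennreal_le_iff)
  then show ?thesis by (simp add: S_def \<tau>_def)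
qed

section \<open>Nets and Cholesky factors\<close>

lemma sum_exp_neg_abs_le: "(\<Sum>k\<in>{- int L..int L}. exp (- real_of_int \<bar>k\<bar>)) \<le> 4"
proof -
  have half: "exp (- real k) \<le> (1 / 2) ^ k" for k
  proof -
    have "exp (- 1) \<le> (1 / 2 :: real)" using exp_ge_add_one_self[of 1] by (simp add: exp_minus field_simps)
    then have "exp (- 1) ^ k \<le> (1 / 2 :: real) ^ k" by (intro power_mono) auto
    then show ?thesis by (simp add: exp_of_nat_mult[symmetric])
  qed
  have geo: "(\<Sum>k\<le>L. exp (- real k)) \<le> 2"
  proof -
    have "(\<Sum>k\<le>L. exp (- real k)) \<le> (\<Sum>k\<le>L. (1 / 2) ^ k)" by (rule sum_mono) (rule half)
    also have "\<dots> = (1 - (1 / 2) ^ Suc L) / (1 - 1 / 2)" by (subst sum_gp0) auto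
    also have "\<dots> \<le> 2" by simp
    finally show ?thesis .
  qed
  have "{- int L..int L} \<subseteq> int ` {..L} \<union> (\<lambda>k. - int k) ` {..L}"
  proof
    fix k assume k: "k \<in> {- int L..int L}"
    show "k \<in> int ` {..L} \<union> (\<lambda>k. - int k) ` {..L}"
    proof (cases "0 \<le> k")
      case True
      then have "k = int (nat k)" "nat k \<in> {..L}" using k by auto
      then show ?thesis by blast
    next
      case False
      then have "k = - int (nat (- k))" "nat (- k) \<in> {..L}" using k by auto
      then show ?thesis by blast
    qed
  qed
  then have "(\<Sum>k\<in>{- int L..int L}. exp (- real_of_int \<bar>k\<bar>)) \<le> (\<Sum>k\<in>int ` {..L} \<union> (\<lambda>k. - int k) ` {..L}. exp (- real_of_int \<bar>k\<bar>))"
    by (intro sum_mono2) auto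
  also have "\<dots> \<le> (\<Sum>k\<in>int ` {..L}. exp (- real_of_int \<bar>k\<bar>)) + (\<Sum>k\<in>(\<lambda>k. - int k) ` {..L}. exp (- real_of_int \<bar>k\<bar>))"
    by (subst sum.union_inter[symmetric]) (auto intro: sum_nonneg)
  also have "\<dots> = (\<Sum>k\<le>L. exp (- real k)) + (\<Sum>k\<le>L. exp (- real k))"
    by (subst (1 2) sum.reindex) (auto simp: inj_on_def)
  finally show ?thesis using geo by linarith
qed

text \<open>Every point of the ball gets a weight exp (r card I - |z|_1) of at least 1; the total
  weight over a box factorizes into coordinate sums, each at most 4.\<close>

lemma card_integer_l1_ball_le:
  fixes r :: real
  assumes I: "finite I" and r: "0 \<le> r"
  shows "finite {z\<in>PiE I (\<lambda>_. UNIV :: int set). (\<Sum>i\<in>I. real_of_int \<bar>z i\<bar>) \<le> r * card I}" (is "finite ?Z")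
    "real (card {z\<in>PiE I (\<lambda>_. UNIV :: int set). (\<Sum>i\<in>I. real_of_int \<bar>z i\<bar>) \<le> r * card I}) \<le> (4 * exp r) ^ card I"
proof -
  define L where "L = nat \<lceil>r * card I\<rceil>"
  define B where "B = PiE I (\<lambda>_. {- int L..int L})"
  have fB: "finite B" unfolding B_def using I by (intro finite_PiE) auto
  have sub: "?Z \<subseteq> B"
  proof
    fix z assume z: "z \<in> ?Z"
    have "\<bar>z i\<bar> \<le> int L" if "i \<in> I" for i
    proof -
      have "real_of_int \<bar>z i\<bar> \<le> (\<Sum>i\<in>I. real_of_int \<bar>z i\<bar>)" using I that by (intro member_le_sum) auto
      also have "\<dots> \<le> r * card I" using z by simp
      also have "\<dots> \<le> real_of_int (int L)" unfolding L_def by linarith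
      finally show ?thesis by linarith
    qed
    then show "z \<in> B" using z unfolding B_def by (auto simp: PiE_iff abs_le_iff) (metis minus_le_iff)
  qed
  show fin: "finite ?Z" using sub fB by (rule finite_subset)
  have "real (card ?Z) = (\<Sum>z\<in>?Z. 1)" by simp
  also have "\<dots> \<le> (\<Sum>z\<in>?Z. exp (r * card I - (\<Sum>i\<in>I. real_of_int \<bar>z i\<bar>)))" by (intro sum_mono) auto
  also have "\<dots> \<le> (\<Sum>z\<in>B. exp (r * card I - (\<Sum>i\<in>I. real_of_int \<bar>z i\<bar>)))"
    using sub fB by (intro sum_mono2) auto
  also have "\<dots> = exp (r * card I) * (\<Sum>z\<in>B. \<Prod>i\<in>I. exp (- real_of_int \<bar>z i\<bar>))"
    using I by (simp add: sum_distrib_left exp_sum[symmetric] exp_add[symmetric] sum_negf)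
  also have "(\<Sum>z\<in>B. \<Prod>i\<in>I. exp (- real_of_int \<bar>z i\<bar>)) = (\<Prod>i\<in>I. \<Sum>k\<in>{- int L..int L}. exp (- real_of_int \<bar>k\<bar>))"
    unfolding B_def using I by (intro prod_sum_PiE[symmetric]) auto
  also have "\<dots> \<le> (\<Prod>i\<in>I. 4)" by (intro prod_mono conjI sum_exp_neg_abs_le sum_nonneg) auto
  also have "exp (r * card I) * (\<Prod>i\<in>I. 4) = (4 * exp r) ^ card I"
    by (simp add: power_mult_distrib exp_of_nat_mult[symmetric] mult.commute)
  finally show "real (card ?Z) \<le> (4 * exp r) ^ card I" by simp
qed

text \<open>Round each coordinate down on a grid of mesh \<eta> / sqrt d. By Cauchy-Schwarz the grid
  labels of unit-ball points have l1 norm at most d / \<eta> + d, so only exponentially many in d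
  occur, and points with equal labels are within \<eta> of each other.\<close>

lemma unit_ball_net:
  fixes A :: "('i \<Rightarrow> real) set"
  assumes I: "finite I" "I \<noteq> {}" and A: "\<And>f. f \<in> A \<Longrightarrow> (\<Sum>i\<in>I. (f i)\<^sup>2) \<le> 1" and \<eta>: "0 < \<eta>"
  shows "\<exists>N\<subseteq>A. finite N \<and> real (card N) \<le> (4 * exp (1 / \<eta> + 1)) ^ card I \<and>
    (\<forall>f\<in>A. \<exists>g\<in>N. (\<Sum>i\<in>I. (f i - g i)\<^sup>2) \<le> \<eta>\<^sup>2)"
proof -
  define d where "d = real (card I)"
  have d: "0 < d" using I by (simp add: d_def card_gt_0_iff)
  define h where "h = \<eta> / sqrt d"
  have h: "0 < h" using d \<eta> by (simp add: h_def)
  define q where "q f = (\<lambda>i\<in>I. \<lfloor>f i / h\<rfloor>)" for f :: "'i \<Rightarrow> real"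
  define Z where "Z = {z\<in>PiE I (\<lambda>_. UNIV :: int set). (\<Sum>i\<in>I. real_of_int \<bar>z i\<bar>) \<le> (1 / \<eta> + 1) * card I}"
  have Z: "finite Z" "real (card Z) \<le> (4 * exp (1 / \<eta> + 1)) ^ card I"
    unfolding Z_def using card_integer_l1_ball_le[OF I(1), of "1 / \<eta> + 1"] \<eta> by simp_all
  have qZ: "q f \<in> Z" if f: "f \<in> A" for f
  proof -
    have "(\<Sum>i\<in>I. real_of_int \<bar>q f i\<bar>) \<le> (\<Sum>i\<in>I. \<bar>f i\<bar> / h + 1)"
    proof (rule sum_mono)
      fix i assume "i \<in> I"
      have "\<bar>real_of_int \<lfloor>f i / h\<rfloor>\<bar> \<le> \<bar>f i / h\<bar> + 1" by linarith
      then show "real_of_int \<bar>q f i\<bar> \<le> \<bar>f i\<bar> / h + 1" using \<open>i \<in> I\<close> h by (simp add: q_def)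
    qed
    also have "\<dots> = (\<Sum>i\<in>I. \<bar>f i\<bar>) / h + d" by (simp add: sum.distrib sum_divide_distrib d_def)
    also have "(\<Sum>i\<in>I. \<bar>f i\<bar>) \<le> sqrt d"
    proof -
      have "(\<Sum>i\<in>I. \<bar>f i\<bar> * 1)\<^sup>2 \<le> (\<Sum>i\<in>I. \<bar>f i\<bar>\<^sup>2) * (\<Sum>i\<in>I. 1\<^sup>2)" by (rule Cauchy_Schwarz_ineq_sum)
      also have "\<dots> \<le> 1 * d" unfolding d_def power2_abs
        by (intro mult_mono A[OF f]) auto
      finally show ?thesis by (intro real_le_rsqrt) simp
    qed
    also have "sqrt d / h = d / \<eta>" using d \<eta> by (simp add: h_def field_simps)
    finally have "(\<Sum>i\<in>I. real_of_int \<bar>q f i\<bar>) \<le> d / \<eta> + d" using h by (simp add: divide_right_mono)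
    then show ?thesis by (auto simp: Z_def q_def d_def algebra_simps)
  qed
  \<comment> \<open>One representative from \<open>A\<close> itself for each occupied cell, so that
    the net consists of members of \<open>A\<close> and not of grid points.\<close>
  define rep where "rep z = (SOME f. f \<in> A \<and> q f = z)" for z
  have rep: "rep (q f) \<in> A" "q (rep (q f)) = q f" if "f \<in> A" for f
    using someI[of "\<lambda>g. g \<in> A \<and> q g = q f" f] that unfolding rep_def by auto
  define N where "N = rep ` q ` A"
  have qA: "q ` A \<subseteq> Z" using qZ by blast
  show ?thesis
  proof (intro exI[of _ N] conjI ballI)
    show "N \<subseteq> A" using rep(1) by (auto simp: N_def)
    show "finite N" unfolding N_def using finite_subset[OF qA Z(1)] by simp
    have "card N \<le> card (q ` A)" unfolding N_def by (rule card_image_le[OF finite_subset[OF qA Z(1)]])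
    also have "\<dots> \<le> card Z" by (rule card_mono[OF Z(1) qA])
    finally show "real (card N) \<le> (4 * exp (1 / \<eta> + 1)) ^ card I" using Z(2) by linarith
    fix f assume f: "f \<in> A"
    let ?g = "rep (q f)"
    have "(\<Sum>i\<in>I. (f i - ?g i)\<^sup>2) \<le> (\<Sum>i\<in>I. h\<^sup>2)"
    proof (rule sum_mono)
      fix i assume i: "i \<in> I"
      have "\<lfloor>f i / h\<rfloor> = \<lfloor>?g i / h\<rfloor>" 
      proof -
        have "q f i = q ?g i" by (simp only: rep(2)[OF f])
        then show ?thesis using i by (simp add: q_def)
      qed
      then have "\<bar>f i / h - ?g i / h\<bar> \<le> 1" by linarith
      then have "\<bar>f i - ?g i\<bar> \<le> h" using h by (simp add: diff_divide_distrib[symmetric] field_simps)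
      then show "(f i - ?g i)\<^sup>2 \<le> h\<^sup>2" by (metis abs_ge_zero power2_abs power_mono)
    qed
    also have "\<dots> = \<eta>\<^sup>2" using d by (simp add: h_def power_divide d_def)
    finally show "\<exists>g\<in>N. (\<Sum>i\<in>I. (f i - g i)\<^sup>2) \<le> \<eta>\<^sup>2" using f unfolding N_def by blast
  qed
qed

section \<open>Existence of a factor A with A A^T = S\<close>

lemma quadratic_form_Suc:
  fixes v :: "nat \<Rightarrow> real"
  assumes sym: "\<And>i. i < p \<Longrightarrow> S p i = S i p"
  shows "(\<Sum>i<Suc p. \<Sum>j<Suc p. v i * S i j * v j) =
    (\<Sum>i<p. \<Sum>j<p. v i * S i j * v j) + 2 * v p * (\<Sum>i<p. v i * S i p) + (v p)\<^sup>2 * S p p"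
proof -
  have "(\<Sum>i<Suc p. \<Sum>j<Suc p. v i * S i j * v j) =
    (\<Sum>i<p. \<Sum>j<p. v i * S i j * v j) + (\<Sum>i<p. v i * S i p * v p) + ((\<Sum>j<p. v p * S p j * v j) + v p * S p p * v p)"
    by (simp add: sum.distrib)
  also have "(\<Sum>j<p. v p * S p j * v j) = v p * (\<Sum>i<p. v i * S i p)"
    unfolding sum_distrib_left by (intro sum.cong refl) (simp add: sym)
  also have "(\<Sum>i<p. v i * S i p * v p) = v p * (\<Sum>i<p. v i * S i p)"
    unfolding sum_distrib_left by (intro sum.cong refl) simp
  finally show ?thesis by (simp add: power2_eq_square algebra_simps)
qed

text \<open>Induction by Schur complements: removing the last index leaves \<open>S'\<close>, again
  positive semidefinite, whose factor is bordered by the column S i p / sqrt c. If the pivot c is 0,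
  the whole last column of S vanishes, and division by 0 yielding 0 makes the same formulas
  valid.\<close>

lemma cholesky_exists:
  assumes "covariance_matrix p S"
  shows "\<exists>A. \<forall>i<p. \<forall>j<p. (\<Sum>k<p. A i k * A j k) = S i j"
  using assms
proof (induction p arbitrary: S)
  case 0
  then show ?case by simp
next
  case (Suc p)
  define c where "c = S p p"
  have sym: "S i j = S j i" if "i < Suc p" "j < Suc p" for i j
    using Suc.prems that unfolding covariance_matrix_def by blast
  have psd: "0 \<le> (\<Sum>i<p. \<Sum>j<p. v i * S i j * v j) + 2 * v p * (\<Sum>i<p. v i * S i p) + (v p)\<^sup>2 * c" for v :: "nat \<Rightarrow> real"
  proof -
    have "0 \<le> (\<Sum>i<Suc p. \<Sum>j<Suc p. v i * S i j * v j)"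
      using Suc.prems unfolding covariance_matrix_def by blast
    then show ?thesis by (subst (asm) quadratic_form_Suc) (use sym in \<open>auto simp: c_def\<close>)
  qed
  have c0: "0 \<le> c" using psd[of "\<lambda>i. if i = p then 1 else 0"] by simp
  \<comment> \<open>With pivot 0 the form at e_i + s e_p is S i i + 2 s S i p, linear in s;
    \<open>s\<close> is chosen to make it -1 if S i p is nonzero.\<close>
  have cz: "S i p = 0" if "c = 0" "i < p" for i
  proof (rule ccontr)
    assume nz: "S i p \<noteq> 0"
    define s where "s = - (S i i + 1) / (2 * S i p)"
    define v where "v k = (if k = i then 1 else if k = p then s else 0)" for k
    have v1: "v k = (if k = i then 1 else 0)" if "k < p" for k using that by (simp add: v_def)
    have "(\<Sum>k<p. \<Sum>j<p. v k * S k j * v j) = S i i"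
    proof -
      have "(\<Sum>k<p. \<Sum>j<p. v k * S k j * v j) = (\<Sum>k<p. \<Sum>j<p. if j = i then (if k = i then S k j else 0) else 0)"
        by (intro sum.cong refl) (simp add: v1)
      then show ?thesis using that by simp
    qed
    moreover have "(\<Sum>k<p. v k * S k p) = S i p"
    proof -
      have "(\<Sum>k<p. v k * S k p) = (\<Sum>k<p. if k = i then S k p else 0)" by (intro sum.cong refl) (simp add: v1)
      then show ?thesis using that by simp
    qed
    moreover have "v p = s" using that by (simp add: v_def)
    ultimately have "0 \<le> S i i + 2 * s * S i p" using psd[of v] \<open>c = 0\<close> by simp
    moreover have "2 * s * S i p = - (S i i + 1)" using nz by (simp add: s_def)
    ultimately show False by simp
  qed
  define S' where "S' i j = S i j - S i p * S j p / c" for i j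
  have "covariance_matrix p S'"
    unfolding covariance_matrix_def
  proof (intro conjI allI impI)
    show "S' i j = S' j i" if "i < p" "j < p" for i j using sym[of i j] that by (simp add: S'_def)
    fix v :: "nat \<Rightarrow> real"
    define b where "b = (\<Sum>i<p. v i * S i p)"
    \<comment> \<open>For nonzero pivot, the last coordinate that minimizes the quadratic form for
      given v; its minimum is the form of the Schur complement.\<close>
    define w where "w = v(p := - b / c)"
    have w1: "w k = v k" if "k < p" for k using that by (simp add: w_def)
    have "0 \<le> (\<Sum>i<p. \<Sum>j<p. w i * S i j * w j) + 2 * w p * (\<Sum>i<p. w i * S i p) + (w p)\<^sup>2 * c" by (rule psd)
    also have "(\<Sum>i<p. \<Sum>j<p. w i * S i j * w j) = (\<Sum>i<p. \<Sum>j<p. v i * S i j * v j)"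
      by (intro sum.cong refl) (simp add: w1)
    also have "(\<Sum>i<p. w i * S i p) = b" unfolding b_def by (intro sum.cong refl) (simp add: w1)
    finally have "0 \<le> (\<Sum>i<p. \<Sum>j<p. v i * S i j * v j) - b * b / c"
      by (cases "c = 0") (simp_all add: w_def power2_eq_square)
    also have "b * b / c = (\<Sum>i<p. \<Sum>j<p. v i * (S i p * S j p / c) * v j)"
      unfolding b_def sum_product sum_divide_distrib by (intro sum.cong refl) simp
    also have "(\<Sum>i<p. \<Sum>j<p. v i * S i j * v j) - \<dots> = (\<Sum>i<p. \<Sum>j<p. v i * S' i j * v j)"
      unfolding S'_def by (simp add: sum_subtractf[symmetric] algebra_simps)
    finally show "0 \<le> (\<Sum>i<p. \<Sum>j<p. v i * S' i j * v j)" .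
  qed
  then obtain A' where A': "\<And>i j. i < p \<Longrightarrow> j < p \<Longrightarrow> (\<Sum>k<p. A' i k * A' j k) = S' i j" using Suc.IH by blast
  define A where "A i k = (if k < p then (if i < p then A' i k else 0) else (if i < p then S i p / sqrt c else sqrt c))" for i k
  have sc: "sqrt c * sqrt c = c" using c0 by simp
  have col: "S i p / sqrt c * sqrt c = S i p" if "i < p" for i
    using cz[OF _ that] by (cases "c = 0") auto
  have "(\<Sum>k<Suc p. A i k * A j k) = S i j" if ij: "i < Suc p" "j < Suc p" for i j
  proof -
    consider "i < p" "j < p" | "i < p" "j = p" | "i = p" "j < p" | "i = p" "j = p" using ij by linarith
    then show ?thesis
    proof cases
      case 1
      have "(\<Sum>k<p. A i k * A j k) = S' i j" using A'[OF 1] 1 by (simp add: A_def)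
      moreover have "A i p * A j p = S i p * S j p / c"
        using 1 sc by (simp add: A_def)
      ultimately show ?thesis by (simp add: S'_def)
    next
      case 2
      then show ?thesis using col[of i] by (simp add: A_def)
    next
      case 3
      then show ?thesis using col[of j] sym[of j p] by (simp add: A_def mult.commute)
    next
      case 4
      then show ?thesis using sc by (simp add: A_def c_def)
    qed
  qed
  then show ?case by blast
qed

lemma sqrt_factor_eq:
  assumes "covariance_matrix p S" "i < p" "j < p"
  shows "(\<Sum>k<p. sqrt_factor p S i k * sqrt_factor p S j k) = S i j"
  using someI_ex[OF cholesky_exists[OF assms(1)]] assms(2,3) unfolding sqrt_factor_def by blast

section \<open>The contaminated regression model\<close>

lemma sets_mixture [simp]: "sets (mixture \<epsilon> P Q) = sets P"
  unfolding mixture_def by (simp add: sets.sigma_sets_eq sets.space_closed)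

lemma space_mixture [simp]: "space (mixture \<epsilon> P Q) = space P"
  by (rule sets_eq_imp_space_eq) simp

lemma emeasure_mixture:
  assumes QP: "sets Q = sets P" and A: "A \<in> sets P"
  shows "emeasure (mixture \<epsilon> P Q) A = ennreal (1 - \<epsilon>) * emeasure P A + ennreal \<epsilon> * emeasure Q A"
proof -
  have "countably_additive (sets P) (\<lambda>A. ennreal (1 - \<epsilon>) * emeasure P A + ennreal \<epsilon> * emeasure Q A)"
    unfolding countably_additive_def
  proof (intro allI impI)
    fix F :: "nat \<Rightarrow> 'a set" assume F: "range F \<subseteq> sets P" "disjoint_family F" "\<Union>(range F) \<in> sets P"
    have "(\<Sum>i. emeasure P (F i)) = emeasure P (\<Union>(range F))" using F by (intro suminf_emeasure) auto
    moreover have "(\<Sum>i. emeasure Q (F i)) = emeasure Q (\<Union>(range F))" using F QP by (intro suminf_emeasure) auto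
    ultimately show "(\<Sum>i. ennreal (1 - \<epsilon>) * emeasure P (F i) + ennreal \<epsilon> * emeasure Q (F i)) =
        ennreal (1 - \<epsilon>) * emeasure P (\<Union>(range F)) + ennreal \<epsilon> * emeasure Q (\<Union>(range F))"
      by (simp add: suminf_add[symmetric] ennreal_suminf_cmult)
  qed
  then show ?thesis
    by (intro emeasure_measure_of[OF mixture_def]) (use A sets.space_closed in \<open>auto simp: positive_def sets.sigma_sets_eq\<close>)
qed

text \<open>Only this upper bound on the contaminated probability enters the argument: both uses
  concern events whose probability is to be bounded from above.\<close>

lemma mixture_prob:
  assumes P: "prob_space P" and Q: "prob_space Q" "sets Q = sets P" and \<epsilon>: "0 \<le> \<epsilon>" "\<epsilon> < 1"
  shows "prob_space (mixture \<epsilon> P Q)"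
    "A \<in> sets P \<Longrightarrow> measure (mixture \<epsilon> P Q) A \<le> measure P A + \<epsilon>"
proof -
  interpret P: prob_space P by fact
  interpret Q: prob_space Q by fact
  have m: "emeasure (mixture \<epsilon> P Q) A = ennreal ((1 - \<epsilon>) * measure P A + \<epsilon> * measure Q A)" if "A \<in> sets P" for A
    using \<epsilon> emeasure_mixture[OF Q(2) that]
    by (simp add: P.emeasure_eq_measure Q.emeasure_eq_measure ennreal_mult ennreal_plus)
  have sp: "space Q = space P" by (rule sets_eq_imp_space_eq) (rule Q)
  show "prob_space (mixture \<epsilon> P Q)"
    by (rule prob_spaceI) (use m[of "space P"] sp P.prob_space Q.prob_space in simp)
  assume A: "A \<in> sets P"
  have "measure (mixture \<epsilon> P Q) A = (1 - \<epsilon>) * measure P A + \<epsilon> * measure Q A"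
    by (rule measure_eq_emeasure_eq_ennreal[OF _ m[OF A]]) (use \<epsilon> in simp)
  also have "\<dots> \<le> 1 * measure P A + \<epsilon> * 1" using \<epsilon> by (intro add_mono mult_mono) auto
  finally show "measure (mixture \<epsilon> P Q) A \<le> measure P A + \<epsilon>" by simp
qed

definition model_map :: "nat \<Rightarrow> nat \<Rightarrow> (nat \<Rightarrow> nat \<Rightarrow> real) \<Rightarrow> real \<Rightarrow> (nat \<Rightarrow> nat \<Rightarrow> real)
    \<Rightarrow> (nat \<Rightarrow> real) \<times> (nat \<Rightarrow> real) \<Rightarrow> (nat \<Rightarrow> real) \<times> (nat \<Rightarrow> real)" where
  "model_map p m A \<sigma> B = (\<lambda>(z, w). let x = (\<lambda>i\<in>{..<p}. \<Sum>k<p. A i k * z k)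
                  in (x, (\<lambda>j\<in>{..<m}. (\<Sum>i<p. B i j * x i) + \<sigma> * w j)))"

lemma P_model_eq: "P_model p m S \<sigma> B = distr (gauss_vec p \<Otimes>\<^sub>M gauss_vec m) (data_space p m) (model_map p m (sqrt_factor p S) \<sigma> B)"
  by (simp add: P_model_def model_map_def gauss_vec_def Let_def)

lemma model_map_measurable [measurable]:
  "model_map p m A \<sigma> B \<in> measurable (gauss_vec p \<Otimes>\<^sub>M gauss_vec m) (data_space p m)"
proof -
  note [measurable] = measurable_compose[OF measurable_fst measurable_gauss_vec_component]
    measurable_compose[OF measurable_snd measurable_gauss_vec_component]
  have x: "(\<lambda>\<omega>. \<Sum>k<p. A i k * fst \<omega> k) \<in> borel_measurable (gauss_vec p \<Otimes>\<^sub>M gauss_vec m)" for i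
    by measurable
  have "(\<lambda>\<omega>. ((\<lambda>i\<in>{..<p}. \<Sum>k<p. A i k * fst \<omega> k),
      (\<lambda>j\<in>{..<m}. (\<Sum>i<p. B i j * (\<Sum>k<p. A i k * fst \<omega> k)) + \<sigma> * snd \<omega> j)))
    \<in> measurable (gauss_vec p \<Otimes>\<^sub>M gauss_vec m) (data_space p m)"
    unfolding data_space_def vec_space_def by measurable
  moreover have "model_map p m A \<sigma> B = (\<lambda>\<omega>. ((\<lambda>i\<in>{..<p}. \<Sum>k<p. A i k * fst \<omega> k),
      (\<lambda>j\<in>{..<m}. (\<Sum>i<p. B i j * (\<Sum>k<p. A i k * fst \<omega> k)) + \<sigma> * snd \<omega> j)))"
    by (auto simp: model_map_def Let_def fun_eq_iff split_beta intro!: sum.cong)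
  ultimately show ?thesis by simp
qed

lemma sets_P_model [simp]: "sets (P_model p m S \<sigma> B) = sets (data_space p m)"
  by (simp add: P_model_eq)

lemma prob_space_P_model: "prob_space (P_model p m S \<sigma> B)"
proof -
  interpret P: prob_space "gauss_vec p" by (rule prob_space_gauss_vec)
  interpret W: prob_space "gauss_vec m" by (rule prob_space_gauss_vec)
  interpret PW: pair_prob_space "gauss_vec p" "gauss_vec m" ..
  show ?thesis unfolding P_model_eq by (rule PW.prob_space_distr) measurable
qed

text \<open>The matrix A^T U, so that U^T X = (A^T U)^T z for X = A z.\<close>

definition whiten :: "nat \<Rightarrow> (nat \<Rightarrow> nat \<Rightarrow> real) \<Rightarrow> (nat \<Rightarrow> nat \<Rightarrow> real) \<Rightarrow> nat \<Rightarrow> nat \<Rightarrow> real" where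
  "whiten p A U k j = (\<Sum>i<p. A i k * U i j)"

lemma col_form_whiten:
  "col_form p (whiten p A U) j z = (\<Sum>i<p. U i j * (\<Sum>k<p. A i k * z k))"
proof -
  have "col_form p (whiten p A U) j z = (\<Sum>k<p. \<Sum>i<p. U i j * (A i k * z k))"
    unfolding col_form_def whiten_def by (simp add: sum_distrib_left sum_distrib_right mult_ac)
  also have "\<dots> = (\<Sum>i<p. U i j * (\<Sum>k<p. A i k * z k))"
    by (subst sum.swap) (simp add: sum_distrib_left)
  finally show ?thesis .
qed

text \<open>The signal cancels in the residual: Y - B'^T X = \<sigma> w - (B' - B)^T X.\<close>

lemma reg_inner_model_map:
  "reg_inner p m U B' (fst (model_map p m A \<sigma> B (z, w))) (snd (model_map p m A \<sigma> B (z, w))) =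
    (\<Sum>j<m. col_form p (whiten p A U) j z * (\<sigma> * w j - col_form p (whiten p A (\<lambda>i j. B' i j - B i j)) j z))"
  unfolding reg_inner_def model_map_def Let_def col_form_whiten
  by (intro sum.cong refl arg_cong2[where f = "(*)"]) (simp_all add: left_diff_distrib sum_subtractf)

lemma measure_P_model:
  assumes "{\<omega>\<in>space (data_space p m). R \<omega>} \<in> sets (data_space p m)"
  shows "measure (P_model p m S \<sigma> B) {\<omega>\<in>space (data_space p m). R \<omega>} =
    measure (gauss_vec p \<Otimes>\<^sub>M gauss_vec m) {\<omega>\<in>space (gauss_vec p \<Otimes>\<^sub>M gauss_vec m). R (model_map p m (sqrt_factor p S) \<sigma> B \<omega>)}"
  unfolding P_model_eq using measurable_space[OF model_map_measurable]
  by (subst measure_distr[OF model_map_measurable assms]) (intro arg_cong[where f = "measure _"], auto)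

lemma data_space_component_measurable [measurable]:
  "i < p \<Longrightarrow> (\<lambda>\<omega>. fst \<omega> i) \<in> borel_measurable (data_space p m)"
  "j < m \<Longrightarrow> (\<lambda>\<omega>. snd \<omega> j) \<in> borel_measurable (data_space p m)"
  unfolding data_space_def vec_space_def by measurable

lemma reg_inner_measurable [measurable]:
  "(\<lambda>\<omega>. reg_inner p m U B (fst \<omega>) (snd \<omega>)) \<in> borel_measurable (data_space p m)"
  unfolding reg_inner_def by measurable

text \<open>D^T S D = (A^T D)^T (A^T D), so its trace is a squared Frobenius norm.\<close>

lemma trace_form_whiten:
  assumes "covariance_matrix p S"
  shows "trace_form p m S D = (\<Sum>k<p. \<Sum>j<m. (whiten p (sqrt_factor p S) D k j)\<^sup>2)"
proof -
  let ?A = "sqrt_factor p S"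
  have "trace_form p m S D = (\<Sum>j<m. \<Sum>i<p. \<Sum>k<p. D i j * (\<Sum>l<p. ?A i l * ?A k l) * D k j)"
    unfolding trace_form_def by (intro sum.cong refl) (simp add: sqrt_factor_eq[OF assms])
  also have "\<dots> = (\<Sum>j<m. \<Sum>l<p. (whiten p ?A D l j)\<^sup>2)"
  proof (rule sum.cong[OF refl])
    fix j
    have "(\<Sum>i<p. \<Sum>k<p. D i j * (\<Sum>l<p. ?A i l * ?A k l) * D k j) = (\<Sum>i<p. \<Sum>k<p. \<Sum>l<p. (?A i l * D i j) * (?A k l * D k j))"
      by (intro sum.cong refl) (simp add: sum_distrib_left sum_distrib_right mult_ac)
    also have "\<dots> = (\<Sum>i<p. \<Sum>l<p. \<Sum>k<p. (?A i l * D i j) * (?A k l * D k j))"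
      by (rule sum.cong[OF refl], rule sum.swap)
    also have "\<dots> = (\<Sum>l<p. \<Sum>i<p. \<Sum>k<p. (?A i l * D i j) * (?A k l * D k j))" by (rule sum.swap)
    also have "\<dots> = (\<Sum>l<p. (whiten p ?A D l j)\<^sup>2)"
      by (simp add: whiten_def power2_eq_square sum_product)
    finally show "(\<Sum>i<p. \<Sum>k<p. D i j * (\<Sum>l<p. ?A i l * ?A k l) * D k j) = (\<Sum>l<p. (whiten p ?A D l j)\<^sup>2)" .
  qed
  also have "\<dots> = (\<Sum>k<p. \<Sum>j<m. (whiten p ?A D k j)\<^sup>2)" by (rule sum.swap)
  finally show ?thesis .
qed

text \<open>The Rayleigh-quotient bound applied to each column of D. The product form keeps the
  statement meaningful for \<open>kappa p S = 0\<close>.\<close>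

lemma kappa_frob_sq_le:
  assumes S: "covariance_matrix p S"
  shows "(kappa p S)\<^sup>2 * frob_sq p m D \<le> trace_form p m S D"
proof -
  have psd: "0 \<le> (\<Sum>i<p. \<Sum>k<p. v i * S i k * v k)" for v :: "nat \<Rightarrow> real"
    using S unfolding covariance_matrix_def by blast
  have col: "(kappa p S)\<^sup>2 * (\<Sum>i<p. (v i)\<^sup>2) \<le> (\<Sum>i<p. \<Sum>k<p. v i * S i k * v k)" for v
  proof (cases "\<exists>i<p. v i \<noteq> 0")
    case False
    then have "(\<Sum>i<p. (v i)\<^sup>2) = 0" by simp
    then show ?thesis using psd[of v] by simp
  next
    case True
    then obtain i where i: "i < p" "v i \<noteq> 0" by blast
    have "0 < (v i)\<^sup>2" using i by simp
    also have "\<dots> \<le> (\<Sum>i<p. (v i)\<^sup>2)" using i by (intro member_le_sum) auto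
    finally have pos: "0 < (\<Sum>i<p. (v i)\<^sup>2)" .
    let ?q = "\<lambda>v. sqrt (\<Sum>i<p. \<Sum>k<p. v i * S i k * v k) / sqrt (\<Sum>i<p. (v i)\<^sup>2)"
    have nn: "0 \<le> ?q u" for u using psd[of u] by (intro divide_nonneg_nonneg) (auto intro: sum_nonneg)
    have "kappa p S \<le> ?q v" unfolding kappa_def
      by (rule cINF_lower) (use True nn in \<open>auto intro!: bdd_belowI[of _ 0]\<close>)
    moreover have "0 \<le> kappa p S" unfolding kappa_def
      by (rule cINF_greatest) (use True nn in auto)
    ultimately have "(kappa p S)\<^sup>2 \<le> (?q v)\<^sup>2" by (intro power_mono)
    also have "\<dots> = (\<Sum>i<p. \<Sum>k<p. v i * S i k * v k) / (\<Sum>i<p. (v i)\<^sup>2)"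
      using psd[of v] pos by (simp add: power_divide)
    finally show ?thesis using pos by (simp add: pos_le_divide_eq)
  qed
  have "(kappa p S)\<^sup>2 * frob_sq p m D = (\<Sum>j<m. (kappa p S)\<^sup>2 * (\<Sum>i<p. (D i j)\<^sup>2))"
    unfolding frob_sq_def by (subst sum.swap) (simp add: sum_distrib_left)
  also have "\<dots> \<le> trace_form p m S D" unfolding trace_form_def by (intro sum_mono col)
  finally show ?thesis .
qed

text \<open>The depth of \<open>B\<close> is bounded below through the open complementary side,
  since the deviation inequality bounds empirical frequencies only from above. Given z, the form is
  either a symmetric Gaussian, negative with probability 1/2, or identically 0, in which case the
  open side is empty.\<close>

lemma model_negative_side_le:
  assumes \<sigma>: "0 < \<sigma>"
  shows "measure (P_model p m S \<sigma> B) {\<omega>\<in>space (data_space p m). reg_inner p m U B (fst \<omega>) (snd \<omega>) < 0} \<le> 1 / 2"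
proof -
  let ?P = "gauss_vec p" and ?W = "gauss_vec m"
  interpret P: prob_space ?P by (rule prob_space_gauss_vec)
  interpret W: prob_space ?W by (rule prob_space_gauss_vec)
  interpret PW: pair_prob_space ?P ?W ..
  let ?V = "whiten p (sqrt_factor p S) U"
  define N where "N = {\<omega>\<in>space (?P \<Otimes>\<^sub>M ?W). (\<Sum>j<m. col_form p ?V j (fst \<omega>) * snd \<omega> j) < 0}"
  note [measurable] = measurable_compose[OF measurable_fst col_form_measurable]
    measurable_compose[OF measurable_snd measurable_gauss_vec_component]
  have Ns[measurable]: "N \<in> sets (?P \<Otimes>\<^sub>M ?W)" unfolding N_def by measurable
  have zero: "col_form p (whiten p A (\<lambda>i j. 0)) j z = 0" for A j z by (simp add: col_form_def whiten_def)
  have "measure (P_model p m S \<sigma> B) {\<omega>\<in>space (data_space p m). reg_inner p m U B (fst \<omega>) (snd \<omega>) < 0} =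
     measure (?P \<Otimes>\<^sub>M ?W) {\<omega>\<in>space (?P \<Otimes>\<^sub>M ?W). reg_inner p m U B (fst (model_map p m (sqrt_factor p S) \<sigma> B \<omega>)) (snd (model_map p m (sqrt_factor p S) \<sigma> B \<omega>)) < 0}"
    by (rule measure_P_model) measurable
  also have "{\<omega>\<in>space (?P \<Otimes>\<^sub>M ?W). reg_inner p m U B (fst (model_map p m (sqrt_factor p S) \<sigma> B \<omega>)) (snd (model_map p m (sqrt_factor p S) \<sigma> B \<omega>)) < 0} = N"
  proof -
    have "reg_inner p m U B (fst (model_map p m (sqrt_factor p S) \<sigma> B \<omega>)) (snd (model_map p m (sqrt_factor p S) \<sigma> B \<omega>))
      = \<sigma> * (\<Sum>j<m. col_form p ?V j (fst \<omega>) * snd \<omega> j)" for \<omega>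
      using reg_inner_model_map[of p m U B "sqrt_factor p S" \<sigma> B "fst \<omega>" "snd \<omega>"]
      by (simp add: zero sum_distrib_left mult_ac)
    then show ?thesis using \<sigma> by (simp add: N_def mult_less_0_iff)
  qed
  also have "measure (?P \<Otimes>\<^sub>M ?W) N \<le> 1 / 2"
  proof -
    have "emeasure ?W (Pair z -` N) \<le> ennreal (1 / 2)" if z: "z \<in> space ?P" for z
    proof -
      define R where "R = (\<Sum>j<m. (col_form p ?V j z)\<^sup>2)"
      have eq: "Pair z -` N = {w\<in>space ?W. (\<Sum>j<m. col_form p ?V j z * w j) < 0}"
        using z by (auto simp: N_def space_pair_measure)
      show ?thesis
      proof (cases "R = 0")
        case True
        then have "\<forall>j<m. col_form p ?V j z = 0" unfolding R_def by (subst (asm) sum_nonneg_eq_0_iff) auto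
        then have "Pair z -` N = {}" unfolding eq by simp
        then show ?thesis by simp
      next
        case False
        then have R: "0 < R" using sum_nonneg[of "{..<m}" "\<lambda>j. (col_form p ?V j z)\<^sup>2"] by (simp add: R_def)
        have d: "distr ?W borel (\<lambda>w. (\<Sum>j<m. col_form p ?V j z * w j) / sqrt R) = std_gauss"
          using distr_gauss_linear_form[where p = m and v = "\<lambda>j. col_form p ?V j z"] R unfolding R_def by simp
        interpret G: prob_space std_gauss by (rule prob_space_std_gauss)
        have "emeasure ?W (Pair z -` N) = emeasure std_gauss {..<0}"
          unfolding d[symmetric] eq using R
          by (subst emeasure_distr) (auto intro!: arg_cong[where f = "emeasure ?W"] simp: divide_less_0_iff)
        also have "\<dots> = ennreal (measure std_gauss (space std_gauss - {0..}))"
          unfolding G.emeasure_eq_measure by (intro arg_cong[where f = "\<lambda>A. ennreal (measure std_gauss A)"]) auto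
        also have "measure std_gauss (space std_gauss - {0..}) = 1 / 2"
          using gauss_tail_0 by (subst G.prob_compl) (auto simp: gauss_tail_def)
        finally show ?thesis by simp
      qed
    qed
    then have "(\<integral>\<^sup>+z. emeasure ?W (Pair z -` N) \<partial>?P) \<le> (\<integral>\<^sup>+z. ennreal (1 / 2) \<partial>?P)"
      by (intro nn_integral_mono)
    also have "\<dots> = ennreal (1 / 2)" by (simp add: P.emeasure_space_1)
    finally have "emeasure (?P \<Otimes>\<^sub>M ?W) N \<le> ennreal (1 / 2)"
      by (subst W.emeasure_pair_measure_alt[OF Ns])
    then show ?thesis unfolding PW.emeasure_eq_measure by (subst (asm) ennreal_le_iff) auto
  qed
  finally show ?thesis .
qed

lemma model_shifted_side_le:
  fixes p m :: nat and S B B' :: "nat \<Rightarrow> nat \<Rightarrow> real"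
  defines "V \<equiv> whiten p (sqrt_factor p S)"
  assumes \<sigma>: "0 < \<sigma>" and T: "0 < T" and U: "(\<Sum>k<p. \<Sum>j<m. (V U k j)\<^sup>2) = 1"
    and near: "(\<Sum>k<p. \<Sum>j<m. (V (\<lambda>i j. B' i j - B i j) k j - T * V U k j)\<^sup>2) \<le> (T / 100000)\<^sup>2"
  shows "measure (P_model p m S \<sigma> B) {\<omega>\<in>space (data_space p m). 0 \<le> reg_inner p m U B' (fst \<omega>) (snd \<omega>)}
    \<le> 1 / 2 - min (T / \<sigma>) 1 / 400"
proof -
  let ?P = "gauss_vec p" and ?W = "gauss_vec m"
  have "measure (P_model p m S \<sigma> B) {\<omega>\<in>space (data_space p m). 0 \<le> reg_inner p m U B' (fst \<omega>) (snd \<omega>)} =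
    measure (?P \<Otimes>\<^sub>M ?W) {\<omega>\<in>space (?P \<Otimes>\<^sub>M ?W). 0 \<le> reg_inner p m U B' (fst (model_map p m (sqrt_factor p S) \<sigma> B \<omega>)) (snd (model_map p m (sqrt_factor p S) \<sigma> B \<omega>))}"
    by (rule measure_P_model) measurable
  also have "{\<omega>\<in>space (?P \<Otimes>\<^sub>M ?W). 0 \<le> reg_inner p m U B' (fst (model_map p m (sqrt_factor p S) \<sigma> B \<omega>)) (snd (model_map p m (sqrt_factor p S) \<sigma> B \<omega>))}
    = {(z, w)\<in>space (?P \<Otimes>\<^sub>M ?W). 0 \<le> (\<Sum>j<m. col_form p (V U) j z * (\<sigma> * w j - col_form p (V (\<lambda>i j. B' i j - B i j)) j z))}"
    by (auto simp: reg_inner_model_map V_def)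
  also have "measure (?P \<Otimes>\<^sub>M ?W) \<dots> \<le> 1 / 2 - min (T / \<sigma>) 1 / 400"
    by (rule gauss_regression_halfspace_le[OF U T \<sigma> near])
  finally show ?thesis .
qed

section \<open>Depth of the maximizer\<close>

text \<open>The good event intersects one event for \<open>B\<close> and all U at once with one
  event for each net direction and all B' at once; the union bound over \<open>1 + card N\<close>
  events produces the first factor of the failure probability. On it, 1/2 - \<epsilon> - t is at
  most the depth of \<open>Bh\<close>, which is at most 1/2 - min (T / \<sigma>) 1 / 400 +
  \<epsilon> + t.\<close>

lemma regression_depth_core:
  fixes p m n :: nat and S B :: "nat \<Rightarrow> nat \<Rightarrow> real" and \<sigma> \<epsilon> t :: real
    and Q :: "((nat \<Rightarrow> real) \<times> (nat \<Rightarrow> real)) measure"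
  defines "M \<equiv> PiM {..<n} (\<lambda>_. mixture \<epsilon> (P_model p m S \<sigma> B) Q)"
  assumes pm: "1 \<le> p" "1 \<le> m" and n: "1 \<le> n" and \<sigma>: "0 < \<sigma>" and S: "covariance_matrix p S"
    and \<epsilon>: "0 \<le> \<epsilon>" "\<epsilon> < 1" and Q: "prob_space Q" "sets Q = sets (data_space p m)"
    and t: "0 < t" "48000 * real (p * m) \<le> real n * t\<^sup>2"
  shows "\<exists>E\<in>sets M. 1 - (1 + (4 * exp 100001) ^ (p * m)) * (12 * exp (- (real n * t\<^sup>2 / 1600))) \<le> measure M E \<and>
    (\<forall>\<omega>\<in>E. \<forall>Bh. is_depth_maximizer p m n \<omega> Bh \<longrightarrow>
      min (sqrt (trace_form p m S (\<lambda>i j. Bh i j - B i j)) / \<sigma>) 1 \<le> 800 * (\<epsilon> + t))"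
proof -
  define A where "A = sqrt_factor p S"
  define V where "V = whiten p A"
  define P0 where "P0 = P_model p m S \<sigma> B"
  define P where "P = mixture \<epsilon> P0 Q"
  have P0: "prob_space P0" "sets P0 = sets (data_space p m)" by (simp_all add: P0_def prob_space_P_model)
  have sP: "sets P = sets (data_space p m)" by (simp add: P_def P0)
  have spP: "space P = space (data_space p m)" by (rule sets_eq_imp_space_eq[OF sP])
  have mP: "borel_measurable P = borel_measurable (data_space p m)" by (rule measurable_cong_sets[OF sP refl])
  have P: "prob_space P" unfolding P_def by (rule mixture_prob) (use P0 Q \<epsilon> in simp_all)
  have PP0: "measure P X \<le> measure P0 X + \<epsilon>" if "X \<in> sets (data_space p m)" for X
    unfolding P_def by (rule mixture_prob) (use P0 Q \<epsilon> that in simp_all)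
  interpret M: prob_space M unfolding M_def P0_def[symmetric] P_def[symmetric] by (rule prob_space_PiM) (rule P)
  have M_eq: "M = PiM {..<n} (\<lambda>_. P)" by (simp add: M_def P_def P0_def)
  define \<delta> where "\<delta> = 12 * exp (- (real n * t\<^sup>2 / 1600))"
  have n0: "0 < n" using n by simp
  have d1: "1 \<le> p * m" using pm by simp
  \<comment> \<open>The constant 48000 is 3 times 16000, since p m + 2 <= 3 p m.\<close>
  have t16: "16000 * real (p * m + 2) \<le> real n * t\<^sup>2"
  proof -
    have "real (p * m + 2) \<le> 3 * real (p * m)" using d1 by linarith
    moreover have "16000 * x \<le> y" if "x \<le> 3 * z" "48000 * z \<le> y" for x y z :: real
      using that by linarith
    ultimately show ?thesis using t(2) by blast
  qed
  let ?reg = "\<lambda>U B' \<omega>. reg_inner p m U B' (fst \<omega>) (snd \<omega>)"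
  have "\<exists>E\<in>sets M. 1 - \<delta> \<le> measure M E \<and> (\<forall>\<omega>\<in>E. \<forall>U.
      real (card {k\<in>{..<n}. ?reg U B (\<omega> k) < 0}) \<le> real n * (measure P {x\<in>space P. ?reg U B x < 0} + t))"
  proof -
    \<comment> \<open>At fixed \<open>B\<close> the form is linear in U; the minus sign in
      \<open>?f\<close> turns its negative side into a strict positivity set.\<close>
    let ?off = "\<lambda>\<omega>::(nat \<Rightarrow> real) \<times> (nat \<Rightarrow> real). 0::real"
    let ?f = "\<lambda>i j \<omega>. - (fst \<omega> i * (snd \<omega> j - (\<Sum>i<p. B i j * fst \<omega> i)))"
    have eq: "?off \<omega> + (\<Sum>j<m. \<Sum>i<p. U i j * ?f i j \<omega>) = - ?reg U B \<omega>" for U \<omega>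
      unfolding reg_inner_def by (simp add: sum_distrib_right sum_negf mult.assoc)
    have fm: "?off \<in> borel_measurable P" "\<And>i j. i < p \<Longrightarrow> j < m \<Longrightarrow> ?f i j \<in> borel_measurable P"
      unfolding mP by measurable
    from affine_uniform_deviation[where off = ?off and f = ?f, OF P fm n0 t(1) t16, unfolded eq]
    obtain E where E: "E \<in> sets M" "1 - \<delta> \<le> measure M E"
      "\<And>\<omega> U. \<omega> \<in> E \<Longrightarrow> real (card {k\<in>{..<n}. 0 < - ?reg U B (\<omega> k)}) \<le> real n * (measure P {x\<in>space P. 0 < - ?reg U B x} + t)"
      unfolding M_eq[symmetric] \<delta>_def by blast
    show ?thesis by (rule bexI[OF _ E(1)]) (use E(2,3) in simp)
  qed
  then obtain E0 where E0: "E0 \<in> sets M" "1 - \<delta> \<le> measure M E0"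
    "\<And>\<omega> U. \<omega> \<in> E0 \<Longrightarrow> real (card {k\<in>{..<n}. ?reg U B (\<omega> k) < 0}) \<le> real n * (measure P {x\<in>space P. ?reg U B x < 0} + t)"
    by blast
  have EU: "\<exists>E\<in>sets M. 1 - \<delta> \<le> measure M E \<and> (\<forall>\<omega>\<in>E. \<forall>B'.
      real (card {k\<in>{..<n}. 0 \<le> ?reg U B' (\<omega> k)}) \<le> real n * (measure P {x\<in>space P. 0 \<le> ?reg U B' x} + t))" for U
  proof -
    \<comment> \<open>At fixed \<open>U\<close> the form is affine in B': the response term is the
      offset, and the coefficient functions are quadratic in the covariates only.\<close>
    let ?off = "\<lambda>\<omega>. \<Sum>j<m. (\<Sum>i<p. U i j * fst \<omega> i) * snd \<omega> j"
    let ?f = "\<lambda>i j \<omega>. - ((\<Sum>i<p. U i j * fst \<omega> i) * fst \<omega> i)"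
    have eq: "?off \<omega> + (\<Sum>j<m. \<Sum>i<p. B' i j * ?f i j \<omega>) = ?reg U B' \<omega>" for B' \<omega>
    proof -
      have "(\<Sum>i<p. B' i j * ?f i j \<omega>) = - ((\<Sum>i<p. U i j * fst \<omega> i) * (\<Sum>i<p. B' i j * fst \<omega> i))" for j
        unfolding sum_distrib_left[of "\<Sum>i<p. U i j * fst \<omega> i"] sum_negf[symmetric]
        by (intro sum.cong refl) simp
      then show ?thesis unfolding reg_inner_def by (simp add: right_diff_distrib sum_subtractf sum_negf)
    qed
    have fm: "?off \<in> borel_measurable P" "\<And>i j. i < p \<Longrightarrow> j < m \<Longrightarrow> ?f i j \<in> borel_measurable P"
      unfolding mP by measurable
    from affine_uniform_deviation[where off = ?off and f = ?f, OF P fm n0 t(1) t16, unfolded eq]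
    obtain E where E: "E \<in> sets M" "1 - \<delta> \<le> measure M E"
      "\<And>\<omega> B'. \<omega> \<in> E \<Longrightarrow> real (card {k\<in>{..<n}. 0 \<le> ?reg U B' (\<omega> k)}) \<le> real n * (measure P {x\<in>space P. 0 \<le> ?reg U B' x} + t)"
      unfolding M_eq[symmetric] \<delta>_def by blast
    show ?thesis by (rule bexI[OF _ E(1)]) (use E(2,3) in simp)
  qed
  \<comment> \<open>The net is taken inside the set of whitened admissible directions, so every net
    point has a preimage \<open>u g\<close> that occurs in the infimum defining the depth.\<close>
  define \<U> where "\<U> = {U\<in>nonzero_mats p m. (\<Sum>k<p. \<Sum>j<m. (V U k j)\<^sup>2) = 1}"
  define I where "I = {..<p} \<times> {..<m}"
  have I: "finite I" "I \<noteq> {}" "card I = p * m" using pm by (auto simp: I_def lessThan_empty_iff)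
  have sumI: "(\<Sum>(k, j)\<in>I. h k j) = (\<Sum>k<p. \<Sum>j<m. h k j)" for h :: "nat \<Rightarrow> nat \<Rightarrow> real"
    unfolding I_def by (simp add: sum.cartesian_product)
  define flat where "flat U = (\<lambda>(k, j). V U k j)" for U
  have "\<exists>N\<subseteq>flat ` \<U>. finite N \<and> real (card N) \<le> (4 * exp (1 / (1 / 100000) + 1)) ^ card I \<and>
    (\<forall>f\<in>flat ` \<U>. \<exists>g\<in>N. (\<Sum>i\<in>I. (f i - g i)\<^sup>2) \<le> (1 / 100000)\<^sup>2)"
  proof (rule unit_ball_net[OF I(1,2)])
    fix f assume "f \<in> flat ` \<U>"
    then obtain U where U: "U \<in> \<U>" "f = flat U" by blast
    have "(\<Sum>i\<in>I. (f i)\<^sup>2) = (\<Sum>(k, j)\<in>I. (V U k j)\<^sup>2)" unfolding U(2) flat_def by (intro sum.cong) auto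
    then show "(\<Sum>i\<in>I. (f i)\<^sup>2) \<le> 1" using U(1) unfolding sumI by (simp add: \<U>_def)
  qed simp
  then obtain N where N: "N \<subseteq> flat ` \<U>" "finite N" "real (card N) \<le> (4 * exp 100001) ^ (p * m)"
    and net: "\<And>U. U \<in> \<U> \<Longrightarrow> \<exists>g\<in>N. (\<Sum>i\<in>I. (flat U i - g i)\<^sup>2) \<le> (1 / 100000)\<^sup>2"
    unfolding I(3) by auto
  have "\<forall>g\<in>N. \<exists>U. U \<in> \<U> \<and> flat U = g" using N(1) by blast
  then obtain u where u: "\<And>g. g \<in> N \<Longrightarrow> u g \<in> \<U>" "\<And>g. g \<in> N \<Longrightarrow> flat (u g) = g" by metis
  define EV where "EV U E \<longleftrightarrow> E \<in> sets M \<and> 1 - \<delta> \<le> measure M E \<and> (\<forall>\<omega>\<in>E. \<forall>B'.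
      real (card {k\<in>{..<n}. 0 \<le> ?reg U B' (\<omega> k)}) \<le> real n * (measure P {x\<in>space P. 0 \<le> ?reg U B' x} + t))" for U E
  have "\<exists>E. EV U E" for U using EU[of U] unfolding EV_def by blast
  then have "\<exists>F. \<forall>U. EV U (F U)" by (intro choice allI)
  then obtain F where F: "\<And>U. EV U (F U)" by blast
  have Fs: "F U \<in> sets M" "1 - \<delta> \<le> measure M (F U)" for U using F[of U] by (auto simp: EV_def)
  have FB: "real (card {k\<in>{..<n}. 0 \<le> ?reg U B' (\<omega> k)}) \<le> real n * (measure P {x\<in>space P. 0 \<le> ?reg U B' x} + t)"
    if "\<omega> \<in> F U" for \<omega> U B' using F[of U] that by (auto simp: EV_def)
  define bad where "bad = (space M - E0) \<union> (\<Union>g\<in>N. space M - F (u g))"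
  have UNs: "(\<Union>g\<in>N. space M - F (u g)) \<in> sets M"
    by (rule sets.finite_UN[OF N(2)]) (rule sets.compl_sets[OF Fs(1)])
  have bads: "bad \<in> sets M" unfolding bad_def by (intro sets.Un sets.compl_sets E0(1) UNs)
  have "measure M bad \<le> measure M (space M - E0) + measure M (\<Union>g\<in>N. space M - F (u g))"
    unfolding bad_def by (intro measure_Un_le sets.compl_sets E0(1) UNs)
  also have "measure M (\<Union>g\<in>N. space M - F (u g)) \<le> (\<Sum>g\<in>N. measure M (space M - F (u g)))"
    by (rule measure_UNION_le[OF N(2)]) (use Fs in auto)
  also have "\<dots> \<le> (\<Sum>g\<in>N. \<delta>)" 
  proof (rule sum_mono)
    fix g
    show "measure M (space M - F (u g)) \<le> \<delta>"
      using M.prob_compl[OF Fs(1)[of "u g"]] Fs(2)[of "u g"] by linarith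
  qed
  also have "measure M (space M - E0) \<le> \<delta>" using E0 M.prob_compl[OF E0(1)] by simp
  finally have "measure M bad \<le> (1 + real (card N)) * \<delta>" by (simp add: algebra_simps)
  also have "\<dots> \<le> (1 + (4 * exp 100001) ^ (p * m)) * \<delta>"
    by (intro mult_right_mono add_left_mono N(3)) (simp add: \<delta>_def)
  finally have bad: "measure M bad \<le> (1 + (4 * exp 100001) ^ (p * m)) * \<delta>" .
  show ?thesis
  proof (intro bexI[of _ "space M - bad"] conjI ballI allI impI)
    show "space M - bad \<in> sets M" using bads by simp
    show "1 - (1 + (4 * exp 100001) ^ (p * m)) * (12 * exp (- (real n * t\<^sup>2 / 1600))) \<le> measure M (space M - bad)"
      using bad M.prob_compl[OF bads] unfolding \<delta>_def by linarith
  next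
    fix \<omega> Bh assume \<omega>: "\<omega> \<in> space M - bad" and max: "is_depth_maximizer p m n \<omega> Bh"
    have \<omega>0: "\<omega> \<in> E0" and \<omega>N: "\<And>g. g \<in> N \<Longrightarrow> \<omega> \<in> F (u g)" using \<omega> by (auto simp: bad_def)
    define T where "T = sqrt (trace_form p m S (\<lambda>i j. Bh i j - B i j))"
    have rm: "{x\<in>space P. ?reg U B' x < 0} \<in> sets (data_space p m)"
      "{x\<in>space P. 0 \<le> ?reg U B' x} \<in> sets (data_space p m)" for U B'
      unfolding spP by measurable
    have ne: "nonzero_mats p m \<noteq> {}"
    proof -
      have "(\<lambda>i j. if i = 0 \<and> j = 0 then 1 else 0) \<in> nonzero_mats p m"
        using pm by (auto simp: nonzero_mats_def intro!: exI[of _ 0])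
      then show ?thesis by blast
    qed
    have low: "1 / 2 - \<epsilon> - t \<le> real (card {i\<in>{..<n}. 0 \<le> ?reg U B (\<omega> i)}) / real n" for U
    proof -
      have "measure P {x\<in>space P. ?reg U B x < 0} \<le> 1 / 2 + \<epsilon>"
        using PP0[OF rm(1), of U B] model_negative_side_le[OF \<sigma>, of p m S B U] unfolding P0_def spP by linarith
      then have "real n * (measure P {x\<in>space P. ?reg U B x < 0} + t) \<le> real n * (1 / 2 + \<epsilon> + t)"
        by (intro mult_left_mono) auto
      then have neg: "real (card {k\<in>{..<n}. ?reg U B (\<omega> k) < 0}) \<le> real n * (1 / 2 + \<epsilon> + t)"
        using E0(3)[OF \<omega>0, of U] by linarith
      have "{i\<in>{..<n}. 0 \<le> ?reg U B (\<omega> i)} \<union> {k\<in>{..<n}. ?reg U B (\<omega> k) < 0} = {..<n}" by auto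
      then have "n = card ({i\<in>{..<n}. 0 \<le> ?reg U B (\<omega> i)} \<union> {k\<in>{..<n}. ?reg U B (\<omega> k) < 0})" by simp
      also have "\<dots> = card {i\<in>{..<n}. 0 \<le> ?reg U B (\<omega> i)} + card {k\<in>{..<n}. ?reg U B (\<omega> k) < 0}"
        by (rule card_Un_disjoint) auto
      finally have "real n = real (card {i\<in>{..<n}. 0 \<le> ?reg U B (\<omega> i)}) + real (card {k\<in>{..<n}. ?reg U B (\<omega> k) < 0})"
        by linarith
      then have "real n * (1 / 2 - \<epsilon> - t) \<le> real (card {i\<in>{..<n}. 0 \<le> ?reg U B (\<omega> i)})"
        using neg by (simp add: algebra_simps)
      then show ?thesis using n0 by (simp add: pos_le_divide_eq mult.commute)
    qed
    have "1 / 2 - \<epsilon> - t \<le> emp_depth p m n \<omega> B"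
      unfolding emp_depth_def by (rule cINF_greatest[OF ne]) (rule low)
    also have "\<dots> \<le> emp_depth p m n \<omega> Bh" using max unfolding is_depth_maximizer_def by blast
    finally have depth: "1 / 2 - \<epsilon> - t \<le> emp_depth p m n \<omega> Bh" .
    have depthU: "1 / 2 - \<epsilon> - t \<le> real (card {i\<in>{..<n}. 0 \<le> ?reg U Bh (\<omega> i)}) / real n" if "U \<in> nonzero_mats p m" for U
    proof -
      have "emp_depth p m n \<omega> Bh \<le> real (card {i\<in>{..<n}. 0 \<le> ?reg U Bh (\<omega> i)}) / real n"
        unfolding emp_depth_def by (rule cINF_lower[OF _ that]) (auto intro!: bdd_belowI[of _ 0])
      then show ?thesis using depth by linarith
    qed
    have tf: "trace_form p m S (\<lambda>i j. Bh i j - B i j) = (\<Sum>k<p. \<Sum>j<m. (V (\<lambda>i j. Bh i j - B i j) k j)\<^sup>2)"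
      unfolding V_def A_def by (rule trace_form_whiten[OF S])
    show "min (sqrt (trace_form p m S (\<lambda>i j. Bh i j - B i j)) / \<sigma>) 1 \<le> 800 * (\<epsilon> + t)"
    proof (cases "T = 0")
      case True
      then show ?thesis using \<epsilon> t unfolding T_def by simp
    next
      case False
      have "0 \<le> trace_form p m S (\<lambda>i j. Bh i j - B i j)" unfolding tf by (intro sum_nonneg) simp
      then have T: "0 < T" "T\<^sup>2 = trace_form p m S (\<lambda>i j. Bh i j - B i j)" using False by (auto simp: T_def)
      \<comment> \<open>The direction \<Delta> / T, padded by zeros outside the p x m block as
        \<open>nonzero_mats\<close> demands. It is nonzero because its whitened form has norm
        1.\<close>
      define W where "W i j = (if i < p \<and> j < m then (Bh i j - B i j) / T else 0)" for i j
      have VW: "V W k j = V (\<lambda>i j. Bh i j - B i j) k j / T" if "j < m" for k j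
        unfolding V_def whiten_def sum_divide_distrib by (intro sum.cong refl) (use that in \<open>simp add: W_def\<close>)
      have W1: "(\<Sum>k<p. \<Sum>j<m. (V W k j)\<^sup>2) = 1"
      proof -
        have "(\<Sum>k<p. \<Sum>j<m. (V W k j)\<^sup>2) = (\<Sum>k<p. \<Sum>j<m. (V (\<lambda>i j. Bh i j - B i j) k j)\<^sup>2) / T\<^sup>2"
          unfolding sum_divide_distrib by (intro sum.cong refl) (simp add: VW power_divide)
        then show ?thesis unfolding tf[symmetric] T(2)[symmetric] using T(1) by simp
      qed
      have "W \<in> nonzero_mats p m"
      proof -
        have "\<exists>i<p. \<exists>j<m. W i j \<noteq> 0"
        proof (rule ccontr)
          assume "\<not> ?thesis"
          then have "V W k j = 0" if "j < m" for k j using that by (simp add: V_def whiten_def)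
          then show False using W1 by simp
        qed
        then show ?thesis by (auto simp: nonzero_mats_def W_def)
      qed
      then have "W \<in> \<U>" using W1 by (simp add: \<U>_def)
      from net[OF this] obtain g where g: "g \<in> N" "(\<Sum>i\<in>I. (flat W i - g i)\<^sup>2) \<le> (1 / 100000)\<^sup>2" by blast
      define U where "U = u g"
      have U: "U \<in> nonzero_mats p m" "(\<Sum>k<p. \<Sum>j<m. (V U k j)\<^sup>2) = 1" "flat U = g"
        using u[OF g(1)] by (auto simp: U_def \<U>_def)
      have "(\<Sum>i\<in>I. (flat W i - g i)\<^sup>2) = (\<Sum>(k, j)\<in>I. (V W k j - V U k j)\<^sup>2)"
        unfolding U(3)[symmetric] flat_def by (intro sum.cong) auto
      then have near: "(\<Sum>k<p. \<Sum>j<m. (V W k j - V U k j)\<^sup>2) \<le> (1 / 100000)\<^sup>2" using g(2) unfolding sumI by simp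
      have "(\<Sum>k<p. \<Sum>j<m. (V (\<lambda>i j. Bh i j - B i j) k j - T * V U k j)\<^sup>2) = T\<^sup>2 * (\<Sum>k<p. \<Sum>j<m. (V W k j - V U k j)\<^sup>2)"
        unfolding sum_distrib_left
        by (intro sum.cong refl) (use T(1) in \<open>simp add: VW power_mult_distrib[symmetric] right_diff_distrib\<close>)
      also have "\<dots> \<le> T\<^sup>2 * (1 / 100000)\<^sup>2" by (intro mult_left_mono near) simp
      also have "\<dots> = (T / 100000)\<^sup>2" by (simp add: power_divide)
      finally have nearT: "(\<Sum>k<p. \<Sum>j<m. (V (\<lambda>i j. Bh i j - B i j) k j - T * V U k j)\<^sup>2) \<le> (T / 100000)\<^sup>2" .
      have "measure P0 {x\<in>space P. 0 \<le> ?reg U Bh x} \<le> 1 / 2 - min (T / \<sigma>) 1 / 400"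
        unfolding P0_def spP by (rule model_shifted_side_le[OF \<sigma> T(1)]) (use U(2) nearT in \<open>simp_all add: V_def A_def\<close>)
      then have "measure P {x\<in>space P. 0 \<le> ?reg U Bh x} \<le> 1 / 2 - min (T / \<sigma>) 1 / 400 + \<epsilon>"
        using PP0[OF rm(2), of U Bh] by linarith
      then have "real n * (measure P {x\<in>space P. 0 \<le> ?reg U Bh x} + t) \<le> real n * (1 / 2 - min (T / \<sigma>) 1 / 400 + \<epsilon> + t)"
        by (intro mult_left_mono) auto
      then have "real (card {k\<in>{..<n}. 0 \<le> ?reg U Bh (\<omega> k)}) \<le> real n * (1 / 2 - min (T / \<sigma>) 1 / 400 + \<epsilon> + t)"
        using FB[OF \<omega>N[OF g(1)], of Bh] unfolding U_def by linarith
      then have "real (card {k\<in>{..<n}. 0 \<le> ?reg U Bh (\<omega> k)}) / real n \<le> 1 / 2 - min (T / \<sigma>) 1 / 400 + \<epsilon> + t"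
        using n0 by (simp add: pos_divide_le_eq mult.commute)
      moreover have "x \<le> 800 * (\<epsilon> + t)" if "y \<le> 1 / 2 - x / 400 + \<epsilon> + t" "1 / 2 - \<epsilon> - t \<le> y" for x y
        using that by (simp add: field_simps)
      ultimately have "min (T / \<sigma>) 1 \<le> 800 * (\<epsilon> + t)" using depthU[OF U(1)] by blast
      then show ?thesis unfolding T_def .
    qed
  qed
qed

section \<open>Choice of the constants\<close>

theorem theorem7:
  "\<exists>c0>0. \<exists>C>0. \<exists>C'>0. \<forall>(p::nat) (m::nat) (n::nat) S (\<sigma>::real) (\<epsilon>::real) B Q.
     1 \<le> p \<and> 1 \<le> m \<and> 1 \<le> n \<and> 0 < \<sigma> \<and> covariance_matrix p S \<and>
     0 \<le> \<epsilon> \<and> \<epsilon> < 1 \<and> prob_space Q \<and> sets Q = sets (data_space p m) \<and>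
     \<epsilon>\<^sup>2 + real (p * m) / real n \<le> c0 \<longrightarrow>
     (let M = PiM {..<n} (\<lambda>_. mixture \<epsilon> (P_model p m S \<sigma> B) Q);
          r = max (real (p * m) / real n) (\<epsilon>\<^sup>2) in
      \<exists>E\<in>sets M. measure M E \<ge> 1 - exp (- C' * (real (p * m) + real n * \<epsilon>\<^sup>2)) \<and>
        (\<forall>\<omega>\<in>E. \<forall>Bh. is_depth_maximizer p m n \<omega> Bh \<longrightarrow>
            trace_form p m S (\<lambda>i j. Bh i j - B i j) \<le> C * \<sigma>\<^sup>2 * r \<and>
            (kappa p S)\<^sup>2 * frob_sq p m (\<lambda>i j. Bh i j - B i j) \<le> C * \<sigma>\<^sup>2 * r))"
proof -
  define K :: real where "K = 4 * exp 100001"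
  have K: "1 \<le> K" using one_le_exp_iff[of "100001::real"] unfolding K_def by linarith
  \<comment> \<open>The summand 48000 meets the requirement on n t^2. The other one, divided by 1600
    in the tail exponent, cancels the logarithm ln (24 K) per dimension of the union bound and
    leaves a surplus.\<close>
  define K1 where "K1 = 48000 + 1600 * (1 + ln (24 * K))"
  have lnK: "0 \<le> ln (24 * K)" using K by simp
  have K1: "48000 \<le> K1" using lnK by (simp add: K1_def)
  \<comment> \<open>Makes 1280000 (1 + K1) c0 = 1/2, so that (800 (\<epsilon> + t))^2 < 1.\<close>
  define c0 where "c0 = 1 / (2560000 * (1 + K1))"
  define C where "C = 2560000 * (1 + K1)"
  have main: "\<exists>E\<in>sets M. measure M E \<ge> 1 - exp (- 1 * (real (p * m) + real n * \<epsilon>\<^sup>2)) \<and>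
        (\<forall>\<omega>\<in>E. \<forall>Bh. is_depth_maximizer p m n \<omega> Bh \<longrightarrow>
            trace_form p m S (\<lambda>i j. Bh i j - B i j) \<le> C * \<sigma>\<^sup>2 * r \<and>
            (kappa p S)\<^sup>2 * frob_sq p m (\<lambda>i j. Bh i j - B i j) \<le> C * \<sigma>\<^sup>2 * r)"
    if a: "1 \<le> p" "1 \<le> m" "1 \<le> n" "0 < \<sigma>" "covariance_matrix p S" "0 \<le> \<epsilon>" "\<epsilon> < 1"
      "prob_space Q" "sets Q = sets (data_space p m)" "\<epsilon>\<^sup>2 + real (p * m) / real n \<le> c0"
      and M: "M = PiM {..<n} (\<lambda>_. mixture \<epsilon> (P_model p m S \<sigma> B) Q)"
      and r: "r = max (real (p * m) / real n) (\<epsilon>\<^sup>2)"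
    for p m n :: nat and S B :: "nat \<Rightarrow> nat \<Rightarrow> real" and \<sigma> \<epsilon> r :: real
      and Q :: "((nat \<Rightarrow> real) \<times> (nat \<Rightarrow> real)) measure" and M
  proof -
    define s where "s = \<epsilon>\<^sup>2 + real (p * m) / real n"
    \<comment> \<open>With this choice n t^2 = K1 (p m + n \<epsilon>^2), so the tail exponent has
      the form claimed in the theorem.\<close>
    define t where "t = sqrt (K1 * s)"
    define d where "d = real (p * m)"
    have d: "1 \<le> d" unfolding d_def using a(1,2) by (metis One_nat_def Suc_leI mult_pos_pos of_nat_1 of_nat_mono less_eq_Suc_le)
    have n: "0 < real n" using a(3) by simp
    have s: "0 < s" unfolding s_def d_def[symmetric] using d n by (intro add_nonneg_pos) auto
    have t: "0 < t" "t\<^sup>2 = K1 * s" using s K1 by (auto simp: t_def)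
    have nt: "real n * t\<^sup>2 = K1 * (d + real n * \<epsilon>\<^sup>2)" using n by (simp add: t(2) s_def d_def field_simps)
    have t48: "48000 * real (p * m) \<le> real n * t\<^sup>2"
    proof -
      have "48000 * d \<le> K1 * (d + real n * \<epsilon>\<^sup>2)" using K1 d n by (intro mult_mono) auto
      then show ?thesis by (simp add: nt d_def)
    qed
    obtain E where E: "E \<in> sets M" "1 - (1 + K ^ (p * m)) * (12 * exp (- (real n * t\<^sup>2 / 1600))) \<le> measure M E"
      and conc: "\<And>\<omega> Bh. \<omega> \<in> E \<Longrightarrow> is_depth_maximizer p m n \<omega> Bh \<Longrightarrow>
        min (sqrt (trace_form p m S (\<lambda>i j. Bh i j - B i j)) / \<sigma>) 1 \<le> 800 * (\<epsilon> + t)"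
      using regression_depth_core[OF a(1-9) t(1) t48, of B] unfolding M K_def by blast
    have fail: "(1 + K ^ (p * m)) * (12 * exp (- (real n * t\<^sup>2 / 1600))) \<le> exp (- 1 * (real (p * m) + real n * \<epsilon>\<^sup>2))"
    proof -
      define D where "D = d + real n * \<epsilon>\<^sup>2"
      have D: "d \<le> D" by (simp add: D_def)
      \<comment> \<open>The whole prefactor becomes a pure power, whose logarithm is linear in p m
        and can be compared with the tail exponent.\<close>
      have "(1 + K ^ (p * m)) * 12 \<le> (24 * K) ^ (p * m)"
      proof -
        have pm: "1 \<le> p * m" using a(1,2) by simp
        have "1 \<le> K ^ (p * m)" using K by simp
        then have "(1 + K ^ (p * m)) * 12 \<le> 24 * K ^ (p * m)" by simp
        also have "\<dots> \<le> 24 ^ (p * m) * K ^ (p * m)"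
          using K power_increasing[OF pm, of "24::real"] by (intro mult_right_mono) auto
        finally show ?thesis by (simp add: power_mult_distrib)
      qed
      also have "\<dots> = exp (d * ln (24 * K))"
      proof -
        have "24 * K = exp (ln (24 * K))" using K by simp
        then have "(24 * K) ^ (p * m) = exp (ln (24 * K)) ^ (p * m)" by (simp only:)
        then show ?thesis by (simp add: exp_of_nat_mult[symmetric] d_def)
      qed
      also have "\<dots> \<le> exp (D * ln (24 * K))" using D lnK by (simp add: mult_right_mono)
      finally have "(1 + K ^ (p * m)) * 12 * exp (- (real n * t\<^sup>2 / 1600)) \<le> exp (D * ln (24 * K)) * exp (- (real n * t\<^sup>2 / 1600))"
        by (intro mult_right_mono) auto
      also have "\<dots> = exp (D * ln (24 * K) - K1 * D / 1600)"
        unfolding nt D_def[symmetric] by (simp only: exp_add[symmetric]) simp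
      \<comment> \<open>K1 / 1600 = 30 + 1 + ln (24 K); more than the one unit of D needed for C' =
        1 is left.\<close>
      also have "D * ln (24 * K) - K1 * D / 1600 = - (31 * D)" by (simp add: K1_def field_simps)
      also have "exp (- (31 * D)) \<le> exp (- D)" using D d by simp
      finally have "(1 + K ^ (p * m)) * 12 * exp (- (real n * t\<^sup>2 / 1600)) \<le> exp (- D)" .
      moreover have "- 1 * (real (p * m) + real n * \<epsilon>\<^sup>2) = - D" by (simp add: D_def d_def)
      ultimately show ?thesis by (simp only: mult.assoc)
    qed
    show ?thesis
    proof (rule bexI[OF _ E(1)], intro conjI ballI allI impI)
      show "1 - exp (- 1 * (real (p * m) + real n * \<epsilon>\<^sup>2)) \<le> measure M E" using E(2) fail by linarith
      fix \<omega> Bh assume \<omega>: "\<omega> \<in> E" "is_depth_maximizer p m n \<omega> Bh"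
      let ?tf = "trace_form p m S (\<lambda>i j. Bh i j - B i j)"
      define T where "T = sqrt ?tf"
      have "?tf \<ge> 0" unfolding trace_form_whiten[OF a(5)] by (intro sum_nonneg) simp
      then have T: "0 \<le> T" "T\<^sup>2 = ?tf" by (auto simp: T_def)
      have sq: "(800 * (\<epsilon> + t))\<^sup>2 \<le> 1280000 * (1 + K1) * s"
      proof -
        have "(\<epsilon> + t)\<^sup>2 \<le> 2 * (\<epsilon>\<^sup>2 + t\<^sup>2)"
          using sum_squares_bound[of \<epsilon> t] by (simp add: power2_sum)
        also have "\<dots> \<le> 2 * (s + K1 * s)" unfolding t(2) by (simp add: s_def)
        finally have "640000 * (\<epsilon> + t)\<^sup>2 \<le> 640000 * (2 * (s + K1 * s))" by (rule mult_left_mono) simp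
        moreover have "(800 * (\<epsilon> + t))\<^sup>2 = 640000 * (\<epsilon> + t)\<^sup>2" by (simp only: power_mult_distrib) simp
        moreover have "640000 * (2 * (s + K1 * s)) = 1280000 * (1 + K1) * s" by (simp add: algebra_simps)
        ultimately show ?thesis by (simp only:)
      qed
      have "1280000 * (1 + K1) * s \<le> 1280000 * (1 + K1) * c0"
        using a(10) K1 unfolding s_def by (intro mult_left_mono) auto
      also have "\<dots> < 1" using K1 by (simp add: c0_def)
      \<comment> \<open>This excludes that the minimum in \<open>conc\<close> equals 1, so the bound
        holds for T / \<sigma> itself.\<close>
      finally have "(800 * (\<epsilon> + t))\<^sup>2 < 1\<^sup>2" using sq by simp
      then have "800 * (\<epsilon> + t) < 1" by (rule power_less_imp_less_base) simp
      then have "T / \<sigma> \<le> 800 * (\<epsilon> + t)" using conc[OF \<omega>] unfolding T_def by (simp add: min_def split: if_splits)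
      then have "(T / \<sigma>)\<^sup>2 \<le> (800 * (\<epsilon> + t))\<^sup>2" using T a(4) by (intro power_mono) auto
      also have "\<dots> \<le> 1280000 * (1 + K1) * s" by (rule sq)
      \<comment> \<open>The sum s is at most twice the maximum r; this factor 2 is the one in
        \<open>C\<close>.\<close>
      also have "\<dots> \<le> 1280000 * (1 + K1) * (2 * r)" 
      proof (rule mult_left_mono)
        have "real (p * m) / real n \<le> r" "\<epsilon>\<^sup>2 \<le> r" unfolding r by (rule max.cobounded1, rule max.cobounded2)
        then show "s \<le> 2 * r" unfolding s_def by linarith
      qed (use K1 in simp)
      finally have "T\<^sup>2 / \<sigma>\<^sup>2 \<le> C * r" by (simp add: power_divide C_def algebra_simps)
      then show tf: "?tf \<le> C * \<sigma>\<^sup>2 * r" using a(4) T by (simp add: pos_divide_le_eq mult_ac)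
      show "(kappa p S)\<^sup>2 * frob_sq p m (\<lambda>i j. Bh i j - B i j) \<le> C * \<sigma>\<^sup>2 * r"
        using kappa_frob_sq_le[OF a(5), of m "\<lambda>i j. Bh i j - B i j"] tf by linarith
    qed
  qed
  have pos: "0 < c0" "0 < C" using K1 by (simp_all add: c0_def C_def)
  show ?thesis
  proof (rule exI[of _ c0], rule conjI[OF pos(1)], rule exI[of _ C], rule conjI[OF pos(2)],
      rule exI[of _ 1], rule conjI[OF zero_less_one], intro allI impI)
    fix p m n :: nat and S B :: "nat \<Rightarrow> nat \<Rightarrow> real" and \<sigma> \<epsilon> :: real
      and Q :: "((nat \<Rightarrow> real) \<times> (nat \<Rightarrow> real)) measure"
    assume a: "1 \<le> p \<and> 1 \<le> m \<and> 1 \<le> n \<and> 0 < \<sigma> \<and> covariance_matrix p S \<and>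
     0 \<le> \<epsilon> \<and> \<epsilon> < 1 \<and> prob_space Q \<and> sets Q = sets (data_space p m) \<and>
     \<epsilon>\<^sup>2 + real (p * m) / real n \<le> c0"
    show "let M = PiM {..<n} (\<lambda>_. mixture \<epsilon> (P_model p m S \<sigma> B) Q);
          r = max (real (p * m) / real n) (\<epsilon>\<^sup>2) in
      \<exists>E\<in>sets M. measure M E \<ge> 1 - exp (- 1 * (real (p * m) + real n * \<epsilon>\<^sup>2)) \<and>
        (\<forall>\<omega>\<in>E. \<forall>Bh. is_depth_maximizer p m n \<omega> Bh \<longrightarrow>
            trace_form p m S (\<lambda>i j. Bh i j - B i j) \<le> C * \<sigma>\<^sup>2 * r \<and>
            (kappa p S)\<^sup>2 * frob_sq p m (\<lambda>i j. Bh i j - B i j) \<le> C * \<sigma>\<^sup>2 * r)"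
      unfolding Let_def by (rule main[OF _ _ _ _ _ _ _ _ _ _ refl refl]) (use a in blast)+
  qed
qed

end
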